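(* Let $\frac{1}{16}<\omega<\frac14$ and let $\chi\in H^1(\mathbb{R}^3)$ be a positive function such that $S_\omega(\chi)=S_\omega^{\min}$. Then $\chi$ is a radially symmetric function (i.e. $\chi(x)$ depends only on $|x|$).
   Context: For $\chi\in H^1=H^1(\mathbb{R}^3)$ and $\omega>0$, the action functional is $$S_\omega(\chi)=\frac12\|\nabla\chi\|_{L^2}^2+\frac14 A(|\chi|^2)-\frac12\int_{\mathbb{R}^3}\frac{|\chi(x)|^2}{|x|}\,dx+\frac{\omega}{2}\|\chi\|_{L^2}^2,$$ where $$A(f)=\int_{\mathbb{R}^3}\int_{\mathbb{R}^3}\frac{f(x)f(y)}{|x-y|}\,dy\,dx,$$ and $S_\omega^{\min}=\min\{S_\omega(\chi):\chi\in H^1(\mathbb{R}^3)\}$. *)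

theory Defs
  imports "HOL-Analysis.Analysis"
begin

text \<open>
  Elements of \<open>L\<^sup>2\<close> and \<open>H\<^sup>1\<close> are represented by Lebesgue measurable functions; everything
  said below about such a function is invariant under changes on a null set.
\<close>

definition L2 :: "(real^3 \<Rightarrow> 'b::euclidean_space) set" where
  "L2 = {f \<in> borel_measurable lebesgue. integrable lebesgue (\<lambda>x. (norm (f x))\<^sup>2)}"

definition L2_norm :: "(real^3 \<Rightarrow> 'b::euclidean_space) \<Rightarrow> real" where
  "L2_norm f = sqrt (LINT x|lebesgue. (norm (f x))\<^sup>2)"

definition partial_deriv :: "3 \<Rightarrow> (real^3 \<Rightarrow> real) \<Rightarrow> real^3 \<Rightarrow> real" where
  "partial_deriv i f x = frechet_derivative f (at x) (axis i 1)"

primrec Ck :: "nat \<Rightarrow> (real^3 \<Rightarrow> real) \<Rightarrow> bool" where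
  "Ck 0 f \<longleftrightarrow> continuous_on UNIV f"
| "Ck (Suc k) f \<longleftrightarrow> (\<forall>x. f differentiable (at x)) \<and> (\<forall>i. Ck k (partial_deriv i f))"

definition test_functions :: "(real^3 \<Rightarrow> real) set" where
  "test_functions = {\<phi>. (\<forall>k. Ck k \<phi>) \<and> compact (closure {x. \<phi> x \<noteq> 0})}"

definition is_weak_gradient :: "(real^3 \<Rightarrow> complex) \<Rightarrow> (real^3 \<Rightarrow> complex^3) \<Rightarrow> bool" where
  "is_weak_gradient u g \<longleftrightarrow>
     (\<forall>\<phi>\<in>test_functions. \<forall>i.
        (LINT x|lebesgue. partial_deriv i \<phi> x *\<^sub>R u x) = - (LINT x|lebesgue. \<phi> x *\<^sub>R (g x $ i)))"

definition H1 :: "(real^3 \<Rightarrow> complex) set" where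
  "H1 = {u \<in> L2. \<exists>g\<in>L2. is_weak_gradient u g}"

text \<open>The weak gradient is unique up to null sets, so integrals do not depend on the choice.\<close>

definition weak_gradient :: "(real^3 \<Rightarrow> complex) \<Rightarrow> real^3 \<Rightarrow> complex^3" where
  "weak_gradient u = (SOME g. g \<in> L2 \<and> is_weak_gradient u g)"

definition coulomb_energy :: "(real^3 \<Rightarrow> real) \<Rightarrow> real" where
  "coulomb_energy f = (LINT x|lebesgue. LINT y|lebesgue. f x * f y / norm (x - y))"

text \<open>
  For \<open>u \<in> H\<^sup>1\<close> every integral below converges (Hardy's inequality), so the convention that
  the Bochner integral of a non-integrable function is \<open>0\<close> is never used.
\<close>

definition action :: "real \<Rightarrow> (real^3 \<Rightarrow> complex) \<Rightarrow> real" where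
  "action \<omega> u =
     1/2 * (L2_norm (weak_gradient u))\<^sup>2
     + 1/4 * coulomb_energy (\<lambda>x. (cmod (u x))\<^sup>2)
     - 1/2 * (LINT x|lebesgue. (cmod (u x))\<^sup>2 / norm x)
     + \<omega>/2 * (L2_norm u)\<^sup>2"

text \<open>
  The minimum of the action, as a relation: a value of the action on \<open>H\<^sup>1\<close> that bounds all
  others from below. This avoids the arbitrary value of \<open>Inf\<close> or \<open>Least\<close> on real sets without
  a minimum.
\<close>

definition is_action_min :: "real \<Rightarrow> real \<Rightarrow> bool" where
  "is_action_min \<omega> m \<longleftrightarrow> m \<in> action \<omega> ` H1 \<and> (\<forall>u\<in>H1. m \<le> action \<omega> u)"

definition positive_fun :: "(real^3 \<Rightarrow> complex) \<Rightarrow> bool" where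
  "positive_fun u \<longleftrightarrow> (AE x in lebesgue. u x \<in> \<real> \<and> 0 < Re (u x))"

definition radially_symmetric :: "(real^3 \<Rightarrow> complex) \<Rightarrow> bool" where
  "radially_symmetric u \<longleftrightarrow> (\<exists>g. AE x in lebesgue. u x = g (norm x))"

end

theory Submission
  imports Defs
begin

text \<open>
  The action depends on a positive function \<open>u\<close> only through its density \<open>\<rho> = u\<^sup>2\<close>, and as a functional of \<open>\<rho>\<close> it is
  strictly convex: the attraction and the mass are linear, the kinetic energy \<open>\<parallel>\<nabla> sqrt \<rho>\<parallel>\<^sup>2\<close> is convex, and the
  Coulomb energy is a positive definite quadratic form. All terms are invariant under orthogonal
  transformations \<open>R\<close>. So if \<open>u\<close> is a minimizer, the midpoint of \<open>\<rho>\<close> and \<open>\<rho> \<circ> R\<close> would have strictly smaller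
  action unless \<open>\<rho> = \<rho> \<circ> R\<close>.

  Convexity of the kinetic energy is obtained without a chain rule for weak derivatives. A function in \<open>L\<^sup>2\<close> has
  a weak derivative in direction \<open>e\<close> of norm at most \<open>B\<close> exactly when its translations by \<open>t e\<close> move it by at most
  \<open>\<bar>t\<bar> B\<close> (\<open>translation_bound_of_weak_deriv\<close>, \<open>weak_deriv_of_translation_bound\<close>). For the root mean square of
  \<open>u\<close> and \<open>u \<circ> R\<close> such a bound is the pointwise triangle inequality (\<open>rms_H1\<close>). Both directions of the
  characterization rest on a Riesz representation on the space of test functions and on the fundamental lemma
  of the calculus of variations.

  Positive definiteness of the Coulomb energy comes from the formula of Fefferman and de la Llave, which writes
  the energy as a weighted integral of \<open>(\<integral>\<^sub>B \<rho>)\<^sup>2\<close> over all balls \<open>B\<close> (\<open>fefferman_de_la_llave\<close>). The resulting identity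
  involves only nonnegative integrands. It shows that \<open>\<rho>\<close> and \<open>\<rho> \<circ> R\<close> have the same mass in almost every ball
  (\<open>coulomb_strict_convexity\<close>). Since the translations of \<open>\<rho>\<close> are Lipschitz in \<open>L\<^sup>1\<close>, its averages over small balls
  converge to \<open>\<rho>\<close>, so \<open>\<rho> = \<rho> \<circ> R\<close> almost everywhere (\<open>minimizer_density_invariant\<close>). The same Lipschitz property
  gives a Hardy inequality and thereby the convergence of all integrals in the action
  (\<open>coulomb_potential_bound\<close>).

  The exceptional null set in \<open>\<rho> = \<rho> \<circ> R\<close> depends on \<open>R\<close>. The averages of \<open>\<rho>\<close> over balls, however, are radial
  functions of the centre without exception, and \<open>\<rho>\<close> is their limit.
\<close>

section \<open>Square-integrable functions and Riesz representation\<close>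

definition sq_integrable :: "'a measure \<Rightarrow> ('a \<Rightarrow> real) set" where
  "sq_integrable M = {f \<in> borel_measurable M. integrable M (\<lambda>x. (f x)\<^sup>2)}"

lemma sq_integrableI:
  "f \<in> borel_measurable M \<Longrightarrow> integrable M (\<lambda>x. (f x)\<^sup>2) \<Longrightarrow> f \<in> sq_integrable M"
  by (simp add: sq_integrable_def)

lemma sq_integrableD:
  assumes "f \<in> sq_integrable M"
  shows "f \<in> borel_measurable M" "integrable M (\<lambda>x. (f x)\<^sup>2)"
  using assms by (simp_all add: sq_integrable_def)

lemma sq_integrable_mult_integrable:
  assumes f: "f \<in> sq_integrable M" and g: "g \<in> sq_integrable M"
  shows "integrable M (\<lambda>x. f x * g x)"
proof (rule Bochner_Integration.integrable_bound)
  show "integrable M (\<lambda>x. (f x)\<^sup>2 + (g x)\<^sup>2)"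
    using f g by (intro Bochner_Integration.integrable_add) (auto dest: sq_integrableD)
  show "(\<lambda>x. f x * g x) \<in> borel_measurable M"
    using f g by (auto intro!: borel_measurable_times dest: sq_integrableD)
  have "norm (a * b) \<le> norm (a\<^sup>2 + b\<^sup>2)" for a b :: real
  proof -
    have "2 * (\<bar>a\<bar> * \<bar>b\<bar>) \<le> \<bar>a\<bar>\<^sup>2 + \<bar>b\<bar>\<^sup>2"
      using sum_squares_bound[of "\<bar>a\<bar>" "\<bar>b\<bar>"] by simp
    moreover have "0 \<le> \<bar>a\<bar> * \<bar>b\<bar>" by simp
    moreover have "norm (a * b) = \<bar>a\<bar> * \<bar>b\<bar>" by (simp add: abs_mult)
    ultimately show ?thesis by simp
  qed
  then show "AE x in M. norm (f x * g x) \<le> norm ((f x)\<^sup>2 + (g x)\<^sup>2)"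
    by blast
qed

lemma sq_integrable_lin:
  assumes f: "f \<in> sq_integrable M" and g: "g \<in> sq_integrable M"
  shows "(\<lambda>x. f x + c * g x) \<in> sq_integrable M"
proof (rule sq_integrableI)
  show "(\<lambda>x. f x + c * g x) \<in> borel_measurable M"
    using f g by (auto intro!: borel_measurable_times borel_measurable_add dest: sq_integrableD)
  have "integrable M (\<lambda>x. (f x)\<^sup>2 + 2 * c * (f x * g x) + c\<^sup>2 * (g x)\<^sup>2)"
    using f g sq_integrable_mult_integrable[OF f g]
    by (intro Bochner_Integration.integrable_add integrable_mult_right) (auto dest: sq_integrableD)
  then show "integrable M (\<lambda>x. (f x + c * g x)\<^sup>2)"
    by (simp add: power2_eq_square algebra_simps)
qed

lemma sq_integrable_add:
  "f \<in> sq_integrable M \<Longrightarrow> g \<in> sq_integrable M \<Longrightarrow> (\<lambda>x. f x + g x) \<in> sq_integrable M"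
  using sq_integrable_lin[of f M g 1] by simp

lemma sq_integrable_diff:
  "f \<in> sq_integrable M \<Longrightarrow> g \<in> sq_integrable M \<Longrightarrow> (\<lambda>x. f x - g x) \<in> sq_integrable M"
  using sq_integrable_lin[of f M g "-1"] by simp

lemma sq_integrable_zero: "(\<lambda>x. 0) \<in> sq_integrable M"
  by (simp add: sq_integrable_def)

lemma sq_integrable_cmult:
  "g \<in> sq_integrable M \<Longrightarrow> (\<lambda>x. c * g x) \<in> sq_integrable M"
  using sq_integrable_lin[OF sq_integrable_zero, of g M c] by simp

lemma sq_integrable_sum:
  "finite A \<Longrightarrow> (\<And>i. i \<in> A \<Longrightarrow> f i \<in> sq_integrable M) \<Longrightarrow> (\<lambda>x. \<Sum>i\<in>A. f i x) \<in> sq_integrable M"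
  by (induction A rule: finite_induct) (auto simp: sq_integrable_zero intro!: sq_integrable_add)

lemma integral_sq_lin:
  assumes f: "f \<in> sq_integrable M" and g: "g \<in> sq_integrable M"
  shows "(LINT x|M. (f x + t * g x)\<^sup>2)
    = (LINT x|M. (f x)\<^sup>2) + 2 * t * (LINT x|M. f x * g x) + t\<^sup>2 * (LINT x|M. (g x)\<^sup>2)"
proof -
  note [simp] = sq_integrableD(2)[OF f] sq_integrableD(2)[OF g] sq_integrable_mult_integrable[OF f g]
  have "(LINT x|M. (f x + t * g x)\<^sup>2) = (LINT x|M. (f x)\<^sup>2 + 2 * t * (f x * g x) + t\<^sup>2 * (g x)\<^sup>2)"
    by (intro Bochner_Integration.integral_cong) (auto simp: power2_eq_square algebra_simps)
  also have "\<dots> = (LINT x|M. (f x)\<^sup>2) + 2 * t * (LINT x|M. f x * g x) + t\<^sup>2 * (LINT x|M. (g x)\<^sup>2)"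
    by simp
  finally show ?thesis .
qed

lemma cauchy_schwarz_integral:
  assumes f: "f \<in> sq_integrable M" and g: "g \<in> sq_integrable M"
  shows "\<bar>LINT x|M. f x * g x\<bar> \<le> sqrt (LINT x|M. (f x)\<^sup>2) * sqrt (LINT x|M. (g x)\<^sup>2)"
proof -
  define a b c where "a = (LINT x|M. (f x)\<^sup>2)" and "b = (LINT x|M. f x * g x)" and "c = (LINT x|M. (g x)\<^sup>2)"
  have pos: "0 \<le> a + 2 * t * b + t\<^sup>2 * c" for t
    unfolding a_def b_def c_def integral_sq_lin[OF f g, symmetric] by simp
  have c0: "0 \<le> c" "0 \<le> a" unfolding c_def a_def by simp_all
  have "b\<^sup>2 \<le> a * c"
  proof (cases "c = 0")
    case True
    have "b = 0"
    proof (rule ccontr)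
      assume "b \<noteq> 0"
      then have "a + 2 * (-(a + 1) / (2 * b)) * b + 0 = - 1" by (simp add: field_simps)
      then show False using pos[of "-(a + 1) / (2 * b)"] True by simp
    qed
    then show ?thesis using True by simp
  next
    case False
    then have "c > 0" using c0 by simp
    have "a + 2 * (- b / c) * b + (- b / c)\<^sup>2 * c = a - b\<^sup>2 / c"
      using \<open>c > 0\<close> by (simp add: power2_eq_square field_simps)
    then have "b\<^sup>2 / c \<le> a" using pos[of "- b / c"] by simp
    then show ?thesis using \<open>c > 0\<close> by (simp add: field_simps)
  qed
  then have "\<bar>b\<bar> \<le> sqrt (a * c)" by (metis real_sqrt_abs real_sqrt_le_iff)
  then show ?thesis unfolding a_def b_def c_def by (simp add: real_sqrt_mult)
qed

text \<open>
  Completeness of \<open>L\<^sup>2\<close>. With \<open>a\<^sub>n = f\<^sub>n\<^sub>+\<^sub>1 - f\<^sub>n\<close>, the series \<open>\<Sum> 2\<^sup>n a\<^sub>n\<^sup>2\<close> has a finite integral, hence is finite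
  almost everywhere; there \<open>\<bar>a\<^sub>n\<bar>\<close> decays geometrically and the functions converge pointwise. Fatou's lemma
  turns pointwise convergence into the \<open>L\<^sup>2\<close> estimate.
\<close>

lemma sq_integrable_fast_Cauchy_limit:
  fixes f :: "nat \<Rightarrow> 'a \<Rightarrow> real"
  assumes f: "\<And>n. f n \<in> sq_integrable M"
    and Cauchy: "\<And>n m. n \<le> m \<Longrightarrow> (LINT x|M. (f m x - f n x)\<^sup>2) \<le> (1/4)^n"
  obtains g where "g \<in> sq_integrable M" "\<And>n. (LINT x|M. (f n x - g x)\<^sup>2) \<le> (1/4)^n"
proof -
  note [measurable] = sq_integrableD(1)[OF f]
  have nn: "(\<integral>\<^sup>+x. ennreal ((f m x - f n x)\<^sup>2) \<partial>M) \<le> ennreal ((1/4)^n)" if "n \<le> m" for n m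
    using Cauchy[OF that] sq_integrableD(2)[OF sq_integrable_diff[OF f f], of m n]
    by (subst nn_integral_eq_integral) (auto intro: ennreal_leI)
  \<comment> \<open>the weights \<open>2\<^sup>n\<close> still leave a convergent majorant, since the squared norms decay like \<open>4\<^bsup>-n\<^esup>\<close>\<close>
  define T where "T x = (\<Sum>n. ennreal (2^n * (f (Suc n) x - f n x)\<^sup>2))" for x
  have [measurable]: "T \<in> borel_measurable M" unfolding T_def by measurable
  have "(\<integral>\<^sup>+x. T x \<partial>M) = (\<Sum>n. \<integral>\<^sup>+x. ennreal (2^n * (f (Suc n) x - f n x)\<^sup>2) \<partial>M)"
    unfolding T_def by (subst nn_integral_suminf) auto
  also have "\<dots> = (\<Sum>n. ennreal (2^n) * (\<integral>\<^sup>+x. ennreal ((f (Suc n) x - f n x)\<^sup>2) \<partial>M))"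
    by (subst nn_integral_cmult[symmetric]) (auto simp: ennreal_mult)
  also have "\<dots> \<le> (\<Sum>n. ennreal (2^n) * ennreal ((1/4)^n))"
    by (intro suminf_le mult_left_mono nn) auto
  also have "\<dots> = (\<Sum>n. ennreal ((1/2)^n))"
    by (auto simp: ennreal_mult[symmetric] power_mult_distrib[symmetric])
  also have "\<dots> < \<infinity>"
    by (subst suminf_ennreal2) auto
  finally have "AE x in M. T x \<noteq> \<infinity>"
    by (intro nn_integral_noteq_infinite) auto
  then have conv: "AE x in M. convergent (\<lambda>n. f n x)"
  proof eventually_elim
    case (elim x)
    define B where "B = enn2real (T x)"
    have leT: "ennreal (2^n * (f (Suc n) x - f n x)\<^sup>2) \<le> T x" for n
    proof -
      have "(\<Sum>i\<in>{n}. ennreal (2^i * (f (Suc i) x - f i x)\<^sup>2)) \<le> T x"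
        unfolding T_def by (rule sum_le_suminf) auto
      then show ?thesis by simp
    qed
    have "2^n * (f (Suc n) x - f n x)\<^sup>2 \<le> B" for n
    proof -
      have "enn2real (ennreal (2^n * (f (Suc n) x - f n x)\<^sup>2)) \<le> B"
        unfolding B_def using elim by (intro enn2real_mono leT) (simp add: less_top)
      then show ?thesis by simp
    qed
    then have "(f (Suc n) x - f n x)\<^sup>2 \<le> B * (1/2)^n" for n
      by (simp add: field_simps)
    then have le: "\<bar>f (Suc n) x - f n x\<bar> \<le> sqrt B * sqrt (1/2)^n" for n
      by (metis real_sqrt_abs real_sqrt_le_iff real_sqrt_mult real_sqrt_power)
    have "summable (\<lambda>n. f (Suc n) x - f n x)"
    proof (rule summable_comparison_test[OF _ summable_mult[OF summable_geometric]])
      show "\<exists>N. \<forall>n\<ge>N. norm (f (Suc n) x - f n x) \<le> sqrt B * sqrt (1/2)^n" using le by auto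
      show "norm (sqrt (1/2)) < 1" by (simp add: real_sqrt_lt_1_iff)
    qed
    then have "convergent (\<lambda>n. (\<Sum>i<n. f (Suc i) x - f i x))"
      by (simp add: summable_iff_convergent)
    then have "convergent (\<lambda>n. f n x - f 0 x)" by (simp add: sum_lessThan_telescope[of "\<lambda>i. f i x"])
    then have "convergent (\<lambda>n. (f n x - f 0 x) + f 0 x)" by (intro convergent_add convergent_const)
    then show ?case by simp
  qed
  define g where "g x = lim (\<lambda>n. f n x)" for x
  have [measurable]: "g \<in> borel_measurable M" unfolding g_def by measurable
  have lim: "AE x in M. (\<lambda>n. f n x) \<longlonglongrightarrow> g x"
    using conv by eventually_elim (simp add: g_def convergent_LIMSEQ_iff)
  have fat: "(\<integral>\<^sup>+x. ennreal ((f n x - g x)\<^sup>2) \<partial>M) \<le> ennreal ((1/4)^n)" for n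
  proof -
    have "(\<integral>\<^sup>+x. ennreal ((f n x - g x)\<^sup>2) \<partial>M) = (\<integral>\<^sup>+x. liminf (\<lambda>m. ennreal ((f m x - f n x)\<^sup>2)) \<partial>M)"
    proof (rule nn_integral_cong_AE, use lim in eventually_elim)
      case (elim x)
      then have "(\<lambda>m. ennreal ((f m x - f n x)\<^sup>2)) \<longlonglongrightarrow> ennreal ((g x - f n x)\<^sup>2)"
        by (intro tendsto_ennrealI tendsto_intros)
      then have "liminf (\<lambda>m. ennreal ((f m x - f n x)\<^sup>2)) = ennreal ((g x - f n x)\<^sup>2)"
        by (intro lim_imp_Liminf) auto
      then show ?case by (simp add: power2_commute)
    qed
    also have "\<dots> \<le> liminf (\<lambda>m. \<integral>\<^sup>+x. ennreal ((f m x - f n x)\<^sup>2) \<partial>M)"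
      by (rule nn_integral_liminf) auto
    also have "\<dots> \<le> ennreal ((1/4)^n)"
    proof (rule order_trans[OF Liminf_le_Limsup])
      show "limsup (\<lambda>m. \<integral>\<^sup>+x. ennreal ((f m x - f n x)\<^sup>2) \<partial>M) \<le> ennreal ((1/4)^n)"
        by (rule Limsup_bounded) (auto simp: eventually_sequentially intro!: exI[of _ n] nn)
    qed auto
    finally show ?thesis .
  qed
  have d: "(\<lambda>x. f n x - g x) \<in> sq_integrable M" for n
    using fat[of n] by (intro sq_integrableI integrableI_bounded) (auto simp: le_less_trans)
  have "g \<in> sq_integrable M"
    using sq_integrable_diff[OF f[of 0] d[of 0]] by simp
  moreover have "(LINT x|M. (f n x - g x)\<^sup>2) \<le> (1/4)^n" for n
    using fat[of n] sq_integrableD(2)[OF d[of n]] by (subst (asm) nn_integral_eq_integral) auto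
  ultimately show thesis by (rule that)
qed

text \<open>
  Riesz representation for a functional that is bounded on a subspace of \<open>L\<^sup>2\<close>, which need not be closed.
  The functional \<open>J f = \<parallel>f\<parallel>\<^sup>2 - 2 L f\<close> is bounded below; by the parallelogram law a minimizing sequence is
  Cauchy, and the first variation of \<open>J\<close> at its limit says that the limit represents \<open>L\<close>. The limit lies
  in the closure of the subspace, which gives the bound on its norm.
\<close>

lemma riesz_representation_subspace:
  fixes V :: "('a \<Rightarrow> real) set" and L :: "('a \<Rightarrow> real) \<Rightarrow> real"
  assumes VL2: "V \<subseteq> sq_integrable M" and ne: "V \<noteq> {}"
    and lin: "\<And>f g c. f \<in> V \<Longrightarrow> g \<in> V \<Longrightarrow> (\<lambda>x. f x + c * g x) \<in> V"
    and Llin: "\<And>f g c. f \<in> V \<Longrightarrow> g \<in> V \<Longrightarrow> L (\<lambda>x. f x + c * g x) = L f + c * L g"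
    and bound: "\<And>f. f \<in> V \<Longrightarrow> \<bar>L f\<bar> \<le> B * sqrt (LINT x|M. (f x)\<^sup>2)" and B: "0 \<le> B"
  obtains g where "g \<in> sq_integrable M" "(LINT x|M. (g x)\<^sup>2) \<le> B\<^sup>2"
    "\<And>f. f \<in> V \<Longrightarrow> L f = (LINT x|M. f x * g x)"
proof -
  define N where "N f = (LINT x|M. (f x)\<^sup>2)" for f :: "'a \<Rightarrow> real"
  define J where "J f = N f - 2 * L f" for f
  have N0: "0 \<le> N f" for f unfolding N_def by simp
  have Jlow: "- B\<^sup>2 \<le> J f" if "f \<in> V" for f
  proof -
    have "L f \<le> B * sqrt (N f)" using bound[OF that] unfolding N_def by simp
    moreover have "0 \<le> (sqrt (N f) - B)\<^sup>2" by simp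
    moreover have "(sqrt (N f) - B)\<^sup>2 = N f - 2 * (B * sqrt (N f)) + B\<^sup>2"
      using N0[of f] by (simp add: power2_eq_square algebra_simps)
    ultimately show ?thesis unfolding J_def by linarith
  qed
  define I where "I = Inf (J ` V)"
  have bdd: "bdd_below (J ` V)" using Jlow by (auto intro!: bdd_belowI2)
  have Ile: "I \<le> J f" if "f \<in> V" for f
    unfolding I_def using bdd that by (intro cInf_lower) auto
  have "\<exists>f\<in>V. J f < I + (1/4)^n / 4" for n
  proof -
    have "Inf (J ` V) < I + (1/4)^n / 4" unfolding I_def by simp
    then show ?thesis using ne bdd by (subst (asm) cInf_less_iff) auto
  qed
  then obtain p where pV: "\<And>n. p n \<in> V" and pJ: "\<And>n. J (p n) < I + (1/4)^n / 4" by metis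
  have pL2: "p n \<in> sq_integrable M" for n using pV VL2 by auto
  \<comment> \<open>parallelogram law: \<open>\<parallel>p\<^sub>m - p\<^sub>n\<parallel>\<^sup>2 = 2 J p\<^sub>n + 2 J p\<^sub>m - 4 J s\<close> with the midpoint \<open>s\<close>, written as a step from \<open>p\<^sub>m\<close> so that closure under linear combinations applies\<close>
  have cau: "(LINT x|M. (p m x - p n x)\<^sup>2) \<le> (1/4)^n" if "n \<le> m" for n m
  proof -
    define s where "s = (\<lambda>x. p m x + (1/2) * (p n x + (-1) * p m x))"
    have d: "(\<lambda>x. p n x + (-1) * p m x) \<in> V" by (intro lin pV)
    have sV: "s \<in> V" unfolding s_def by (intro lin pV d)
    have ds: "(\<lambda>x. p n x + (-1) * p m x) \<in> sq_integrable M" using d VL2 by auto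
    have Ls: "L s = (L (p m) + L (p n)) / 2"
      unfolding s_def by (subst Llin[OF pV d], subst Llin[OF pV pV]) (simp add: field_simps)
    have s': "s = (\<lambda>x. (1/2) * p n x + (1/2) * p m x)" unfolding s_def by (auto simp: algebra_simps)
    have Ns: "4 * N s = N (p n) + 2 * (LINT x|M. p n x * p m x) + N (p m)"
    proof -
      have "N (\<lambda>x. 2 * s x) = N (\<lambda>x. p n x + 1 * p m x)" unfolding s' by (simp add: algebra_simps)
      moreover have "N (\<lambda>x. 2 * s x) = 4 * N s" unfolding N_def by (simp add: power_mult_distrib)
      ultimately show ?thesis using integral_sq_lin[OF pL2 pL2, of n 1 m] unfolding N_def by simp
    qed
    have "(LINT x|M. (p m x - p n x)\<^sup>2) = (LINT x|M. (p n x + (-1) * p m x)\<^sup>2)"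
      by (simp add: power2_commute)
    also have "\<dots> = N (p n) - 2 * (LINT x|M. p n x * p m x) + N (p m)"
      unfolding N_def by (subst integral_sq_lin[OF pL2 pL2]) simp
    also have "\<dots> = 2 * J (p n) + 2 * J (p m) - 4 * J s" using Ns Ls unfolding J_def by simp
    also have "\<dots> \<le> 2 * (I + (1/4)^n / 4) + 2 * (I + (1/4)^m / 4) - 4 * I"
    proof -
      have "2 * a + 2 * b - 4 * c \<le> 2 * (i + e) + 2 * (i + e') - 4 * i"
        if "a < i + e" "b < i + e'" "i \<le> c" for a b c i e e' :: real using that by simp
      from this[OF pJ[of n] pJ[of m] Ile[OF sV]] show ?thesis .
    qed
    also have "\<dots> \<le> (1/4)^n"
    proof -
      have "(1/4::real)^m \<le> (1/4)^n" using that by (intro power_decreasing) auto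
      then show ?thesis by argo
    qed
    finally show ?thesis .
  qed
  obtain g where gL2: "g \<in> sq_integrable M" and gn: "\<And>n. (LINT x|M. (p n x - g x)\<^sup>2) \<le> (1/4)^n"
    using sq_integrable_fast_Cauchy_limit[of p, OF pL2 cau] by blast
  have pair: "(\<lambda>n. LINT x|M. p n x * f x) \<longlonglongrightarrow> (LINT x|M. g x * f x)" if f: "f \<in> sq_integrable M" for f
  proof -
    have dle: "\<bar>(LINT x|M. p n x * f x) - (LINT x|M. g x * f x)\<bar> \<le> (1/2)^n * sqrt (N f)" for n
    proof -
      have "(LINT x|M. p n x * f x) - (LINT x|M. g x * f x) = (LINT x|M. (p n x - g x) * f x)"
        using sq_integrable_mult_integrable[OF pL2 f] sq_integrable_mult_integrable[OF gL2 f]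
        by (simp add: left_diff_distrib)
      also have "\<bar>\<dots>\<bar> \<le> sqrt (LINT x|M. (p n x - g x)\<^sup>2) * sqrt (N f)"
        unfolding N_def by (rule cauchy_schwarz_integral[OF sq_integrable_diff[OF pL2 gL2] f])
      also have "\<dots> \<le> sqrt ((1/4)^n) * sqrt (N f)"
        using gn[of n] N0[of f] by (intro mult_right_mono) auto
      also have "sqrt ((1/4)^n) = (1/2::real)^n"
        by (simp add: real_sqrt_power real_sqrt_divide)
      finally show ?thesis .
    qed
    have "(\<lambda>n. (1/2)^n * sqrt (N f)) \<longlonglongrightarrow> 0"
      by (intro tendsto_mult_left_zero LIMSEQ_power_zero) simp
    then have "(\<lambda>n. (LINT x|M. p n x * f x) - (LINT x|M. g x * f x)) \<longlonglongrightarrow> 0"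
      by (rule Lim_null_comparison[rotated]) (simp only: real_norm_def dle eventually_True)
    then show ?thesis by (rule LIM_zero_cancel)
  qed
  have rep: "L f = (LINT x|M. f x * g x)" if f: "f \<in> V" for f
  proof -
    have fL2: "f \<in> sq_integrable M" using f VL2 by auto
    define c where "c = (LINT x|M. g x * f x) - L f"
    have pos: "0 \<le> 2 * t * c + t\<^sup>2 * N f" for t
    proof -
      have "0 \<le> (1/4)^n / 4 + 2 * t * ((LINT x|M. p n x * f x) - L f) + t\<^sup>2 * N f" for n
      proof -
        have "J (\<lambda>x. p n x + t * f x) = J (p n) + 2 * t * ((LINT x|M. p n x * f x) - L f) + t\<^sup>2 * N f"
          unfolding J_def N_def
          by (subst integral_sq_lin[OF pL2 fL2], subst Llin[OF pV f]) (simp add: algebra_simps)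
        moreover have "I \<le> J (\<lambda>x. p n x + t * f x)" by (rule Ile[OF lin[OF pV f]])
        ultimately show ?thesis using pJ[of n] by argo
      qed
      moreover have "(\<lambda>n. (1/4)^n / 4 + 2 * t * ((LINT x|M. p n x * f x) - L f) + t\<^sup>2 * N f)
          \<longlonglongrightarrow> 0 / 4 + 2 * t * c + t\<^sup>2 * N f"
        unfolding c_def by (intro tendsto_intros pair fL2 LIMSEQ_power_zero) auto
      ultimately have "0 \<le> 0 / 4 + 2 * t * c + t\<^sup>2 * N f"
        by (intro LIMSEQ_le_const) auto
      then show ?thesis by simp
    qed
    have "c = 0"
    proof (rule ccontr)
      assume c: "c \<noteq> 0"
      \<comment> \<open>the step \<open>- c / N f\<close> would be optimal; adding \<open>1\<close> avoids a division by \<open>0\<close>\<close>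
      define q where "q = N f + 1"
      have q: "0 < q" "N f \<le> q" using N0[of f] unfolding q_def by simp_all
      have "(- c / q)\<^sup>2 * N f \<le> (- c / q)\<^sup>2 * q" using q by (intro mult_left_mono) auto
      also have "\<dots> = c\<^sup>2 / q" using q by (simp add: power2_eq_square)
      finally have "(- c / q)\<^sup>2 * N f \<le> c\<^sup>2 / q" .
      moreover have "2 * (- c / q) * c = - 2 * (c\<^sup>2 / q)" by (simp add: power2_eq_square)
      moreover have "0 < c\<^sup>2 / q" using c q by simp
      ultimately show False using pos[of "- c / q"] by argo
    qed
    then show ?thesis unfolding c_def by (simp add: mult.commute)
  qed
  have "N g \<le> B\<^sup>2"
  proof -
    have a: "\<bar>LINT x|M. p n x * g x\<bar> \<le> B * (sqrt (N g) + (1/2)^n)" for n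
    proof -
      have "sqrt (N (p n)) \<le> sqrt (N g) + (1/2)^n"
      proof -
        have dL2: "(\<lambda>x. p n x - g x) \<in> sq_integrable M" by (intro sq_integrable_diff pL2 gL2)
        have e: "N (\<lambda>x. p n x - g x) \<le> (1/4)^n" using gn unfolding N_def by simp
        have "N (p n) = N (\<lambda>x. g x + 1 * (p n x - g x))" by simp
        also have "\<dots> = N g + 2 * (LINT x|M. g x * (p n x - g x)) + N (\<lambda>x. p n x - g x)"
          unfolding N_def by (subst integral_sq_lin[OF gL2 dL2]) simp
        also have "\<dots> \<le> N g + 2 * (sqrt (N g) * sqrt (N (\<lambda>x. p n x - g x))) + N (\<lambda>x. p n x - g x)"
          using cauchy_schwarz_integral[OF gL2 dL2] unfolding N_def by simp
        also have "\<dots> = (sqrt (N g) + sqrt (N (\<lambda>x. p n x - g x)))\<^sup>2"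
          using N0 by (simp add: power2_eq_square algebra_simps)
        finally have "sqrt (N (p n)) \<le> sqrt (N g) + sqrt (N (\<lambda>x. p n x - g x))"
          by (rule real_le_lsqrt[rotated]) (use N0 in simp_all)
        also have "sqrt (N (\<lambda>x. p n x - g x)) \<le> sqrt ((1/4)^n)" using e by simp
        also have "sqrt ((1/4)^n) = (1/2::real)^n"
          by (simp add: real_sqrt_power real_sqrt_divide)
        finally show ?thesis by simp
      qed
      then have "B * sqrt (N (p n)) \<le> B * (sqrt (N g) + (1/2)^n)" using B by (rule mult_left_mono)
      moreover have "\<bar>LINT x|M. p n x * g x\<bar> \<le> B * sqrt (N (p n))"
        using bound[OF pV[of n]] rep[OF pV[of n]] unfolding N_def by simp
      ultimately show ?thesis by linarith
    qed
    have "(\<lambda>n. B * (sqrt (N g) + (1/2)^n)) \<longlonglongrightarrow> B * (sqrt (N g) + 0)"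
      by (intro tendsto_intros LIMSEQ_power_zero) auto
    moreover have "(\<lambda>n. LINT x|M. p n x * g x) \<longlonglongrightarrow> N g"
      using pair[OF gL2] unfolding N_def by (simp add: power2_eq_square)
    ultimately have "N g \<le> B * sqrt (N g)"
      using a by (intro LIMSEQ_le[where X="\<lambda>n. LINT x|M. p n x * g x" and Y="\<lambda>n. B * (sqrt (N g) + (1/2)^n)"])
         (auto simp: abs_le_iff)
    then have "sqrt (N g) * sqrt (N g) \<le> B * sqrt (N g)" using N0 by simp
    then have "sqrt (N g) \<le> B" using N0[of g] B
      by (cases "N g = 0") (simp_all add: mult_right_le_imp_le[of "sqrt (N g)" "sqrt (N g)" B] del: real_sqrt_mult_self)
    then have "(sqrt (N g))\<^sup>2 \<le> B\<^sup>2" using N0 by (intro power_mono) auto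
    then show ?thesis using N0 by simp
  qed
  then show thesis using that[OF gL2 _ rep] unfolding N_def by blast
qed

section \<open>Test functions and the fundamental lemma\<close>

lemma partial_deriv_eq:
  "(f has_derivative f') (at x) \<Longrightarrow> partial_deriv i f x = f' (axis i 1)"
  unfolding partial_deriv_def using frechet_derivative_at by metis

lemma Ck_continuous: "Ck k f \<Longrightarrow> continuous_on UNIV f"
  by (cases k) (auto intro!: continuous_at_imp_continuous_on differentiable_imp_continuous_within)

lemma Ck_SucD: "Ck (Suc k) f \<Longrightarrow> Ck k f"
proof (induction k arbitrary: f)
  case 0
  then show ?case using Ck_continuous[of "Suc 0" f] by simp
next
  case (Suc k)
  then show ?case by (metis Ck.simps(2))
qed

lemma Ck_lin:
  "Ck k f \<Longrightarrow> Ck k g \<Longrightarrow> Ck k (\<lambda>x. f x + c * g x)"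
proof (induction k arbitrary: f g)
  case 0
  then show ?case by (auto intro!: continuous_intros)
next
  case (Suc k)
  have D: "((\<lambda>x. f x + c * g x) has_derivative
      (\<lambda>h. frechet_derivative f (at x) h + c * frechet_derivative g (at x) h)) (at x)" for x
    using Suc.prems by (auto intro!: derivative_eq_intros simp: frechet_derivative_works[symmetric])
  have "partial_deriv i (\<lambda>x. f x + c * g x) = (\<lambda>x. partial_deriv i f x + c * partial_deriv i g x)" for i
    by (rule ext) (subst partial_deriv_eq[OF D], simp add: partial_deriv_def)
  then show ?case using Suc differentiableI[OF D] by auto
qed

lemma Ck_mult:
  "Ck k f \<Longrightarrow> Ck k g \<Longrightarrow> Ck k (\<lambda>x. f x * g x)"
proof (induction k arbitrary: f g)
  case 0
  then show ?case by (auto intro!: continuous_intros)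
next
  case (Suc k)
  have D: "((\<lambda>x. f x * g x) has_derivative
      (\<lambda>h. f x * frechet_derivative g (at x) h + 1 * (frechet_derivative f (at x) h * g x))) (at x)" for x
    using Suc.prems by (auto intro!: derivative_eq_intros simp: frechet_derivative_works[symmetric])
  have "partial_deriv i (\<lambda>x. f x * g x) = (\<lambda>x. f x * partial_deriv i g x + 1 * (partial_deriv i f x * g x))" for i
    by (rule ext) (subst partial_deriv_eq[OF D], simp add: partial_deriv_def)
  moreover have "Ck k (\<lambda>x. f x * partial_deriv i g x + 1 * (partial_deriv i f x * g x))" for i
    using Suc.prems by (intro Ck_lin Suc.IH) (auto intro: Ck_SucD)
  ultimately show ?case using differentiableI[OF D] by auto
qed

lemma Ck_const: "Ck k (\<lambda>x. c)"
proof (induction k arbitrary: c)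
  case (Suc k)
  have "partial_deriv i (\<lambda>x. c) = (\<lambda>x. 0)" for i
    by (rule ext) (subst partial_deriv_eq[where f'="\<lambda>h. 0"], auto)
  then show ?case using Suc by auto
qed auto

lemma Ck_prod: "finite A \<Longrightarrow> (\<And>i. i \<in> A \<Longrightarrow> Ck k (f i)) \<Longrightarrow> Ck k (\<lambda>x. \<Prod>i\<in>A. f i x)"
  by (induction A rule: finite_induct) (auto simp: Ck_const intro!: Ck_mult)

lemma partial_deriv_translate:
  assumes "\<And>x. f differentiable (at x)"
  shows "partial_deriv i (\<lambda>x. f (x + a)) = (\<lambda>x. partial_deriv i f (x + a))"
proof
  fix x
  have "(f has_derivative frechet_derivative f (at (x + a))) (at (x + a))"
    using assms frechet_derivative_works by blast
  moreover have "((\<lambda>x. x + a) has_derivative (\<lambda>h. h)) (at x)"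
    by (auto intro!: derivative_eq_intros)
  ultimately have "((\<lambda>x. f (x + a)) has_derivative frechet_derivative f (at (x + a))) (at x)"
    using diff_chain_at[of "\<lambda>x. x + a" "\<lambda>h. h" x f] by (simp add: o_def)
  then show "partial_deriv i (\<lambda>x. f (x + a)) x = partial_deriv i f (x + a)"
    using frechet_derivative_at by (metis partial_deriv_def)
qed

lemma Ck_translate: "Ck k f \<Longrightarrow> Ck k (\<lambda>x. f (x + a))"
proof (induction k arbitrary: f)
  case 0
  then show ?case by (auto intro!: continuous_on_compose2[of UNIV f] continuous_intros)
next
  case (Suc k)
  have "(\<lambda>x. f (x + a)) differentiable (at x)" for x
    using Suc.prems differentiable_chain_at[of "\<lambda>x. x + a" x f]
    by (auto simp: o_def intro!: derivative_intros)
  then show ?case using Suc partial_deriv_translate[of f] by auto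
qed

text \<open>
  The functions \<open>e\<^bsup>-1/t\<^esup> t\<^bsup>-n\<^esup>\<close>, continued by \<open>0\<close>. Their span is closed under differentiation, so
  smoothness of the case \<open>n = 0\<close> follows by an induction over all \<open>n\<close> at once.
\<close>

definition flat_exp :: "nat \<Rightarrow> real \<Rightarrow> real" where
  "flat_exp n t = (if t \<le> 0 then 0 else exp (- (1 / t)) / t ^ n)"

text \<open>
  One term of the series of \<open>exp (1/t)\<close> beats any power of \<open>1/t\<close>; a linear bound is enough because the
  difference quotient of \<open>flat_exp n\<close> at \<open>0\<close> is \<open>flat_exp (n + 1)\<close>.
\<close>

lemma flat_exp_le: "\<bar>flat_exp n t\<bar> \<le> fact (Suc n) * \<bar>t\<bar>"
proof (cases "t \<le> 0")
  case False
  then have t: "t > 0" by simp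
  have "(1 / t) ^ Suc n / fact (Suc n) \<le> exp (1 / t)"
  proof -
    have "(\<Sum>k\<in>{Suc n}. (1 / t) ^ k /\<^sub>R fact k) \<le> (\<Sum>k. (1 / t) ^ k /\<^sub>R fact k)"
      using t by (intro sum_le_suminf summable_exp_generic) auto
    then show ?thesis by (simp add: exp_def divide_inverse mult.commute)
  qed
  then have "exp (- (1 / t)) * ((1 / t) ^ Suc n / fact (Suc n)) \<le> exp (- (1 / t)) * exp (1 / t)"
    by (intro mult_left_mono) auto
  then have *: "exp (- (1 / t)) * ((1 / t) ^ Suc n / fact (Suc n)) \<le> 1"
    by (simp add: exp_minus)
  have "exp (- (1 / t)) / t ^ n = (exp (- (1 / t)) * ((1 / t) ^ Suc n / fact (Suc n))) * (fact (Suc n) * t)"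
    using t by (simp add: field_simps power_divide del: fact_Suc)
  also have "\<dots> \<le> 1 * (fact (Suc n) * t)" using * t by (intro mult_right_mono) auto
  finally show ?thesis using t by (simp add: flat_exp_def)
qed (simp add: flat_exp_def mult_nonneg_nonpos del: fact_Suc)

lemma flat_exp_deriv:
  "(flat_exp n has_real_derivative (flat_exp (n + 2) t - real n * flat_exp (n + 1) t)) (at t)"
proof -
  consider "t < 0" | "t = 0" | "t > 0" by linarith
  then show ?thesis
  proof cases
    case 1
    have "((\<lambda>t. 0) has_real_derivative 0) (at t)" by simp
    then have "(flat_exp n has_real_derivative 0) (at t)"
      by (rule has_field_derivative_transform_within_open[of _ _ _ "{..<0}"]) (use 1 in \<open>auto simp: flat_exp_def\<close>)
    then show ?thesis using 1 by (simp add: flat_exp_def)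
  next
    case 2
    have "((\<lambda>h. (flat_exp n (0 + h) - flat_exp n 0) / h) \<longlongrightarrow> 0) (at 0)"
    proof (rule Lim_null_comparison)
      show "\<forall>\<^sub>F h in at 0. norm ((flat_exp n (0 + h) - flat_exp n 0) / h) \<le> fact (Suc (Suc n)) * \<bar>h\<bar>"
      proof (rule eventually_at_filter[THEN iffD2, OF always_eventually], intro allI impI)
        fix h :: real assume "h \<noteq> 0"
        have "(flat_exp n (0 + h) - flat_exp n 0) / h = flat_exp (Suc n) h"
          by (simp add: flat_exp_def)
        then show "norm ((flat_exp n (0 + h) - flat_exp n 0) / h) \<le> fact (Suc (Suc n)) * \<bar>h\<bar>"
          using flat_exp_le[of "Suc n" h] by simp
      qed
      have "((\<lambda>h::real. fact (Suc (Suc n)) * \<bar>h\<bar>) \<longlongrightarrow> fact (Suc (Suc n)) * \<bar>0\<bar>) (at 0)"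
        by (intro tendsto_intros)
      then show "((\<lambda>h::real. fact (Suc (Suc n)) * \<bar>h\<bar>) \<longlongrightarrow> 0) (at 0)" by simp
    qed
    then show ?thesis using 2 by (simp add: DERIV_def flat_exp_def)
  next
    case 3
    have "((\<lambda>t. exp (- (1 / t)) * inverse (t ^ n)) has_real_derivative
        (flat_exp (n + 2) t - real n * flat_exp (n + 1) t)) (at t)"
    proof -
      have *: "t ^ (n - 1) * real n = real n * t ^ n / t" using 3 by (cases n) auto
      show ?thesis
        using 3 by (auto intro!: derivative_eq_intros simp: * flat_exp_def power2_eq_square divide_simps)
          (cases n; auto simp: algebra_simps)
    qed
    then show ?thesis
      by (rule has_field_derivative_transform_within_open[of _ _ _ "{0<..}"]) (use 3 in \<open>auto simp: flat_exp_def divide_inverse\<close>)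
  qed
qed

lemma Ck_flat_exp_coordinate: "Ck k (\<lambda>x. flat_exp n (c * x $ i + d))"
proof (induction k arbitrary: n)
  case 0
  have "continuous_on UNIV (flat_exp n)"
    using flat_exp_deriv DERIV_isCont by (blast intro: continuous_at_imp_continuous_on)
  then show ?case by (auto intro!: continuous_on_compose2[of UNIV "flat_exp n"] continuous_intros)
next
  case (Suc k)
  define F where "F = (\<lambda>x::real^3. flat_exp (n + 2) (c * x $ i + d) + (- real n) * flat_exp (n + 1) (c * x $ i + d))"
  have D: "((\<lambda>x. flat_exp n (c * x $ i + d)) has_derivative (\<lambda>h. F x * (c * h $ i))) (at x)" for x
  proof -
    have "((\<lambda>x::real^3. c * x $ i + d) has_derivative (\<lambda>h. c * h $ i)) (at x)"
      by (auto intro!: derivative_eq_intros bounded_linear_imp_has_derivative)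
    from diff_chain_at[OF this flat_exp_deriv[unfolded has_field_derivative_def]]
    show ?thesis by (simp add: o_def F_def)
  qed
  have FC: "Ck k F" unfolding F_def by (intro Ck_lin Suc)
  have "partial_deriv j (\<lambda>x. flat_exp n (c * x $ i + d)) = (\<lambda>x. 0 + (c * axis j 1 $ i) * F x)" for j
    by (rule ext) (subst partial_deriv_eq[OF D], simp)
  then show ?case using differentiableI[OF D] FC by (auto simp del: add_0 intro!: Ck_lin Ck_const)
qed

lemma test_functionsI:
  "(\<And>k. Ck k \<phi>) \<Longrightarrow> bounded {x. \<phi> x \<noteq> 0} \<Longrightarrow> \<phi> \<in> test_functions"
  by (simp add: test_functions_def)

lemma test_functionsD:
  assumes "\<phi> \<in> test_functions"
  shows "Ck k \<phi>" "bounded {x. \<phi> x \<noteq> 0}" "\<phi> differentiable (at x)" "continuous_on UNIV \<phi>"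
    "\<phi> \<in> borel_measurable borel"
proof -
  have C: "Ck k \<phi>" for k using assms by (simp add: test_functions_def)
  show "Ck k \<phi>" by (rule C)
  show "continuous_on UNIV \<phi>" by (rule Ck_continuous[OF C])
  then show "\<phi> \<in> borel_measurable borel" by (rule borel_measurable_continuous_onI)
  show "bounded {x. \<phi> x \<noteq> 0}" using assms by (simp add: test_functions_def)
  show "\<phi> differentiable (at x)" using C[of 1] by simp
qed

lemma test_functions_lin:
  assumes "\<phi> \<in> test_functions" "\<psi> \<in> test_functions"
  shows "(\<lambda>x. \<phi> x + c * \<psi> x) \<in> test_functions"
proof (rule test_functionsI)
  have "bounded ({x. \<phi> x \<noteq> 0} \<union> {x. \<psi> x \<noteq> 0})"
    using test_functionsD(2)[OF assms(1)] test_functionsD(2)[OF assms(2)] by simp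
  then show "bounded {x. \<phi> x + c * \<psi> x \<noteq> 0}" by (rule bounded_subset) auto
qed (intro Ck_lin test_functionsD(1) assms)

lemma test_functions_zero: "(\<lambda>x. 0) \<in> test_functions"
  by (rule test_functionsI) (auto intro: Ck_const)

lemma test_functions_translate:
  assumes "\<phi> \<in> test_functions"
  shows "(\<lambda>x. \<phi> (x + a)) \<in> test_functions"
proof (rule test_functionsI)
  have "{x. \<phi> (x + a) \<noteq> 0} = (\<lambda>x. - a + x) ` {x. \<phi> x \<noteq> 0}"
  proof safe
    fix x assume "\<phi> (x + a) \<noteq> 0"
    then have "x = - a + (x + a)" "x + a \<in> {x. \<phi> x \<noteq> 0}" by simp_all
    then show "x \<in> (\<lambda>x. - a + x) ` {x. \<phi> x \<noteq> 0}" by (rule image_eqI)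
  qed (simp add: algebra_simps)
  then show "bounded {x. \<phi> (x + a) \<noteq> 0}"
    using bounded_translation[OF test_functionsD(2)[OF assms], of "- a"] by (simp only:)
qed (intro Ck_translate test_functionsD(1) assms)

lemma test_functions_partial_deriv:
  assumes "\<phi> \<in> test_functions"
  shows "partial_deriv i \<phi> \<in> test_functions"
proof (rule test_functionsI)
  show "Ck k (partial_deriv i \<phi>)" for k using test_functionsD(1)[OF assms, of "Suc k"] by simp
  have "partial_deriv i \<phi> x = 0" if "x \<notin> closure {x. \<phi> x \<noteq> 0}" for x
  proof -
    have "((\<lambda>x. 0) has_derivative (\<lambda>h. 0)) (at x)" by simp
    then have "(\<phi> has_derivative (\<lambda>h. 0)) (at x)"
      by (rule has_derivative_transform_within_open[of _ _ _ _ "- closure {x. \<phi> x \<noteq> 0}"])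
         (use that closure_subset[of "{x. \<phi> x \<noteq> 0}"] in auto)
    then show ?thesis by (simp add: partial_deriv_eq)
  qed
  then have "{x. partial_deriv i \<phi> x \<noteq> 0} \<subseteq> closure {x. \<phi> x \<noteq> 0}" by blast
  then show "bounded {x. partial_deriv i \<phi> x \<noteq> 0}"
    using test_functionsD(2)[OF assms] bounded_closure bounded_subset by blast
qed

lemma test_functions_bound:
  assumes "\<phi> \<in> test_functions"
  obtains C R where "0 \<le> C" "\<And>x. \<bar>\<phi> x\<bar> \<le> C * indicator (cball 0 R) x"
proof -
  obtain R where R: "{x. \<phi> x \<noteq> 0} \<subseteq> cball 0 R"
    using test_functionsD(2)[OF assms] unfolding bounded_iff by (metis mem_cball_0 subsetI)
  have "compact (\<phi> ` cball 0 R)"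
    by (intro compact_continuous_image continuous_on_subset[OF test_functionsD(4)[OF assms]]) auto
  then obtain C where C: "0 < C" "\<And>y. y \<in> \<phi> ` cball 0 R \<Longrightarrow> norm y \<le> C"
    using compact_imp_bounded bounded_pos by metis
  have "\<bar>\<phi> x\<bar> \<le> C * indicator (cball 0 R) x" for x
  proof (cases "x \<in> cball 0 R")
    case True then show ?thesis using C(2)[of "\<phi> x"] by auto
  next
    case False then have "\<phi> x = 0" using R by blast
    then show ?thesis using C by simp
  qed
  then show thesis using that[of C R] C by auto
qed

lemma indicator_sq_integrable:
  assumes "A \<in> sets borel" "bounded A"
  shows "indicator A \<in> sq_integrable (lborel :: 'a::euclidean_space measure)"
proof (rule sq_integrableI)
  show "indicator A \<in> borel_measurable lborel" using assms by simp
  have "integrable lborel (indicator A :: 'a \<Rightarrow> real)"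
    using assms emeasure_bounded_finite[OF assms(2)] by (intro integrable_real_indicator) auto
  moreover have "(\<lambda>x. (indicator A x :: real)\<^sup>2) = indicator A" by (auto simp: indicator_def)
  ultimately show "integrable lborel (\<lambda>x. (indicator A x :: real)\<^sup>2)" by simp
qed

lemma sq_integrable_bound:
  assumes "g \<in> sq_integrable M" "f \<in> borel_measurable M" "\<And>x. \<bar>f x\<bar> \<le> \<bar>g x\<bar>"
  shows "f \<in> sq_integrable M"
proof (rule sq_integrableI)
  show "integrable M (\<lambda>x. (f x)\<^sup>2)"
    by (rule Bochner_Integration.integrable_bound[OF sq_integrableD(2)[OF assms(1)]])
       (use assms in \<open>auto simp: abs_le_square_iff[symmetric]\<close>)
qed fact

lemma test_functions_sq_integrable: "test_functions \<subseteq> sq_integrable lborel"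
proof
  fix \<phi> assume "\<phi> \<in> test_functions"
  then obtain C R where CR: "0 \<le> C" "\<And>x. \<bar>\<phi> x\<bar> \<le> C * indicator (cball 0 R) x"
    by (rule test_functions_bound) blast
  have g: "(\<lambda>x. C * indicator (cball 0 R) x) \<in> sq_integrable lborel"
    by (intro sq_integrable_cmult indicator_sq_integrable) auto
  show "\<phi> \<in> sq_integrable lborel"
  proof (rule sq_integrable_bound[OF g])
    show "\<bar>\<phi> x\<bar> \<le> \<bar>C * indicator (cball 0 R) x\<bar>" for x using CR by (auto simp: abs_mult)
  qed (use test_functionsD(5)[OF \<open>\<phi> \<in> test_functions\<close>] in simp)
qed

lemmas test_functions_sqD = test_functions_sq_integrable[THEN subsetD]

text \<open>
  The product over the coordinates of \<open>flat_exp 0 (n (x\<^sub>i - a\<^sub>i)) flat_exp 0 (n (b\<^sub>i - x\<^sub>i))\<close> is positive exactly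
  on the box, and tends to \<open>1\<close> there since \<open>exp (- 1 / (n s)) \<longlonglongrightarrow> 1\<close> for every \<open>s > 0\<close>.
\<close>

lemma indicator_box_limit_of_test_functions:
  obtains \<phi> where "\<And>n. \<phi> n \<in> test_functions"
    "\<And>n x. \<bar>\<phi> n x\<bar> \<le> indicator (box a b) x"
    "\<And>x. (\<lambda>n. \<phi> n x) \<longlonglongrightarrow> indicator (box a b) x"
proof -
  define \<beta> where "\<beta> n i x = flat_exp 0 (real n * x $ i + (- real n * a $ i)) * flat_exp 0 (- real n * x $ i + real n * b $ i)"
    for n i and x :: "real^3"
  define \<phi> where "\<phi> n x = (\<Prod>i\<in>UNIV. \<beta> n i x)" for n x
  have \<beta>0: "\<beta> n i x = 0" if "\<not> (a $ i < x $ i \<and> x $ i < b $ i)" for n i x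
    using that unfolding \<beta>_def flat_exp_def by (auto simp: mult_left_mono not_less algebra_simps)
  have \<beta>1: "0 \<le> \<beta> n i x \<and> \<beta> n i x \<le> 1" for n i x
    unfolding \<beta>_def flat_exp_def by (auto intro!: mult_le_one)
  have lim1: "(\<lambda>n. flat_exp 0 (real n * s)) \<longlonglongrightarrow> 1" if "0 < s" for s
  proof -
    have "(\<lambda>n. exp (- (inverse s * (1 / real n)))) \<longlonglongrightarrow> exp (- (inverse s * 0))"
      by (intro tendsto_intros lim_1_over_n)
    then have "(\<lambda>n. exp (- (inverse s * (1 / real n)))) \<longlonglongrightarrow> 1" by simp
    moreover have "\<forall>\<^sub>F n in sequentially. exp (- (inverse s * (1 / real n))) = flat_exp 0 (real n * s)"
      using eventually_gt_at_top[of 0]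
      by eventually_elim (use that in \<open>auto simp: flat_exp_def field_simps mult_le_0_iff\<close>)
    ultimately show ?thesis by (rule Lim_transform_eventually)
  qed
  have \<beta>lim: "(\<lambda>n. \<beta> n i x) \<longlonglongrightarrow> 1" if "a $ i < x $ i \<and> x $ i < b $ i" for i x
  proof -
    have "(\<lambda>n. flat_exp 0 (real n * (x $ i - a $ i)) * flat_exp 0 (real n * (b $ i - x $ i))) \<longlonglongrightarrow> 1 * 1"
      using that by (intro tendsto_mult lim1) auto
    then show ?thesis unfolding \<beta>_def by (simp add: algebra_simps)
  qed
  have le: "\<bar>\<phi> n x\<bar> \<le> indicator (box a b) x" for n x
  proof (cases "x \<in> box a b")
    case True
    have "0 \<le> \<phi> n x" "\<phi> n x \<le> 1" unfolding \<phi>_def using \<beta>1 by (auto intro!: prod_nonneg prod_le_1)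
    then show ?thesis using True by simp
  next
    case False
    then obtain i where "\<not> (a $ i < x $ i \<and> x $ i < b $ i)" by (auto simp: mem_box_cart)
    then have "\<phi> n x = 0" unfolding \<phi>_def using \<beta>0 by (auto intro!: prod_zero)
    then show ?thesis by simp
  qed
  have "\<phi> n \<in> test_functions" for n
  proof (rule test_functionsI)
    show "Ck k (\<phi> n)" for k
      unfolding \<phi>_def \<beta>_def by (intro Ck_prod Ck_mult Ck_flat_exp_coordinate) auto
    have "{x. \<phi> n x \<noteq> 0} \<subseteq> box a b"
    proof
      fix x assume "x \<in> {x. \<phi> n x \<noteq> 0}"
      then show "x \<in> box a b" using le[of n x] by (cases "x \<in> box a b") auto
    qed
    then show "bounded {x. \<phi> n x \<noteq> 0}" using bounded_box bounded_subset by blast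
  qed
  moreover have "(\<lambda>n. \<phi> n x) \<longlonglongrightarrow> indicator (box a b) x" for x
  proof (cases "x \<in> box a b")
    case True
    have "(\<lambda>n. \<phi> n x) \<longlonglongrightarrow> (\<Prod>i::3\<in>UNIV. 1)"
      unfolding \<phi>_def using True by (intro tendsto_prod \<beta>lim) (auto simp: mem_box_cart)
    then show ?thesis using True by simp
  next
    case False
    then have "\<phi> n x = 0" for n using le[of n x] by simp
    then show ?thesis using False by simp
  qed
  ultimately show thesis using le that by blast
qed

text \<open>
  Passing to the limit in the test functions above, the integral of \<open>w\<close> over every box vanishes. So the
  positive and the negative part of \<open>w\<close> are densities of measures that agree on boxes, hence everywhere.
\<close>

lemma fundamental_lemma_of_variations:
  fixes w :: "real^3 \<Rightarrow> real"
  assumes w: "w \<in> sq_integrable lborel"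
    and zero: "\<And>\<phi>. \<phi> \<in> test_functions \<Longrightarrow> (LBINT x. \<phi> x * w x) = 0"
  shows "AE x in lborel. w x = 0"
proof -
  have [measurable]: "w \<in> borel_measurable borel" using sq_integrableD(1)[OF w] by simp
  have ib: "integrable lborel (\<lambda>x. indicator (box a b) x * w x)" for a b
    by (intro sq_integrable_mult_integrable w indicator_sq_integrable) auto
  have box0: "(LBINT x. indicator (box a b) x * w x) = 0" for a b
  proof -
    obtain \<phi> where \<phi>: "\<And>n. \<phi> n \<in> test_functions" "\<And>n x. \<bar>\<phi> n x\<bar> \<le> indicator (box a b) x"
      "\<And>x. (\<lambda>n. \<phi> n x) \<longlonglongrightarrow> indicator (box a b) x"
      using indicator_box_limit_of_test_functions[of a b] by metis
    note [measurable] = test_functionsD(5)[OF \<phi>(1)]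
    have "(\<lambda>n. LBINT x. \<phi> n x * w x) \<longlonglongrightarrow> (LBINT x. indicator (box a b) x * w x)"
    proof (rule integral_dominated_convergence[where w="\<lambda>x. \<bar>indicator (box a b) x * w x\<bar>"])
      show "AE x in lborel. (\<lambda>n. \<phi> n x * w x) \<longlonglongrightarrow> indicator (box a b) x * w x"
        by (intro always_eventually allI tendsto_mult_right \<phi>(3))
      show "AE x in lborel. norm (\<phi> n x * w x) \<le> \<bar>indicator (box a b) x * w x\<bar>" for n
        using \<phi>(2) by (auto simp: abs_mult intro!: mult_right_mono)
    qed (use ib in auto)
    then show ?thesis using zero[OF \<phi>(1)] LIMSEQ_unique[OF _ tendsto_const[of 0]] by auto
  qed
  define P where "P = density lborel (\<lambda>x. ennreal (w x))"
  define Q where "Q = density lborel (\<lambda>x. ennreal (- w x))"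
  have eP: "emeasure P (box a b) = ennreal (LBINT x. max 0 (indicator (box a b) x * w x))" for a b
  proof -
    have "emeasure P (box a b) = (\<integral>\<^sup>+x. ennreal (max 0 (indicator (box a b) x * w x)) \<partial>lborel)"
      unfolding P_def by (subst emeasure_density) (auto intro!: nn_integral_cong simp: indicator_def max_def ennreal_neg)
    then show ?thesis using ib[of a b] by (subst (asm) nn_integral_eq_integral) auto
  qed
  have eQ: "emeasure Q (box a b) = ennreal (LBINT x. max 0 (- (indicator (box a b) x * w x)))" for a b
  proof -
    have "emeasure Q (box a b) = (\<integral>\<^sup>+x. ennreal (max 0 (- (indicator (box a b) x * w x))) \<partial>lborel)"
      unfolding Q_def by (subst emeasure_density) (auto intro!: nn_integral_cong simp: indicator_def max_def ennreal_neg)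
    then show ?thesis using ib[of a b] by (subst (asm) nn_integral_eq_integral) auto
  qed
  have PQ: "emeasure P (box a b) = emeasure Q (box a b)" for a b
  proof -
    have "(LBINT x. max 0 (indicator (box a b) x * w x))
        = (LBINT x. indicator (box a b) x * w x + max 0 (- (indicator (box a b) x * w x)))"
      by (intro Bochner_Integration.integral_cong) auto
    also have "\<dots> = (LBINT x. indicator (box a b) x * w x) + (LBINT x. max 0 (- (indicator (box a b) x * w x)))"
      using ib[of a b] by (intro Bochner_Integration.integral_add) auto
    finally show ?thesis unfolding eP eQ box0 by simp
  qed
  let ?E = "range (\<lambda>(a, b). box a b :: (real^3) set)"
  have "P = Q"
  proof (rule measure_eqI_generator_eq[where \<Omega>=UNIV and E="?E"
        and A="\<lambda>n. box (- (real n *\<^sub>R One)) (real n *\<^sub>R One)"])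
    show "Int_stable ?E" by (auto simp: Int_stable_def box_Int_box)
    show "sets P = sigma_sets UNIV ?E" "sets Q = sigma_sets UNIV ?E"
      unfolding P_def Q_def by (simp_all add: borel_eq_box)
    show "(\<Union>i. box (- (real i *\<^sub>R One)) (real i *\<^sub>R One)) = (UNIV :: (real^3) set)"
      by (rule UN_box_eq_UNIV)
    show "emeasure P (box (- (real i *\<^sub>R One)) (real i *\<^sub>R One)) \<noteq> \<infinity>" for i
      unfolding eP by simp
    show "emeasure P X = emeasure Q X" if "X \<in> ?E" for X using that PQ by auto
  qed auto
  then have "AE x in lborel. ennreal (w x) = ennreal (- w x)"
    unfolding P_def Q_def by (intro sigma_finite_measure.density_unique[OF sigma_finite_lborel]) auto
  then show ?thesis
  proof eventually_elim
    case (elim x)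
    then show ?case by (cases "w x \<ge> 0") (auto simp: ennreal_neg ennreal_eq_0_iff)
  qed
qed

section \<open>Weak derivatives as bounds on translations\<close>

lemma lborel_distr_shift: "distr lborel borel (\<lambda>x. x + a) = (lborel :: 'a::euclidean_space measure)"
  using lborel_distr_plus[of a] by (simp add: add.commute[of _ a])

lemma integral_shift:
  fixes f :: "'a::euclidean_space \<Rightarrow> real"
  assumes [measurable]: "f \<in> borel_measurable borel"
  shows "(LBINT x. f (x + a)) = (LBINT x. f x)"
  by (subst (2) lborel_distr_shift[of a, symmetric]) (simp add: integral_distr)

lemma integrable_shift:
  fixes f :: "'a::euclidean_space \<Rightarrow> real"
  assumes [measurable]: "f \<in> borel_measurable borel"
  shows "integrable lborel (\<lambda>x. f (x + a)) \<longleftrightarrow> integrable lborel f"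
  by (subst (2) lborel_distr_shift[of a, symmetric]) (simp add: integrable_distr_eq)

lemma nn_integral_shift:
  fixes f :: "'a::euclidean_space \<Rightarrow> ennreal"
  assumes [measurable]: "f \<in> borel_measurable borel"
  shows "(\<integral>\<^sup>+x. f (x + a) \<partial>lborel) = (\<integral>\<^sup>+x. f x \<partial>lborel)"
  by (subst (2) lborel_distr_shift[of a, symmetric]) (simp add: nn_integral_distr)

lemma sq_integrable_shift:
  fixes f :: "'a::euclidean_space \<Rightarrow> real"
  assumes f: "f \<in> sq_integrable lborel"
  shows "(\<lambda>x. f (x + a)) \<in> sq_integrable lborel"
proof (rule sq_integrableI)
  have [measurable]: "f \<in> borel_measurable borel" using sq_integrableD(1)[OF f] by simp
  show "(\<lambda>x. f (x + a)) \<in> borel_measurable lborel" by measurable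
  show "integrable lborel (\<lambda>x. (f (x + a))\<^sup>2)"
    using sq_integrableD(2)[OF f] by (subst integrable_shift[of "\<lambda>x. (f x)\<^sup>2"]) auto
qed

definition dir_deriv :: "real^3 \<Rightarrow> (real^3 \<Rightarrow> real) \<Rightarrow> real^3 \<Rightarrow> real" where
  "dir_deriv e f x = (\<Sum>i\<in>UNIV. e $ i * partial_deriv i f x)"

lemma test_functions_sum:
  "finite A \<Longrightarrow> (\<And>i. i \<in> A \<Longrightarrow> \<phi> i \<in> test_functions) \<Longrightarrow> (\<lambda>x. \<Sum>i\<in>A. c i * \<phi> i x) \<in> test_functions"
proof (induction A rule: finite_induct)
  case (insert a A)
  then have "(\<lambda>x. (\<Sum>i\<in>A. c i * \<phi> i x) + c a * \<phi> a x) \<in> test_functions"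
    by (intro test_functions_lin) auto
  then show ?case using insert by (simp add: add.commute)
qed (simp add: test_functions_zero)

lemma test_functions_dir_deriv: "\<phi> \<in> test_functions \<Longrightarrow> dir_deriv e \<phi> \<in> test_functions"
  unfolding dir_deriv_def[abs_def] by (intro test_functions_sum test_functions_partial_deriv) auto

lemma dir_deriv_axis: "dir_deriv (axis i 1) f = partial_deriv i f"
  by (simp add: dir_deriv_def[abs_def] axis_def if_distrib[of "\<lambda>c. c * _"] cong: if_cong)

lemma dir_deriv_minus: "dir_deriv (- e) f x = - dir_deriv e f x"
  by (simp add: dir_deriv_def sum_negf)

lemma dir_deriv_frechet:
  assumes "f differentiable (at x)"
  shows "frechet_derivative f (at x) e = dir_deriv e f x"
proof -
  have lin: "linear (frechet_derivative f (at x))" by (rule linear_frechet_derivative[OF assms])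
  have "frechet_derivative f (at x) e = frechet_derivative f (at x) (\<Sum>i\<in>UNIV. e $ i *\<^sub>R axis i 1)"
    using basis_expansion[of e] by (simp add: scalar_mult_eq_scaleR)
  also have "\<dots> = dir_deriv e f x"
    by (simp add: linear_sum[OF lin] linear_scale[OF lin] dir_deriv_def partial_deriv_def)
  finally show ?thesis .
qed

lemma has_real_derivative_along_line:
  assumes "\<phi> \<in> test_functions"
  shows "((\<lambda>t. \<phi> (x + t *\<^sub>R e)) has_real_derivative dir_deriv e \<phi> (x + t *\<^sub>R e)) (at t)"
proof -
  have "((\<lambda>t. x + t *\<^sub>R e) has_derivative (\<lambda>h. h *\<^sub>R e)) (at t)"
    by (auto intro!: derivative_eq_intros)
  moreover have "(\<phi> has_derivative frechet_derivative \<phi> (at (x + t *\<^sub>R e))) (at (x + t *\<^sub>R e))"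
    using test_functionsD(3)[OF assms] frechet_derivative_works by blast
  ultimately have "((\<lambda>t. \<phi> (x + t *\<^sub>R e)) has_derivative
      (\<lambda>h. frechet_derivative \<phi> (at (x + t *\<^sub>R e)) (h *\<^sub>R e))) (at t)"
    using diff_chain_at[of "\<lambda>t. x + t *\<^sub>R e" "\<lambda>h. h *\<^sub>R e" t \<phi>] by (simp add: o_def)
  moreover have "dir_deriv (h *\<^sub>R e) \<phi> y = dir_deriv e \<phi> y * h" for h y
    by (simp add: dir_deriv_def sum_distrib_left mult_ac)
  ultimately show ?thesis
    unfolding has_field_derivative_def dir_deriv_frechet[OF test_functionsD(3)[OF assms]] by simp
qed

text \<open>
  Differentiation under the integral sign along a line. The mean value theorem dominates the difference
  quotients of \<open>\<psi>\<close> by \<open>K\<close>; the range \<open>\<bar>t\<bar> \<le> 1\<close> suffices because only small \<open>t\<close> matter in the limit.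
\<close>

lemma integral_line_derivative:
  fixes f \<psi> D K :: "'a::euclidean_space \<Rightarrow> real" and e :: 'a
  assumes [measurable]: "f \<in> borel_measurable borel" "\<psi> \<in> borel_measurable borel" "D \<in> borel_measurable borel"
    and deriv: "\<And>x t. ((\<lambda>t. \<psi> (x + t *\<^sub>R e)) has_real_derivative D (x + t *\<^sub>R e)) (at t)"
    and bound: "\<And>x t. \<bar>t\<bar> \<le> 1 \<Longrightarrow> \<bar>D (x + t *\<^sub>R e)\<bar> \<le> K x"
    and intK: "integrable lborel (\<lambda>x. f x * K x)"
    and int: "\<And>t. integrable lborel (\<lambda>x. f x * \<psi> (x + t *\<^sub>R e))"
  shows "((\<lambda>t. LBINT x. f x * \<psi> (x + t *\<^sub>R e)) has_real_derivative (LBINT x. f x * D x)) (at 0)"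
proof -
  define q where "q h x = (\<psi> (x + h *\<^sub>R e) - \<psi> x) / h" for h x
  have q_le: "\<bar>q h x\<bar> \<le> K x" if h: "h \<noteq> 0" "\<bar>h\<bar> \<le> 1" for h x
  proof -
    define F where "F t = \<psi> (x + (t * h) *\<^sub>R e)" for t
    have "(F has_real_derivative h * D (x + (t * h) *\<^sub>R e)) (at t)" for t
    proof -
      have "((\<lambda>t. \<psi> (x + (t * h) *\<^sub>R e)) has_real_derivative D (x + (t * h) *\<^sub>R e) * h) (at t)"
        by (rule DERIV_chain2[OF deriv]) (auto intro!: derivative_eq_intros)
      then show ?thesis unfolding F_def by (simp add: mult.commute)
    qed
    then obtain z where z: "0 < z" "z < 1" "F 1 - F 0 = (1 - 0) * (h * D (x + (z * h) *\<^sub>R e))"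
      using MVT2[of 0 1 F "\<lambda>t. h * D (x + (t * h) *\<^sub>R e)"] by auto
    then have "q h x = D (x + (z * h) *\<^sub>R e)"
      using h unfolding q_def F_def by (simp add: field_simps)
    moreover have "\<bar>z * h\<bar> \<le> 1" using z h by (auto simp: abs_mult intro!: mult_le_one)
    ultimately show ?thesis using bound by simp
  qed
  have "((\<lambda>h. LBINT x. f x * q h x) \<longlongrightarrow> (LBINT x. f x * D x)) (at 0)"
  proof (subst tendsto_at_iff_sequentially, intro allI impI)
    fix X :: "nat \<Rightarrow> real" assume X: "\<forall>i. X i \<in> UNIV - {0}" "X \<longlonglongrightarrow> 0"
    have ev: "\<forall>\<^sub>F n in sequentially. \<bar>X n\<bar> \<le> 1"
      using X(2)[unfolded tendsto_iff, rule_format, of 1] by (auto elim: eventually_mono)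
    then obtain N where N: "\<And>n. n \<ge> N \<Longrightarrow> \<bar>X n\<bar> \<le> 1" by (auto simp: eventually_sequentially)
    have "(\<lambda>n. LBINT x. f x * q (X (n + N)) x) \<longlonglongrightarrow> (LBINT x. f x * D x)"
    proof (rule integral_dominated_convergence[where w="\<lambda>x. \<bar>f x * K x\<bar>"])
      show "(\<lambda>x. f x * q (X (n + N)) x) \<in> borel_measurable lborel" for n unfolding q_def by measurable
      show "integrable lborel (\<lambda>x. \<bar>f x * K x\<bar>)" by (intro integrable_abs intK)
      show "AE x in lborel. norm (f x * q (X (n + N)) x) \<le> \<bar>f x * K x\<bar>" for n
      proof (intro always_eventually allI)
        fix x
        have "\<bar>q (X (n + N)) x\<bar> \<le> \<bar>K x\<bar>" using q_le[of "X (n + N)" x] X(1) N[of "n + N"] by auto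
        then show "norm (f x * q (X (n + N)) x) \<le> \<bar>f x * K x\<bar>"
          by (auto simp: abs_mult intro!: mult_left_mono)
      qed
      have "(\<lambda>n. q (X n) x) \<longlonglongrightarrow> D x" for x
      proof -
        have "((\<lambda>h. q h x) \<longlongrightarrow> D x) (at 0)"
          using deriv[of x 0] unfolding DERIV_def q_def by simp
        then show ?thesis using X
          by (auto simp: tendsto_at_iff_sequentially o_def)
      qed
      then show "AE x in lborel. (\<lambda>n. f x * q (X (n + N)) x) \<longlonglongrightarrow> f x * D x"
        by (intro always_eventually allI tendsto_mult_left LIMSEQ_ignore_initial_segment)
    qed measurable
    then show "((\<lambda>h. LBINT x. f x * q h x) \<circ> X) \<longlonglongrightarrow> (LBINT x. f x * D x)"
      unfolding o_def by (rule LIMSEQ_offset)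
  qed
  moreover have "(LBINT x. f x * q h x) = ((LBINT x. f x * \<psi> (x + h *\<^sub>R e)) - (LBINT x. f x * \<psi> x)) / h" for h
  proof -
    have "(LBINT x. f x * q h x) = (LBINT x. (f x * \<psi> (x + h *\<^sub>R e) - f x * \<psi> (x + 0 *\<^sub>R e)) / h)"
      unfolding q_def by (simp add: field_simps)
    also have "\<dots> = ((LBINT x. f x * \<psi> (x + h *\<^sub>R e)) - (LBINT x. f x * \<psi> (x + 0 *\<^sub>R e))) / h"
      by (subst integral_divide_zero, subst Bochner_Integration.integral_diff[OF int int]) (rule refl)
    finally show ?thesis by simp
  qed
  ultimately show ?thesis unfolding DERIV_def by simp
qed

lemma translate_integral_derivative_0:
  assumes f: "f \<in> sq_integrable lborel" and \<phi>: "\<phi> \<in> test_functions"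
  shows "((\<lambda>t. LBINT x. f x * \<phi> (x + t *\<^sub>R e)) has_real_derivative
    (LBINT x. f x * dir_deriv e \<phi> x)) (at 0)"
proof -
  obtain C R where C: "0 \<le> C" and CR: "\<And>x. \<bar>dir_deriv e \<phi> x\<bar> \<le> C * indicator (cball 0 R) x"
    using test_functions_bound[OF test_functions_dir_deriv[OF \<phi>]] by blast
  \<comment> \<open>contains every point that a translation by \<open>t e\<close> with \<open>\<bar>t\<bar> \<le> 1\<close> moves into the ball of radius \<open>R\<close>, outside which the derivative vanishes\<close>
  define K where "K = cball (0::real^3) (R + norm e)"
  show ?thesis
  proof (rule integral_line_derivative[where K="\<lambda>x. C * indicator K x"])
    show "f \<in> borel_measurable borel" "\<phi> \<in> borel_measurable borel" "dir_deriv e \<phi> \<in> borel_measurable borel"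
      using sq_integrableD(1)[OF f] test_functionsD(5)[OF \<phi>]
        test_functionsD(5)[OF test_functions_dir_deriv[OF \<phi>]] by simp_all
    show "((\<lambda>t. \<phi> (x + t *\<^sub>R e)) has_real_derivative dir_deriv e \<phi> (x + t *\<^sub>R e)) (at t)" for x t
      by (rule has_real_derivative_along_line[OF \<phi>])
    show "integrable lborel (\<lambda>x. f x * \<phi> (x + t *\<^sub>R e))" for t
      by (intro sq_integrable_mult_integrable f test_functions_sqD test_functions_translate \<phi>)
    show "integrable lborel (\<lambda>x. f x * (C * indicator K x))"
      unfolding K_def by (intro sq_integrable_mult_integrable f sq_integrable_cmult indicator_sq_integrable) auto
    fix x t assume t: "\<bar>t::real\<bar> \<le> 1"
    have "C * indicator (cball 0 R) (x + t *\<^sub>R e) \<le> C * indicator K x"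
    proof (cases "x + t *\<^sub>R e \<in> cball 0 R")
      case True
      have "norm x \<le> norm (x + t *\<^sub>R e) + norm (t *\<^sub>R e)"
        using norm_triangle_ineq4[of "x + t *\<^sub>R e" "t *\<^sub>R e"] by simp
      also have "\<dots> \<le> R + norm e"
        using True t mult_right_mono[of "\<bar>t\<bar>" 1 "norm e"] by (intro add_mono) auto
      finally show ?thesis using C by (simp add: K_def indicator_def)
    qed (use C in simp)
    then show "\<bar>dir_deriv e \<phi> (x + t *\<^sub>R e)\<bar> \<le> C * indicator K x" using CR[of "x + t *\<^sub>R e"] by linarith
  qed
qed

lemma dir_deriv_translate:
  "\<phi> \<in> test_functions \<Longrightarrow> dir_deriv e (\<lambda>x. \<phi> (x + a)) x = dir_deriv e \<phi> (x + a)"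
  unfolding dir_deriv_def by (simp add: partial_deriv_translate test_functionsD(3))

lemma translate_integral_derivative:
  assumes f: "f \<in> sq_integrable lborel" and \<phi>: "\<phi> \<in> test_functions"
  shows "((\<lambda>t. LBINT x. f x * \<phi> (x + t *\<^sub>R e)) has_real_derivative
    (LBINT x. f x * dir_deriv e \<phi> (x + t *\<^sub>R e))) (at t)"
  using translate_integral_derivative_0[OF f test_functions_translate[OF \<phi>, of "t *\<^sub>R e"], of e]
    DERIV_shift[of "\<lambda>t. LBINT x. f x * \<phi> (x + t *\<^sub>R e)" _ 0 t]
  by (simp add: dir_deriv_translate[OF \<phi>] scaleR_add_left add_ac)

text \<open>
  A real and directional form of the weak gradient: directions other than the coordinate axes occur when a
  function is rotated.
\<close>

definition weak_dir_deriv :: "real^3 \<Rightarrow> (real^3 \<Rightarrow> real) \<Rightarrow> (real^3 \<Rightarrow> real) \<Rightarrow> bool" where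
  "weak_dir_deriv e f g \<longleftrightarrow> (\<forall>\<phi>\<in>test_functions.
     (LBINT x. dir_deriv e \<phi> x * f x) = - (LBINT x. \<phi> x * g x))"

lemma integral_sq_shift:
  assumes "f \<in> sq_integrable (lborel :: (real^3) measure)"
  shows "(LBINT x. (f (x + a))\<^sup>2) = (LBINT x. (f x)\<^sup>2)"
  using sq_integrableD(1)[OF assms] by (intro integral_shift[of "\<lambda>x. (f x)\<^sup>2"]) simp

lemma integral_mult_shift:
  assumes f: "f \<in> sq_integrable (lborel :: (real^3) measure)" and g: "g \<in> sq_integrable lborel"
  shows "(LBINT x. f (x + a) * g x) = (LBINT x. f x * g (x - a))"
proof -
  have [measurable]: "f \<in> borel_measurable borel" "g \<in> borel_measurable borel"
    using sq_integrableD(1)[OF f] sq_integrableD(1)[OF g] by simp_all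
  show ?thesis using integral_shift[of "\<lambda>x. f x * g (x - a)" a] by simp
qed

lemma riesz_test_functions:
  assumes Llin: "\<And>f g c. f \<in> test_functions \<Longrightarrow> g \<in> test_functions \<Longrightarrow> L (\<lambda>x. f x + c * g x) = L f + c * L g"
    and bound: "\<And>f. f \<in> test_functions \<Longrightarrow> \<bar>L f\<bar> \<le> B * sqrt (LBINT x. (f x)\<^sup>2)" and B: "0 \<le> B"
  obtains g where "g \<in> sq_integrable lborel" "(LBINT x. (g x)\<^sup>2) \<le> B\<^sup>2"
    "\<And>f. f \<in> test_functions \<Longrightarrow> L f = (LBINT x. f x * g x)"
  using riesz_representation_subspace[OF test_functions_sq_integrable _ test_functions_lin Llin bound B]
    test_functions_zero by blast

lemma integral_mult_lin:
  assumes h: "h \<in> sq_integrable M" and f: "f \<in> sq_integrable M" and g: "g \<in> sq_integrable M"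
  shows "(LINT x|M. h x * (f x + c * g x)) = (LINT x|M. h x * f x) + c * (LINT x|M. h x * g x)"
proof -
  have "(LINT x|M. h x * (f x + c * g x)) = (LINT x|M. h x * f x + c * (h x * g x))"
    by (simp add: algebra_simps)
  also have "\<dots> = (LINT x|M. h x * f x) + c * (LINT x|M. h x * g x)"
    using sq_integrable_mult_integrable[OF h f] sq_integrable_mult_integrable[OF h g] by simp
  finally show ?thesis .
qed

text \<open>
  For a test function \<open>\<phi>\<close> the pairing of \<open>f (\<cdot> + e) - f\<close> with \<open>\<phi>\<close> is an increment over \<open>[0, 1]\<close> of the function
  \<open>t \<mapsto> \<integral> f(x) \<phi>(x - t e) dx\<close>. By weak differentiability the derivative of the latter is a pairing of \<open>g\<close> with a
  translate of \<open>\<phi>\<close>, so it is at most \<open>\<parallel>g\<parallel> \<parallel>\<phi>\<parallel>\<close>. Duality turns this into the bound on the norm: the Riesz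
  representative of the pairing has norm at most \<open>\<parallel>g\<parallel>\<close>, and by the fundamental lemma it is
  \<open>f (\<cdot> + e) - f\<close> itself.
\<close>

lemma translation_bound_of_weak_deriv:
  assumes f: "f \<in> sq_integrable lborel" and g: "g \<in> sq_integrable lborel"
    and weak: "weak_dir_deriv e f g"
  shows "(LBINT x. (f (x + e) - f x)\<^sup>2) \<le> (LBINT x. (g x)\<^sup>2)"
proof -
  define d where "d x = f (x + e) - f x" for x
  have d: "d \<in> sq_integrable lborel"
    unfolding d_def[abs_def] by (intro sq_integrable_diff sq_integrable_shift f)
  define B where "B = sqrt (LBINT x. (g x)\<^sup>2)"
  have B: "0 \<le> B" "B\<^sup>2 = (LBINT x. (g x)\<^sup>2)" unfolding B_def by simp_all
  have bound: "\<bar>LBINT x. d x * \<phi> x\<bar> \<le> B * sqrt (LBINT x. (\<phi> x)\<^sup>2)" if \<phi>: "\<phi> \<in> test_functions" for \<phi>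
  proof -
    note \<phi>2 = test_functions_sqD[OF \<phi>]
    \<comment> \<open>translating the test function by \<open>- e\<close> amounts to translating \<open>f\<close> by \<open>e\<close>\<close>
    define F where "F t = (LBINT x. f x * \<phi> (x + t *\<^sub>R (- e)))" for t
    define F' where "F' t = (LBINT x. f x * dir_deriv (- e) \<phi> (x + t *\<^sub>R (- e)))" for t
    have "(F has_real_derivative F' t) (at t)" for t
      unfolding F_def F'_def by (rule translate_integral_derivative[OF f \<phi>])
    then obtain z where z: "F 1 - F 0 = (1 - 0) * F' z"
      using MVT2[of 0 1 F F'] by auto
    have "F 1 - F 0 = (LBINT x. d x * \<phi> x)"
    proof -
      have "F 1 = (LBINT x. f (x + e) * \<phi> x)"
        unfolding F_def by (subst integral_mult_shift[OF f \<phi>2]) simp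
      then show ?thesis unfolding F_def d_def
        using sq_integrable_mult_integrable[OF sq_integrable_shift[OF f] \<phi>2, of e] sq_integrable_mult_integrable[OF f \<phi>2]
        by (simp add: left_diff_distrib)
    qed
    moreover have "F' z = (LBINT x. \<phi> (x + z *\<^sub>R (- e)) * g x)"
    proof -
      have "(LBINT x. dir_deriv e \<phi> (x + z *\<^sub>R (- e)) * f x) = - (LBINT x. \<phi> (x + z *\<^sub>R (- e)) * g x)"
        using weak test_functions_translate[OF \<phi>, of "z *\<^sub>R (- e)"]
        unfolding weak_dir_deriv_def dir_deriv_translate[OF \<phi>, symmetric] by blast
      then show ?thesis unfolding F'_def dir_deriv_minus by (simp add: mult.commute)
    qed
    moreover have "\<bar>LBINT x. \<phi> (x + z *\<^sub>R (- e)) * g x\<bar> \<le> sqrt (LBINT x. (\<phi> (x + z *\<^sub>R (- e)))\<^sup>2) * B"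
      unfolding B_def by (intro cauchy_schwarz_integral g sq_integrable_shift \<phi>2)
    ultimately show ?thesis using z integral_sq_shift[OF \<phi>2, of "z *\<^sub>R (- e)"] by (simp add: mult.commute)
  qed
  obtain r where r: "r \<in> sq_integrable lborel" "(LBINT x. (r x)\<^sup>2) \<le> B\<^sup>2"
    and rep: "\<And>\<phi>. \<phi> \<in> test_functions \<Longrightarrow> (LBINT x. d x * \<phi> x) = (LBINT x. \<phi> x * r x)"
  proof (rule riesz_test_functions[of "\<lambda>\<phi>. LBINT x. d x * \<phi> x", OF _ bound B(1)])
    show "(LBINT x. d x * (\<phi> x + c * \<psi> x)) = (LBINT x. d x * \<phi> x) + c * (LBINT x. d x * \<psi> x)"
      if "\<phi> \<in> test_functions" "\<psi> \<in> test_functions" for \<phi> \<psi> c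
      by (intro integral_mult_lin d test_functions_sqD that)
  qed blast+
  have "AE x in lborel. d x - r x = 0"
  proof (rule fundamental_lemma_of_variations)
    show "(\<lambda>x. d x - r x) \<in> sq_integrable lborel" by (intro sq_integrable_diff d r)
    show "(LBINT x. \<phi> x * (d x - r x)) = 0" if "\<phi> \<in> test_functions" for \<phi>
      using rep[OF that] sq_integrable_mult_integrable[OF test_functions_sqD[OF that] d]
        sq_integrable_mult_integrable[OF test_functions_sqD[OF that] r(1)]
      by (simp add: right_diff_distrib mult.commute)
  qed
  then have "(LBINT x. (d x)\<^sup>2) = (LBINT x. (r x)\<^sup>2)"
    using sq_integrableD(1)[OF d] sq_integrableD(1)[OF r(1)] by (intro integral_cong_AE) auto
  then show ?thesis using r(2) B(2) unfolding d_def by simp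
qed

lemma abs_deriv_le:
  assumes D: "(F has_real_derivative D) (at 0)" and le: "\<And>t. \<bar>F t - F 0\<bar> \<le> C * \<bar>t\<bar>"
  shows "\<bar>D\<bar> \<le> C"
proof -
  have "((\<lambda>h. \<bar>(F (0 + h) - F 0) / h\<bar>) \<longlongrightarrow> \<bar>D\<bar>) (at 0)"
    using D unfolding DERIV_def by (rule tendsto_rabs)
  moreover have "\<forall>\<^sub>F h in at 0. \<bar>(F (0 + h) - F 0) / h\<bar> \<le> C"
    by (rule eventually_at_filter[THEN iffD2, OF always_eventually])
       (use le in \<open>auto simp: field_simps\<close>)
  ultimately show ?thesis by (rule tendsto_upperbound) simp
qed

text \<open>
  Conversely, \<open>- \<integral> f D\<^sub>e\<phi>\<close> is a limit of pairings of \<open>\<phi>\<close> with difference quotients of \<open>f\<close>, so it is bounded by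
  \<open>B \<parallel>\<phi>\<parallel>\<close> and has a Riesz representative, which is the weak derivative.
\<close>

lemma weak_deriv_of_translation_bound:
  assumes f: "f \<in> sq_integrable lborel" and B: "0 \<le> B"
    and bound: "\<And>t. (LBINT x. (f (x + t *\<^sub>R e) - f x)\<^sup>2) \<le> t\<^sup>2 * B\<^sup>2"
  obtains g where "g \<in> sq_integrable lborel" "(LBINT x. (g x)\<^sup>2) \<le> B\<^sup>2" "weak_dir_deriv e f g"
proof -
  have bd: "\<bar>- (LBINT x. f x * dir_deriv e \<phi> x)\<bar> \<le> B * sqrt (LBINT x. (\<phi> x)\<^sup>2)"
    if \<phi>: "\<phi> \<in> test_functions" for \<phi>
  proof -
    note \<phi>2 = test_functions_sqD[OF \<phi>]
    define F where "F t = (LBINT x. f x * \<phi> (x + t *\<^sub>R e))" for t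
    have le: "\<bar>F t - F 0\<bar> \<le> (B * sqrt (LBINT x. (\<phi> x)\<^sup>2)) * \<bar>t\<bar>" for t
    proof -
      have "F t = (LBINT x. f (x + (- t) *\<^sub>R e) * \<phi> x)"
        unfolding F_def by (subst integral_mult_shift[OF f \<phi>2]) simp
      then have "F t - F 0 = (LBINT x. (f (x + (- t) *\<^sub>R e) - f x) * \<phi> x)"
        unfolding F_def
        using sq_integrable_mult_integrable[OF sq_integrable_shift[OF f] \<phi>2, of "(- t) *\<^sub>R e"]
          sq_integrable_mult_integrable[OF f \<phi>2]
        by (simp add: left_diff_distrib)
      also have "\<bar>\<dots>\<bar> \<le> sqrt (LBINT x. (f (x + (- t) *\<^sub>R e) - f x)\<^sup>2) * sqrt (LBINT x. (\<phi> x)\<^sup>2)"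
        by (intro cauchy_schwarz_integral sq_integrable_diff sq_integrable_shift f \<phi>2)
      also have "\<dots> \<le> sqrt ((- t)\<^sup>2 * B\<^sup>2) * sqrt (LBINT x. (\<phi> x)\<^sup>2)"
        by (intro mult_right_mono real_sqrt_le_mono bound) simp
      also have "sqrt ((- t)\<^sup>2 * B\<^sup>2) = \<bar>t\<bar> * B" using B by (simp add: real_sqrt_mult)
      finally show ?thesis by (simp add: mult_ac)
    qed
    have "(F has_real_derivative (LBINT x. f x * dir_deriv e \<phi> x)) (at 0)"
      unfolding F_def by (rule translate_integral_derivative_0[OF f \<phi>])
    from abs_deriv_le[OF this le]
    have "\<bar>LBINT x. f x * dir_deriv e \<phi> x\<bar> \<le> B * sqrt (LBINT x. (\<phi> x)\<^sup>2)" .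
    then show ?thesis by simp
  qed
  have lin: "- (LBINT x. f x * dir_deriv e (\<lambda>x. \<phi> x + c * \<psi> x) x)
      = - (LBINT x. f x * dir_deriv e \<phi> x) + c * - (LBINT x. f x * dir_deriv e \<psi> x)"
    if "\<phi> \<in> test_functions" "\<psi> \<in> test_functions" for \<phi> \<psi> c
  proof -
    have D: "((\<lambda>x. \<phi> x + c * \<psi> x) has_derivative
      (\<lambda>h. frechet_derivative \<phi> (at x) h + c * frechet_derivative \<psi> (at x) h)) (at x)" for x
      using test_functionsD(3)[OF that(1)] test_functionsD(3)[OF that(2)]
      by (auto intro!: derivative_eq_intros simp: frechet_derivative_works[symmetric])
    have "dir_deriv e (\<lambda>x. \<phi> x + c * \<psi> x) x = dir_deriv e \<phi> x + c * dir_deriv e \<psi> x" for x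
      unfolding dir_deriv_def partial_deriv_eq[OF D]
      by (simp add: partial_deriv_def algebra_simps sum.distrib sum_distrib_left)
    then show ?thesis
      using integral_mult_lin[OF f test_functions_sqD test_functions_sqD,
          OF test_functions_dir_deriv[OF that(1)] test_functions_dir_deriv[OF that(2)]] by simp
  qed
  obtain g where "g \<in> sq_integrable lborel" "(LBINT x. (g x)\<^sup>2) \<le> B\<^sup>2"
    "\<And>\<phi>. \<phi> \<in> test_functions \<Longrightarrow> - (LBINT x. f x * dir_deriv e \<phi> x) = (LBINT x. \<phi> x * g x)"
    using riesz_test_functions[of "\<lambda>\<phi>. - (LBINT x. f x * dir_deriv e \<phi> x)", OF lin bd B] by blast
  moreover from this(3) have "weak_dir_deriv e f g"
    unfolding weak_dir_deriv_def by (simp add: mult.commute[of "dir_deriv e _ _"] flip: \<open>\<And>\<phi>. \<phi> \<in> test_functions \<Longrightarrow> _ = (LBINT x. \<phi> x * g x)\<close>)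
  ultimately show thesis using that by blast
qed

section \<open>Weak gradients of real functions in \<open>H\<^sup>1\<close>\<close>

lemma lebesgue_sq_integrable_representative:
  fixes f :: "real^3 \<Rightarrow> real"
  assumes f: "f \<in> borel_measurable lebesgue" and i: "integrable lebesgue (\<lambda>x. (f x)\<^sup>2)"
  obtains g where "g \<in> sq_integrable lborel" "AE x in lebesgue. f x = g x"
proof -
  obtain g where g: "g \<in> borel_measurable lborel" "AE x in lborel. f x = g x"
    using completion_ex_borel_measurable_real[OF f] by blast
  have ae: "AE x in lebesgue. f x = g x" using g(2) by (rule AE_completion)
  have gl: "g \<in> borel_measurable lebesgue" using g(1) by (rule measurable_completion)
  have "integrable lebesgue (\<lambda>x. (g x)\<^sup>2)"
    by (rule integrable_cong_AE_imp[OF i]) (use gl ae in \<open>auto elim: eventually_mono\<close>)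
  then have "integrable lborel (\<lambda>x. (g x)\<^sup>2)"
    using g(1) by (subst (asm) integrable_completion) auto
  then show thesis using that[of g] g(1) ae by (simp add: sq_integrable_def)
qed

lemma integral_lebesgue_representative:
  fixes f g :: "real^3 \<Rightarrow> real"
  assumes "f \<in> borel_measurable lebesgue" "g \<in> borel_measurable lborel" "AE x in lebesgue. f x = g x"
  shows "(LINT x|lebesgue. f x) = (LBINT x. g x)"
proof -
  have "(LINT x|lebesgue. f x) = (LINT x|lebesgue. g x)"
    by (rule integral_cong_AE[OF assms(1) measurable_completion[OF assms(2)] assms(3)])
  also have "\<dots> = (LBINT x. g x)" using assms(2) by (rule integral_completion)
  finally show ?thesis .
qed

lemma L2D:
  assumes "f \<in> L2"
  shows "f \<in> borel_measurable lebesgue" "integrable lebesgue (\<lambda>x. (norm (f x))\<^sup>2)"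
  using assms by (simp_all add: L2_def)

lemma integrable_scaleR_L2:
  fixes U :: "real^3 \<Rightarrow> complex"
  assumes \<psi>: "\<psi> \<in> sq_integrable lborel" and U: "U \<in> borel_measurable lebesgue"
    and i: "integrable lebesgue (\<lambda>x. (norm (U x))\<^sup>2)"
  shows "integrable lebesgue (\<lambda>x. \<psi> x *\<^sub>R U x)"
proof -
  have \<psi>l: "\<psi> \<in> borel_measurable lebesgue"
    by (rule measurable_completion[OF sq_integrableD(1)[OF \<psi>]])
  have "\<psi> \<in> sq_integrable lebesgue"
    using \<psi> \<psi>l sq_integrableD[OF \<psi>] by (intro sq_integrableI) (auto simp: integrable_completion)
  moreover have "(\<lambda>x. norm (U x)) \<in> sq_integrable lebesgue"
    using U i by (intro sq_integrableI) auto
  ultimately have "integrable lebesgue (\<lambda>x. \<psi> x * norm (U x))"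
    by (rule sq_integrable_mult_integrable)
  then show ?thesis
    by (rule Bochner_Integration.integrable_bound) (use \<psi>l U in auto)
qed

text \<open>
  The case of interest is that \<open>T\<close> is the real or the imaginary part.
\<close>

lemma weak_deriv_component:
  fixes U :: "real^3 \<Rightarrow> complex" and G :: "real^3 \<Rightarrow> complex^3"
  assumes weak: "is_weak_gradient U G" and U: "U \<in> L2" and G: "G \<in> L2"
    and T: "bounded_linear T"
    and f: "f \<in> sq_integrable lborel" "AE x in lebesgue. T (U x) = f x"
    and g: "g \<in> sq_integrable lborel" "AE x in lebesgue. T (G x $ i) = g x"
  shows "weak_dir_deriv (axis i 1) f g"
  unfolding weak_dir_deriv_def dir_deriv_axis
proof
  fix \<phi> assume \<phi>: "\<phi> \<in> test_functions"
  interpret T: bounded_linear T by fact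
  have Tm: "T \<in> borel_measurable borel"
    by (intro borel_measurable_continuous_onI T.continuous_on continuous_on_id)
  have pull: "T (LINT x|lebesgue. \<psi> x *\<^sub>R V x) = (LBINT x. \<psi> x * h x)"
    if \<psi>: "\<psi> \<in> test_functions" and V: "V \<in> borel_measurable lebesgue" "integrable lebesgue (\<lambda>x. (norm (V x))\<^sup>2)"
      and h: "h \<in> sq_integrable lborel" "AE x in lebesgue. T (V x) = h x" for \<psi> V h
  proof -
    have \<psi>b: "\<psi> \<in> borel_measurable lborel" using test_functionsD(5)[OF \<psi>] by simp
    have \<psi>l: "\<psi> \<in> borel_measurable lebesgue" using \<psi>b by (rule measurable_completion)
    have "T (LINT x|lebesgue. \<psi> x *\<^sub>R V x) = (LINT x|lebesgue. T (\<psi> x *\<^sub>R V x))"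
      by (rule integral_bounded_linear[OF T, symmetric])
         (intro integrable_scaleR_L2 test_functions_sqD \<psi> V)
    also have "\<dots> = (LINT x|lebesgue. \<psi> x * T (V x))" by (simp add: T.scaleR)
    also have "\<dots> = (LBINT x. \<psi> x * h x)"
    proof (rule integral_lebesgue_representative)
      show "(\<lambda>x. \<psi> x * T (V x)) \<in> borel_measurable lebesgue"
        using \<psi>l measurable_compose[OF V(1) Tm] by (intro borel_measurable_times)
      show "(\<lambda>x. \<psi> x * h x) \<in> borel_measurable lborel"
        using \<psi>b sq_integrableD(1)[OF h(1)] by (intro borel_measurable_times)
      show "AE x in lebesgue. \<psi> x * T (V x) = \<psi> x * h x" using h(2) by eventually_elim simp
    qed
    finally show ?thesis .
  qed
  have Gi: "(\<lambda>x. G x $ i) \<in> borel_measurable lebesgue"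
    by (rule measurable_compose[OF L2D(1)[OF G]])
       (intro borel_measurable_continuous_onI continuous_intros)
  have Gii: "integrable lebesgue (\<lambda>x. (norm (G x $ i))\<^sup>2)"
    by (rule Bochner_Integration.integrable_bound[OF L2D(2)[OF G]])
       (use Gi in \<open>auto intro!: power_mono Finite_Cartesian_Product.norm_nth_le\<close>)
  have eq: "(LINT x|lebesgue. partial_deriv i \<phi> x *\<^sub>R U x) = - (LINT x|lebesgue. \<phi> x *\<^sub>R (G x $ i))"
    using weak \<phi> unfolding is_weak_gradient_def by blast
  have "(LBINT x. partial_deriv i \<phi> x * f x) = T (LINT x|lebesgue. partial_deriv i \<phi> x *\<^sub>R U x)"
    by (rule pull[symmetric]) (intro test_functions_partial_deriv \<phi> L2D[OF U] f)+
  also have "\<dots> = - T (LINT x|lebesgue. \<phi> x *\<^sub>R (G x $ i))" unfolding eq by (rule T.neg)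
  also have "T (LINT x|lebesgue. \<phi> x *\<^sub>R (G x $ i)) = (LBINT x. \<phi> x * g x)"
    by (rule pull) (intro \<phi> Gi Gii g)+
  finally show "(LBINT x. partial_deriv i \<phi> x * f x) = - (LBINT x. \<phi> x * g x)" .
qed

lemma weak_dir_deriv_unique:
  assumes f: "weak_dir_deriv e f g" "weak_dir_deriv e f g'"
    and g: "g \<in> sq_integrable lborel" "g' \<in> sq_integrable lborel"
  shows "AE x in lborel. g x = g' x"
proof -
  have "AE x in lborel. g x - g' x = 0"
  proof (rule fundamental_lemma_of_variations)
    show "(\<lambda>x. g x - g' x) \<in> sq_integrable lborel" by (intro sq_integrable_diff g)
    show "(LBINT x. \<phi> x * (g x - g' x)) = 0" if "\<phi> \<in> test_functions" for \<phi>
      using f that sq_integrable_mult_integrable[OF test_functions_sqD[OF that] g(1)]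
        sq_integrable_mult_integrable[OF test_functions_sqD[OF that] g(2)]
      by (simp add: right_diff_distrib weak_dir_deriv_def)
  qed
  then show ?thesis by eventually_elim simp
qed

lemma weak_dir_deriv_zero: "weak_dir_deriv e (\<lambda>x. 0) (\<lambda>x. 0)"
  by (simp add: weak_dir_deriv_def)

lemma weak_dir_deriv_sum:
  assumes f: "f \<in> sq_integrable lborel" and g: "\<And>i. g i \<in> sq_integrable lborel"
    and weak: "\<And>i. weak_dir_deriv (axis i 1) f (g i)"
  shows "weak_dir_deriv e f (\<lambda>x. \<Sum>i\<in>UNIV. e $ i * g i x)"
  unfolding weak_dir_deriv_def
proof
  fix \<phi> assume \<phi>: "\<phi> \<in> test_functions"
  have "(LBINT x. dir_deriv e \<phi> x * f x) = (LBINT x. (\<Sum>i\<in>UNIV. e $ i * (partial_deriv i \<phi> x * f x)))"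
    by (simp add: dir_deriv_def sum_distrib_right mult.assoc)
  also have "\<dots> = (\<Sum>i\<in>UNIV. e $ i * (LBINT x. partial_deriv i \<phi> x * f x))"
    using sq_integrable_mult_integrable[OF test_functions_sqD[OF test_functions_partial_deriv[OF \<phi>]] f]
    by (subst Bochner_Integration.integral_sum) auto
  also have "\<dots> = (\<Sum>i\<in>UNIV. e $ i * - (LBINT x. \<phi> x * g i x))"
    using weak \<phi> unfolding weak_dir_deriv_def dir_deriv_axis by simp
  also have "\<dots> = - (LBINT x. (\<Sum>i\<in>UNIV. e $ i * (\<phi> x * g i x)))"
    using sq_integrable_mult_integrable[OF test_functions_sqD[OF \<phi>] g]
    by (subst Bochner_Integration.integral_sum) (auto simp: sum_negf)
  also have "(LBINT x. (\<Sum>i\<in>UNIV. e $ i * (\<phi> x * g i x))) = (\<integral>x. \<phi> x * (\<Sum>i\<in>UNIV. e $ i * g i x) \<partial>lborel)"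
    by (simp add: sum_distrib_left mult_ac)
  finally show "(LBINT x. dir_deriv e \<phi> x * f x) = - (\<integral>x. \<phi> x * (\<Sum>i\<in>UNIV. e $ i * g i x) \<partial>lborel)" .
qed

lemma power2_norm_vec: "(norm (x :: 'a::real_normed_vector ^ 'n))\<^sup>2 = (\<Sum>i\<in>UNIV. (norm (x $ i))\<^sup>2)"
  by (simp add: norm_vec_def L2_set_def sum_nonneg)

lemma borel_measurable_vec_nth:
  fixes G :: "'a \<Rightarrow> complex^'n"
  shows "G \<in> borel_measurable M \<Longrightarrow> (\<lambda>x. G x $ i) \<in> borel_measurable M"
  by (erule measurable_compose) (intro borel_measurable_continuous_onI continuous_intros)

text \<open>
  The imaginary part of the weak gradient of a real function is a weak gradient of \<open>0\<close>, hence vanishes, so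
  the norm of the whole gradient is carried by the real parts of its components.
\<close>

lemma weak_gradient_components:
  fixes U :: "real^3 \<Rightarrow> complex"
  assumes U: "U \<in> L2" and G: "G \<in> L2" and weak: "is_weak_gradient U G"
    and f: "f \<in> sq_integrable lborel" "AE x in lebesgue. U x = of_real (f x)"
  obtains g where "\<And>i. g i \<in> sq_integrable lborel" "\<And>i. weak_dir_deriv (axis i 1) f (g i)"
    "(L2_norm G)\<^sup>2 = (\<Sum>i\<in>UNIV. LBINT x. (g i x)\<^sup>2)"
proof -
  have Gi: "(\<lambda>x. G x $ i) \<in> borel_measurable lebesgue" for i
    by (intro borel_measurable_vec_nth L2D(1)[OF G])
  have le: "(Re (G x $ i))\<^sup>2 \<le> (norm (G x))\<^sup>2" "(Im (G x $ i))\<^sup>2 \<le> (norm (G x))\<^sup>2" for i x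
    using Finite_Cartesian_Product.norm_nth_le[of "G x" i] abs_Re_le_cmod[of "G x $ i"] abs_Im_le_cmod[of "G x $ i"]
    by (auto simp: abs_le_square_iff[symmetric])
  have meas: "(\<lambda>x. Re (G x $ i)) \<in> borel_measurable lebesgue" "(\<lambda>x. Im (G x $ i)) \<in> borel_measurable lebesgue" for i
    using measurable_compose[OF Gi borel_measurable_Re] measurable_compose[OF Gi borel_measurable_Im] by blast+
  have intRe: "integrable lebesgue (\<lambda>x. (Re (G x $ i))\<^sup>2)" for i
    by (rule Bochner_Integration.integrable_bound[OF L2D(2)[OF G]])
       (simp_all only: real_norm_def abs_power2 le always_eventually borel_measurable_power meas simp_thms)
  have intIm: "integrable lebesgue (\<lambda>x. (Im (G x $ i))\<^sup>2)" for i
    by (rule Bochner_Integration.integrable_bound[OF L2D(2)[OF G]])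
       (simp_all only: real_norm_def abs_power2 le always_eventually borel_measurable_power meas simp_thms)
  have "\<forall>i. \<exists>g. g \<in> sq_integrable lborel \<and> (AE x in lebesgue. Re (G x $ i) = g x)"
    using lebesgue_sq_integrable_representative[OF meas(1) intRe] by blast
  from choice[OF this] obtain g
    where g: "\<And>i. g i \<in> sq_integrable lborel" "\<And>i. AE x in lebesgue. Re (G x $ i) = g i x" by blast
  have "\<forall>i. \<exists>h. h \<in> sq_integrable lborel \<and> (AE x in lebesgue. Im (G x $ i) = h x)"
    using lebesgue_sq_integrable_representative[OF meas(2) intIm] by blast
  from choice[OF this] obtain h
    where h: "\<And>i. h i \<in> sq_integrable lborel" "\<And>i. AE x in lebesgue. Im (G x $ i) = h i x" by blast
  have gw: "weak_dir_deriv (axis i 1) f (g i)" for i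
    by (rule weak_deriv_component[OF weak U G bounded_linear_Re f(1) _ g])
       (use f(2) in eventually_elim, simp)
  have "weak_dir_deriv (axis i 1) (\<lambda>x. 0) (h i)" for i
    by (rule weak_deriv_component[OF weak U G bounded_linear_Im sq_integrable_zero _ h])
       (use f(2) in eventually_elim, simp)
  then have h0: "AE x in lborel. h i x = 0" for i
    using weak_dir_deriv_unique[OF _ weak_dir_deriv_zero h(1) sq_integrable_zero] by blast
  have [measurable]: "g i \<in> borel_measurable borel" for i using sq_integrableD(1)[OF g(1)] by simp
  have "(L2_norm G)\<^sup>2 = (LINT x|lebesgue. (norm (G x))\<^sup>2)" unfolding L2_norm_def by simp
  also have "\<dots> = (LBINT x. (\<Sum>i\<in>UNIV. (g i x)\<^sup>2))"
  proof (rule integral_lebesgue_representative)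
    show "(\<lambda>x. (norm (G x))\<^sup>2) \<in> borel_measurable lebesgue" using L2D(1)[OF G] by measurable
    have "AE x in lebesgue. \<forall>i. Re (G x $ i) = g i x" using g(2) by (simp add: AE_all_countable)
    moreover have "AE x in lebesgue. \<forall>i. Im (G x $ i) = h i x" using h(2) by (simp add: AE_all_countable)
    moreover have "AE x in lebesgue. \<forall>i. h i x = 0"
      using AE_completion[OF h0] by (simp add: AE_all_countable)
    ultimately show "AE x in lebesgue. (norm (G x))\<^sup>2 = (\<Sum>i\<in>UNIV. (g i x)\<^sup>2)"
      by eventually_elim (simp add: power2_norm_vec cmod_power2)
  qed measurable
  also have "\<dots> = (\<Sum>i\<in>UNIV. LBINT x. (g i x)\<^sup>2)"
    using sq_integrableD(2)[OF g(1)] by (intro Bochner_Integration.integral_sum) auto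
  finally show thesis using that[OF g(1) gw] by blast
qed

lemma weak_gradient_exists:
  assumes "U \<in> H1"
  shows "weak_gradient U \<in> L2" "is_weak_gradient U (weak_gradient U)"
proof -
  have "\<exists>g. g \<in> L2 \<and> is_weak_gradient U g" using assms unfolding H1_def by blast
  from someI_ex[OF this] show "weak_gradient U \<in> L2" "is_weak_gradient U (weak_gradient U)"
    unfolding weak_gradient_def by blast+
qed

lemma of_real_L2:
  assumes f: "f \<in> sq_integrable lborel"
  shows "(\<lambda>x. complex_of_real (f x)) \<in> L2"
proof -
  have [measurable]: "f \<in> borel_measurable lebesgue"
    by (rule measurable_completion[OF sq_integrableD(1)[OF f]])
  have "integrable lebesgue (\<lambda>x. (f x)\<^sup>2)"
    using sq_integrableD[OF f] by (subst integrable_completion) auto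
  then show ?thesis by (simp add: L2_def)
qed

text \<open>
  The norm is that of the gradient picked by \<open>weak_gradient\<close>; weak derivatives are unique up to null sets,
  so it can be computed from any other choice.
\<close>

lemma of_real_H1:
  assumes f: "f \<in> sq_integrable lborel"
    and g: "\<And>i. g i \<in> sq_integrable lborel" "\<And>i. weak_dir_deriv (axis i 1) f (g i)"
  shows "(\<lambda>x. complex_of_real (f x)) \<in> H1"
    and "(L2_norm (weak_gradient (\<lambda>x. complex_of_real (f x))))\<^sup>2 = (\<Sum>i\<in>UNIV. LBINT x. (g i x)\<^sup>2)"
proof -
  let ?U = "\<lambda>x. complex_of_real (f x)"
  let ?G = "\<lambda>x. \<chi> i. complex_of_real (g i x)"
  have [measurable]: "f \<in> borel_measurable lborel" "g i \<in> borel_measurable lborel" for i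
    using sq_integrableD(1)[OF f] sq_integrableD(1)[OF g(1)] by auto
  have [measurable]: "g i \<in> borel_measurable lebesgue" for i
    by (rule measurable_completion) measurable
  have U: "?U \<in> L2" by (rule of_real_L2[OF f])
  have "?G \<in> borel_measurable lebesgue"
  proof (subst borel_measurable_euclidean_space, intro ballI)
    fix b :: "complex^3" assume "b \<in> Basis"
    then obtain i c where b: "b = axis i c" by (auto simp: Basis_vec_def)
    have "(\<lambda>x. ?G x \<bullet> b) = (\<lambda>x. complex_of_real (g i x) \<bullet> c)"
      unfolding b by (simp add: inner_axis)
    then show "(\<lambda>x. ?G x \<bullet> b) \<in> borel_measurable lebesgue" by simp
  qed
  moreover have "integrable lebesgue (\<lambda>x. (norm (?G x))\<^sup>2)"
  proof -
    have "integrable lebesgue (\<lambda>x. \<Sum>i\<in>UNIV. (g i x)\<^sup>2)"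
      using sq_integrableD[OF g(1)] by (intro Bochner_Integration.integrable_sum) (auto simp: integrable_completion)
    then show ?thesis by (simp add: power2_norm_vec)
  qed
  ultimately have G: "?G \<in> L2" by (simp add: L2_def)
  have conv: "(LINT x|lebesgue. \<psi> x *\<^sub>R complex_of_real (h x)) = complex_of_real (LBINT x. \<psi> x * h x)"
    if "\<psi> \<in> test_functions" "h \<in> sq_integrable lborel" for \<psi> h
  proof -
    have [measurable]: "\<psi> \<in> borel_measurable lborel" "h \<in> borel_measurable lborel"
      using test_functionsD(5)[OF that(1)] sq_integrableD(1)[OF that(2)] by simp_all
    have "(LINT x|lebesgue. \<psi> x *\<^sub>R complex_of_real (h x)) = (LINT x|lebesgue. complex_of_real (\<psi> x * h x))"
      by (simp add: scaleR_conv_of_real)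
    also have "\<dots> = complex_of_real (LINT x|lebesgue. \<psi> x * h x)"
    proof (rule integral_of_real)
      show "integrable lebesgue (\<lambda>x. \<psi> x * h x)"
        using sq_integrable_mult_integrable[OF test_functions_sqD[OF that(1)] that(2)]
        by (subst integrable_completion) auto
    qed
    also have "(LINT x|lebesgue. \<psi> x * h x) = (LBINT x. \<psi> x * h x)"
      by (rule integral_completion) measurable
    finally show ?thesis .
  qed
  have "is_weak_gradient ?U ?G"
    unfolding is_weak_gradient_def
  proof (intro ballI allI)
    fix \<phi> i assume \<phi>: "\<phi> \<in> test_functions"
    show "(LINT x|lebesgue. partial_deriv i \<phi> x *\<^sub>R ?U x) = - (LINT x|lebesgue. \<phi> x *\<^sub>R (?G x $ i))"
      using g(2)[of i] \<phi> unfolding weak_dir_deriv_def dir_deriv_axis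
      by (simp add: conv[OF test_functions_partial_deriv[OF \<phi>] f] conv[OF \<phi> g(1)])
  qed
  then show H: "?U \<in> H1" unfolding H1_def using U G by blast
  obtain g' where g': "\<And>i. g' i \<in> sq_integrable lborel" "\<And>i. weak_dir_deriv (axis i 1) f (g' i)"
    "(L2_norm (weak_gradient ?U))\<^sup>2 = (\<Sum>i\<in>UNIV. LBINT x. (g' i x)\<^sup>2)"
    using weak_gradient_components[OF U weak_gradient_exists[OF H] f] by auto
  have "(LBINT x. (g' i x)\<^sup>2) = (LBINT x. (g i x)\<^sup>2)" for i
  proof (rule integral_cong_AE)
    show "AE x in lborel. (g' i x)\<^sup>2 = (g i x)\<^sup>2"
      using weak_dir_deriv_unique[OF g'(2) g(2) g'(1) g(1), of i] by eventually_elim simp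
  qed (use sq_integrableD(1)[OF g'(1)] in auto)
  then show "(L2_norm (weak_gradient ?U))\<^sup>2 = (\<Sum>i\<in>UNIV. LBINT x. (g i x)\<^sup>2)"
    using g'(3) by simp
qed

section \<open>The Coulomb potential and ball averages\<close>

text \<open>
  \<open>a\<^sup>2 - b\<^sup>2 = (a - b) (a + b)\<close> and the Cauchy--Schwarz inequality. So the density \<open>w\<^sup>2\<close> of an \<open>H\<^sup>1\<close> function is
  Lipschitz under translations in \<open>L\<^sup>1\<close>; this is the only regularity of densities used below.
\<close>

lemma square_translation_bound:
  fixes w :: "real^3 \<Rightarrow> real"
  assumes w: "w \<in> sq_integrable lborel" and B: "0 \<le> B"
    and bound: "(LBINT x. (w (x + h) - w x)\<^sup>2) \<le> B\<^sup>2 * (norm h)\<^sup>2"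
  shows "(LBINT x. \<bar>(w (x + h))\<^sup>2 - (w x)\<^sup>2\<bar>) \<le> 2 * B * sqrt (LBINT x. (w x)\<^sup>2) * norm h"
proof -
  define N where "N = (LBINT x. (w x)\<^sup>2)"
  note ws = sq_integrable_shift[OF w, of h]
  have m: "(\<lambda>x. \<bar>w (x + h) - w x\<bar>) \<in> sq_integrable lborel" "(\<lambda>x. \<bar>w (x + h) + w x\<bar>) \<in> sq_integrable lborel"
    using sq_integrable_diff[OF ws w] sq_integrable_add[OF ws w]
    by (auto simp: sq_integrable_def)
  have "(LBINT x. \<bar>(w (x + h))\<^sup>2 - (w x)\<^sup>2\<bar>) = (LBINT x. \<bar>w (x + h) - w x\<bar> * \<bar>w (x + h) + w x\<bar>)"
    by (simp add: abs_mult[symmetric] power2_eq_square algebra_simps)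
  also have "\<dots> \<le> sqrt (LBINT x. \<bar>w (x + h) - w x\<bar>\<^sup>2) * sqrt (LBINT x. \<bar>w (x + h) + w x\<bar>\<^sup>2)"
    using cauchy_schwarz_integral[OF m] by (auto simp: abs_le_iff)
  also have "\<dots> \<le> (B * norm h) * (2 * sqrt N)"
  proof (rule mult_mono)
    show "sqrt (LBINT x. \<bar>w (x + h) - w x\<bar>\<^sup>2) \<le> B * norm h"
      using bound B by (intro real_le_lsqrt) (auto simp: power_mult_distrib)
    have "(LBINT x. (w (x + h) + w x)\<^sup>2) \<le> (LBINT x. 2 * (w (x + h))\<^sup>2 + 2 * (w x)\<^sup>2)"
    proof (rule integral_mono)
      show "(w (x + h) + w x)\<^sup>2 \<le> 2 * (w (x + h))\<^sup>2 + 2 * (w x)\<^sup>2" for x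
        using sum_squares_bound[of "w (x + h)" "w x"] by (simp add: power2_sum)
    qed (use sq_integrableD(2)[OF sq_integrable_add[OF ws w]] sq_integrableD(2)[OF ws] sq_integrableD(2)[OF w] in auto)
    also have "\<dots> = 4 * N"
      using sq_integrableD(2)[OF ws] sq_integrableD(2)[OF w] integral_sq_shift[OF w, of h]
      unfolding N_def by simp
    finally have "sqrt (LBINT x. (w (x + h) + w x)\<^sup>2) \<le> sqrt (4 * N)" by simp
    also have "sqrt (4 * N) = 2 * sqrt N" by (simp add: real_sqrt_mult)
    finally show "sqrt (LBINT x. \<bar>w (x + h) + w x\<bar>\<^sup>2) \<le> 2 * sqrt N" by simp
  qed (use B in \<open>auto simp: N_def\<close>)
  finally show ?thesis unfolding N_def by (simp add: mult_ac)
qed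

text \<open>
  A form of Hardy's inequality. The vector field \<open>x / \<bar>x\<bar>\<close> is bounded by \<open>1\<close> and has divergence \<open>2 / \<bar>x\<bar>\<close>, and
  integrating \<open>\<rho>\<close> against the divergence of a bounded field is controlled by the translations of \<open>\<rho>\<close>. The
  field is regularized to \<open>x / sqrt (\<bar>x\<bar>\<^sup>2 + \<epsilon>)\<close>, which has bounded derivatives and divergence at least
  \<open>2 / sqrt (\<bar>x\<bar>\<^sup>2 + \<epsilon>)\<close>; Fatou's lemma removes \<open>\<epsilon>\<close>.
\<close>

lemma coulomb_potential_bound_origin:
  fixes \<rho> :: "real^3 \<Rightarrow> real"
  assumes int: "integrable lborel \<rho>" and nonneg: "\<And>x. 0 \<le> \<rho> x"
    and lip: "\<And>h. (LBINT x. \<bar>\<rho> (x + h) - \<rho> x\<bar>) \<le> C * norm h"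
  shows "(\<integral>\<^sup>+x. ennreal (\<rho> x / norm x) \<partial>lborel) \<le> ennreal (3 * C / 2)"
proof -
  have [measurable]: "\<rho> \<in> borel_measurable borel" using borel_measurable_integrable[OF int] by simp
  have approx: "(\<integral>\<^sup>+x. ennreal (\<rho> x / sqrt (x \<bullet> x + \<epsilon>)) \<partial>lborel) \<le> ennreal (3 * C / 2)" if \<epsilon>: "0 < \<epsilon>" for \<epsilon>
  proof -
    \<comment> \<open>\<open>D i\<close> is the \<open>i\<close>-th summand of the divergence of the field \<open>\<psi> = y / s y\<close>\<close>
    define s where "s y = sqrt (y \<bullet> y + \<epsilon>)" for y :: "real^3"
    define \<psi> where "\<psi> i y = y $ i / s y" for i y
    define D where "D i y = 1 / s y - (y $ i)\<^sup>2 / (s y) ^ 3" for i y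
    have s2: "(s y)\<^sup>2 = y \<bullet> y + \<epsilon>" for y unfolding s_def using \<epsilon> by (simp add: add_nonneg_nonneg)
    have s0: "0 < s y" for y unfolding s_def using \<epsilon> by (simp add: add_nonneg_pos)
    have s\<epsilon>: "sqrt \<epsilon> \<le> s y" for y unfolding s_def using \<epsilon> by simp
    have yi: "(y $ i)\<^sup>2 \<le> (s y)\<^sup>2" for i y
    proof -
      have "(y $ i)\<^sup>2 \<le> (norm y)\<^sup>2"
        using component_le_norm_cart[of y i] by (simp add: abs_le_square_iff[symmetric])
      then show ?thesis using \<epsilon> by (simp add: s2 power2_norm_eq_inner)
    qed
    have sm [measurable]: "s \<in> borel_measurable borel"
      unfolding s_def[abs_def] by (intro borel_measurable_continuous_onI continuous_intros)
    have nthm [measurable]: "(\<lambda>y::real^3. y $ i) \<in> borel_measurable borel" for i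
      by (intro borel_measurable_continuous_onI continuous_intros)
    have [measurable]: "\<psi> i \<in> borel_measurable borel" "D i \<in> borel_measurable borel" for i
      unfolding \<psi>_def[abs_def] D_def[abs_def] by measurable
    have \<psi>1: "\<bar>\<psi> i y\<bar> \<le> 1" for i y
      using yi[of y i] s0[of y] by (simp add: \<psi>_def abs_le_square_iff[symmetric])
    have D0: "0 \<le> D i y" and D1: "D i y \<le> 1 / sqrt \<epsilon>" for i y
    proof -
      have "(y $ i)\<^sup>2 / (s y) ^ 3 \<le> (s y)\<^sup>2 / (s y) ^ 3" using yi s0[of y] by (intro divide_right_mono) auto
      also have "\<dots> = 1 / s y" using s0[of y] by (simp add: power2_eq_square power3_eq_cube)
      finally show "0 \<le> D i y" unfolding D_def by simp
      have "D i y \<le> 1 / s y" unfolding D_def using s0[of y] by simp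
      also have "\<dots> \<le> 1 / sqrt \<epsilon>" using s\<epsilon> s0 \<epsilon> by (intro divide_left_mono) auto
      finally show "D i y \<le> 1 / sqrt \<epsilon>" .
    qed
    have deriv: "((\<lambda>t. \<psi> i (x + t *\<^sub>R axis i 1)) has_real_derivative D i (x + t *\<^sub>R axis i 1)) (at t)" for i x t
    proof -
      let ?y = "x + t *\<^sub>R axis i 1 :: real^3"
      have inn: "(x + t *\<^sub>R axis i 1) \<bullet> (x + t *\<^sub>R axis i 1) = x \<bullet> x + 2 * t * x $ i + t\<^sup>2" for t
        by (simp add: inner_add_left inner_add_right inner_axis_axis inner_axis inner_commute[of "axis i 1" x]
            power2_eq_square algebra_simps)
      have yi: "?y $ i = x $ i + t" by (simp add: axis_def)
      have pos: "0 < x \<bullet> x + 2 * t * x $ i + t\<^sup>2 + \<epsilon>" using s0[of ?y] unfolding s_def inn by simp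
      have "((\<lambda>t. (x $ i + t) / sqrt (x \<bullet> x + 2 * t * x $ i + t\<^sup>2 + \<epsilon>)) has_real_derivative
          (1 * s ?y - (x $ i + t) * ((2 * x $ i + 2 * t) * (inverse (s ?y) / 2))) / (s ?y * s ?y)) (at t)"
        unfolding s_def inn using pos by (auto intro!: derivative_eq_intros)
      moreover have "(1 * s ?y - (x $ i + t) * ((2 * x $ i + 2 * t) * (inverse (s ?y) / 2))) / (s ?y * s ?y) = D i ?y"
        unfolding D_def yi using s0[of ?y] by (simp add: field_simps power2_eq_square power3_eq_cube)
      moreover have "(\<lambda>t. \<psi> i (x + t *\<^sub>R axis i 1)) = (\<lambda>t. (x $ i + t) / sqrt (x \<bullet> x + 2 * t * x $ i + t\<^sup>2 + \<epsilon>))"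
        unfolding \<psi>_def s_def inn by (simp add: axis_def)
      ultimately show ?thesis by simp
    qed
    have int\<psi>: "integrable lborel (\<lambda>x. f x * \<psi> i (x + a))" if "integrable lborel f" for f i a
      using that \<psi>1 by (intro Bochner_Integration.integrable_bound[OF that])
        (auto simp: abs_mult intro!: mult_left_le)
    have intD: "integrable lborel (\<lambda>x. \<rho> x * D i x)" for i
    proof (rule Bochner_Integration.integrable_bound)
      show "integrable lborel (\<lambda>x. \<rho> x * (1 / sqrt \<epsilon>))" using int by (rule integrable_mult_left)
      show "AE x in lborel. norm (\<rho> x * D i x) \<le> norm (\<rho> x * (1 / sqrt \<epsilon>))"
      proof (rule AE_I2)
        fix x
        have "0 \<le> \<rho> x * D i x" "\<rho> x * D i x \<le> \<rho> x * (1 / sqrt \<epsilon>)"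
          using D0 D1 nonneg by (auto intro: mult_left_mono mult_nonneg_nonneg simp del: times_divide_eq_right)
        then show "norm (\<rho> x * D i x) \<le> norm (\<rho> x * (1 / sqrt \<epsilon>))" unfolding real_norm_def by argo
      qed
    qed measurable
    have Ci: "(LBINT x. \<rho> x * D i x) \<le> C" for i
    proof -
      define F where "F t = (LBINT x. \<rho> x * \<psi> i (x + t *\<^sub>R axis i 1))" for t
      have "(F has_real_derivative (LBINT x. \<rho> x * D i x)) (at 0)"
        unfolding F_def
      proof (rule integral_line_derivative[where K="\<lambda>x. 1 / sqrt \<epsilon>"])
        show "\<bar>D i (x + t *\<^sub>R axis i 1)\<bar> \<le> 1 / sqrt \<epsilon>" for x t using D0 D1 by (simp add: abs_le_iff order_trans[of _ 0])
        show "integrable lborel (\<lambda>x. \<rho> x * (1 / sqrt \<epsilon>))" using int by (rule integrable_mult_left)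
      qed (use deriv int\<psi>[OF int] in auto)
      moreover have "\<bar>F t - F 0\<bar> \<le> C * \<bar>t\<bar>" for t
      proof -
        define h where "h = - (t *\<^sub>R axis i 1 :: real^3)"
        have intd: "integrable lborel (\<lambda>x. \<rho> (x + h) - \<rho> x)"
          using int integrable_shift[of \<rho> h] by (intro Bochner_Integration.integrable_diff) auto
        have "F t = (LBINT x. \<rho> (x + h) * \<psi> i x)"
          unfolding F_def h_def using integral_shift[of "\<lambda>x. \<rho> (x - t *\<^sub>R axis i 1) * \<psi> i x" "t *\<^sub>R axis i 1"] by simp
        then have "F t - F 0 = (LBINT x. (\<rho> (x + h) - \<rho> x) * \<psi> i x)"
          unfolding F_def using int\<psi>[of _ i 0] int integrable_shift[of \<rho> h]
          by (simp add: left_diff_distrib)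
        also have "\<bar>\<dots>\<bar> \<le> (LBINT x. \<bar>\<rho> (x + h) - \<rho> x\<bar>)"
        proof (rule order_trans[OF integral_abs_bound], rule integral_mono)
          show "integrable lborel (\<lambda>x. \<bar>(\<rho> (x + h) - \<rho> x) * \<psi> i x\<bar>)" using int\<psi>[OF intd, of i 0] by auto
          show "\<bar>(\<rho> (x + h) - \<rho> x) * \<psi> i x\<bar> \<le> \<bar>\<rho> (x + h) - \<rho> x\<bar>" for x
            using \<psi>1[of i x] by (simp add: abs_mult mult_left_le)
        qed (use intd in auto)
        also have "\<dots> \<le> C * \<bar>t\<bar>" using lip[of h] by (simp add: h_def)
        finally show ?thesis .
      qed
      ultimately have "\<bar>LBINT x. \<rho> x * D i x\<bar> \<le> C" by (rule abs_deriv_le)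
      then show ?thesis by simp
    qed
    have le: "2 * (\<rho> x / s x) \<le> (\<Sum>i\<in>UNIV. \<rho> x * D i x)" for x
    proof -
      have "(\<Sum>i\<in>UNIV. (x $ i)\<^sup>2) = x \<bullet> x"
        by (simp add: inner_vec_def power2_eq_square)
      then have "(\<Sum>i\<in>UNIV. D i x) = 3 / s x - (x \<bullet> x) / (s x) ^ 3"
        unfolding D_def by (simp add: sum_subtractf sum_divide_distrib[symmetric])
      moreover have "(x \<bullet> x) / (s x) ^ 3 \<le> (s x)\<^sup>2 / (s x) ^ 3"
        using s0[of x] \<epsilon> by (intro divide_right_mono) (auto simp: s2)
      moreover have "(s x)\<^sup>2 / (s x) ^ 3 = 1 / s x" using s0[of x] by (simp add: power2_eq_square power3_eq_cube)
      ultimately have "2 / s x \<le> (\<Sum>i\<in>UNIV. D i x)" by simp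
      then have "\<rho> x * (2 / s x) \<le> \<rho> x * (\<Sum>i\<in>UNIV. D i x)" using nonneg by (rule mult_left_mono)
      then show ?thesis by (simp add: sum_distrib_left mult_ac)
    qed
    have ints: "integrable lborel (\<lambda>x. \<rho> x / s x)"
    proof (rule Bochner_Integration.integrable_bound)
      show "integrable lborel (\<lambda>x. \<Sum>i\<in>UNIV. \<rho> x * D i x)" using intD by auto
      have "\<bar>\<rho> x / s x\<bar> \<le> \<bar>\<Sum>i\<in>UNIV. \<rho> x * D i x\<bar>" for x
        using le[of x] s0[of x] nonneg[of x] divide_nonneg_pos[of "\<rho> x" "s x"] by linarith
      then show "AE x in lborel. norm (\<rho> x / s x) \<le> norm (\<Sum>i\<in>UNIV. \<rho> x * D i x)" by simp
    qed measurable
    have "2 * (LBINT x. \<rho> x / s x) = (LBINT x. 2 * (\<rho> x / s x))"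
      by (rule integral_mult_right_zero[symmetric])
    also have "\<dots> \<le> (LBINT x. (\<Sum>i\<in>UNIV. \<rho> x * D i x))"
      by (intro integral_mono integrable_mult_right ints Bochner_Integration.integrable_sum intD le)
    also have "\<dots> = (\<Sum>i\<in>UNIV. LBINT x. \<rho> x * D i x)"
      using intD by (intro Bochner_Integration.integral_sum) auto
    also have "\<dots> \<le> (\<Sum>i\<in>(UNIV::3 set). C)" by (intro sum_mono Ci)
    finally have "(LBINT x. \<rho> x / s x) \<le> 3 * C / 2" by simp
    moreover have "(\<integral>\<^sup>+x. ennreal (\<rho> x / s x) \<partial>lborel) = ennreal (LBINT x. \<rho> x / s x)"
      using ints nonneg s0 by (intro nn_integral_eq_integral) (auto intro!: divide_nonneg_pos)
    ultimately show ?thesis unfolding s_def by (simp add: ennreal_leI)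
  qed
  have "(\<integral>\<^sup>+x. ennreal (\<rho> x / norm x) \<partial>lborel)
      \<le> (\<integral>\<^sup>+x. liminf (\<lambda>n. ennreal (\<rho> x / sqrt (x \<bullet> x + 1 / real (Suc n)))) \<partial>lborel)"
  proof (intro nn_integral_mono)
    fix x :: "real^3"
    show "ennreal (\<rho> x / norm x) \<le> liminf (\<lambda>n. ennreal (\<rho> x / sqrt (x \<bullet> x + 1 / real (Suc n))))"
    proof (cases "x = 0")
      case False
      have "(\<lambda>n. \<rho> x / sqrt (x \<bullet> x + 1 / real (Suc n))) \<longlonglongrightarrow> \<rho> x / sqrt (x \<bullet> x + 0)"
        using False by (intro tendsto_intros lim_1_over_n[THEN LIMSEQ_Suc]) auto
      then have "(\<lambda>n. ennreal (\<rho> x / sqrt (x \<bullet> x + 1 / real (Suc n)))) \<longlonglongrightarrow> ennreal (\<rho> x / norm x)"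
        by (intro tendsto_ennrealI) (simp add: norm_eq_sqrt_inner)
      then have "liminf (\<lambda>n. ennreal (\<rho> x / sqrt (x \<bullet> x + 1 / real (Suc n)))) = ennreal (\<rho> x / norm x)"
        by (intro lim_imp_Liminf) auto
      then show ?thesis by simp
    qed simp
  qed
  also have "\<dots> \<le> liminf (\<lambda>n. \<integral>\<^sup>+x. ennreal (\<rho> x / sqrt (x \<bullet> x + 1 / real (Suc n))) \<partial>lborel)"
    by (rule nn_integral_liminf) measurable
  also have "\<dots> \<le> limsup (\<lambda>n. \<integral>\<^sup>+x. ennreal (\<rho> x / sqrt (x \<bullet> x + 1 / real (Suc n))) \<partial>lborel)"
    by (rule Liminf_le_Limsup) auto
  also have "\<dots> \<le> ennreal (3 * C / 2)"
    by (rule Limsup_bounded) (auto intro!: always_eventually approx)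
  finally show ?thesis .
qed

lemma coulomb_potential_bound:
  fixes \<rho> :: "real^3 \<Rightarrow> real"
  assumes int: "integrable lborel \<rho>" and nonneg: "\<And>x. 0 \<le> \<rho> x"
    and lip: "\<And>h. (LBINT x. \<bar>\<rho> (x + h) - \<rho> x\<bar>) \<le> C * norm h"
  shows "(\<integral>\<^sup>+y. ennreal (\<rho> y / norm (x - y)) \<partial>lborel) \<le> ennreal (3 * C / 2)"
proof -
  have [measurable]: "\<rho> \<in> borel_measurable borel" using borel_measurable_integrable[OF int] by simp
  have "(\<integral>\<^sup>+y. ennreal (\<rho> y / norm (x - y)) \<partial>lborel) = (\<integral>\<^sup>+y. ennreal (\<rho> (y + x) / norm (x - (y + x))) \<partial>lborel)"
    by (rule nn_integral_shift[symmetric]) measurable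
  also have "\<dots> = (\<integral>\<^sup>+y. ennreal (\<rho> (y + x) / norm y) \<partial>lborel)" by simp
  also have "\<dots> \<le> ennreal (3 * C / 2)"
  proof (rule coulomb_potential_bound_origin)
    show "integrable lborel (\<lambda>y. \<rho> (y + x))" using int by (simp add: integrable_shift)
    show "(\<integral>y. \<bar>\<rho> (y + h + x) - \<rho> (y + x)\<bar> \<partial>lborel) \<le> C * norm h" for h
      using lip[of h] integral_shift[of "\<lambda>y. \<bar>\<rho> (y + h) - \<rho> y\<bar>" x] by (simp add: add_ac)
  qed (rule nonneg)
  finally show ?thesis .
qed

definition ball_integral :: "(real^3 \<Rightarrow> real) \<Rightarrow> real^3 \<Rightarrow> real \<Rightarrow> real" where
  "ball_integral f z r = (LBINT x. indicator (ball z r) x * f x)"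

definition ball_vol :: "real \<Rightarrow> real" where
  "ball_vol r = measure lborel (ball (0::real^3) r)"

lemma ball_vol_pos: "0 < r \<Longrightarrow> 0 < ball_vol r"
  unfolding ball_vol_def using content_ball_pos[of r "0::real^3"] by simp

lemma ball_integral_measurable:
  fixes f :: "real^3 \<Rightarrow> real"
  assumes [measurable]: "f \<in> borel_measurable borel"
  shows "(\<lambda>z. ball_integral f z r) \<in> borel_measurable borel"
proof -
  have "(\<lambda>z. LBINT x. indicator (ball z r) x * f x) \<in> borel_measurable lborel"
  proof (rule lborel.borel_measurable_lebesgue_integral)
    have "(\<lambda>p. indicator {p. dist (fst p) (snd p) < r} p * f (snd p)) \<in> borel_measurable (borel \<Otimes>\<^sub>M borel)"
      by measurable
    moreover have "(\<lambda>(z, x). indicator (ball z r) x * f x) = (\<lambda>p. indicator {p. dist (fst p) (snd p) < r} p * f (snd p))"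
      by (auto simp: indicator_def fun_eq_iff)
    ultimately show "(\<lambda>(z, x). indicator (ball z r) x * f x) \<in> borel_measurable (lborel \<Otimes>\<^sub>M lborel)" by simp
  qed
  then show ?thesis unfolding ball_integral_def by simp
qed

text \<open>
  The error of the average over a ball is an average of the translation errors \<open>f (z + y) - f z\<close>
  with \<open>\<bar>y\<bar> < r\<close>, each of which is at most \<open>C r\<close> in \<open>L\<^sup>1\<close>.
\<close>

lemma ball_integral_approximates:
  fixes f :: "real^3 \<Rightarrow> real"
  assumes int: "integrable lborel f" and r: "0 < r"
    and lip: "\<And>h. (LBINT x. \<bar>f (x + h) - f x\<bar>) \<le> C * norm h"
  shows "(\<integral>\<^sup>+z. ennreal \<bar>f z - ball_integral f z r / ball_vol r\<bar> \<partial>lborel) \<le> ennreal (C * r)"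
proof -
  have [measurable]: "f \<in> borel_measurable borel" using borel_measurable_integrable[OF int] by simp
  let ?B = "ball (0::real^3) r"
  have [measurable]: "?B \<in> sets borel" by simp
  define V where "V = ball_vol r"
  have V: "0 < V" unfolding V_def by (rule ball_vol_pos[OF r])
  have eV: "emeasure lborel ?B = ennreal V"
    unfolding V_def ball_vol_def
    by (intro emeasure_eq_ennreal_measure) (use emeasure_lborel_ball_finite[of 0 r] in \<open>auto simp: less_top\<close>)
  have C0: "0 \<le> C * norm h" for h :: "real^3"
    using order_trans[OF _ lip[of h]] by (simp add: Bochner_Integration.integral_nonneg)
  have pt: "ennreal \<bar>V * f z - ball_integral f z r\<bar> \<le> (\<integral>\<^sup>+y. indicator ?B y * ennreal \<bar>f (z + y) - f z\<bar> \<partial>lborel)" for z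
  proof -
    have "ball_integral f z r = (\<integral>y. indicator (ball z r) (y + z) * f (y + z) \<partial>lborel)"
      unfolding ball_integral_def by (rule integral_shift[symmetric]) (auto intro!: borel_measurable_times borel_measurable_indicator)
    also have "\<dots> = (\<integral>y. indicator ?B y * f (y + z) \<partial>lborel)"
      by (intro Bochner_Integration.integral_cong) (auto simp: indicator_def dist_norm)
    finally have b: "ball_integral f z r = (\<integral>y. indicator ?B y * f (y + z) \<partial>lborel)" .
    have i1: "integrable lborel (\<lambda>y. indicator ?B y * f (y + z))"
      using int integrable_shift[of f z] integrable_mult_indicator[of ?B lborel "\<lambda>y. f (y + z)"] by simp
    have i2: "integrable lborel (\<lambda>y. indicator ?B y * f z)"
      using emeasure_lborel_ball_finite[of 0 r] by (intro integrable_mult_left integrable_real_indicator) auto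
    have "V * f z = (\<integral>y. indicator ?B y * f z \<partial>lborel)"
      unfolding V_def ball_vol_def by simp
    then have "V * f z - ball_integral f z r = (\<integral>y. indicator ?B y * f z - indicator ?B y * f (y + z) \<partial>lborel)"
      unfolding b using i1 i2 by simp
    also have "ennreal \<bar>\<dots>\<bar> \<le> (\<integral>\<^sup>+y. ennreal \<bar>indicator ?B y * f z - indicator ?B y * f (y + z)\<bar> \<partial>lborel)"
      using integral_norm_bound_ennreal[OF Bochner_Integration.integrable_diff[OF i2 i1]] by simp
    also have "\<dots> = (\<integral>\<^sup>+y. indicator ?B y * ennreal \<bar>f (z + y) - f z\<bar> \<partial>lborel)"
      by (intro nn_integral_cong) (auto simp: indicator_def add.commute abs_minus_commute)
    finally show ?thesis .
  qed
  have "(\<integral>\<^sup>+z. ennreal \<bar>V * f z - ball_integral f z r\<bar> \<partial>lborel)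
      \<le> (\<integral>\<^sup>+z. \<integral>\<^sup>+y. indicator ?B y * ennreal \<bar>f (z + y) - f z\<bar> \<partial>lborel \<partial>lborel)"
    by (intro nn_integral_mono pt)
  also have "\<dots> = (\<integral>\<^sup>+y. \<integral>\<^sup>+z. indicator ?B y * ennreal \<bar>f (z + y) - f z\<bar> \<partial>lborel \<partial>lborel)"
    by (rule lborel_pair.Fubini') measurable
  also have "\<dots> = (\<integral>\<^sup>+y. indicator ?B y * (\<integral>\<^sup>+z. ennreal \<bar>f (z + y) - f z\<bar> \<partial>lborel) \<partial>lborel)"
    by (subst nn_integral_cmult) auto
  also have "\<dots> \<le> (\<integral>\<^sup>+y. ennreal (C * r) * indicator ?B y \<partial>lborel)"
  proof (intro nn_integral_mono)
    fix y :: "real^3"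
    show "indicator ?B y * (\<integral>\<^sup>+z. ennreal \<bar>f (z + y) - f z\<bar> \<partial>lborel) \<le> ennreal (C * r) * indicator ?B y"
    proof (cases "y \<in> ?B")
      case True
      have "integrable lborel (\<lambda>z. f (z + y) - f z)"
        using int integrable_shift[of f y] by auto
      then have "(\<integral>\<^sup>+z. ennreal \<bar>f (z + y) - f z\<bar> \<partial>lborel) = ennreal (\<integral>z. \<bar>f (z + y) - f z\<bar> \<partial>lborel)"
        by (intro nn_integral_eq_integral) auto
      also have "\<dots> \<le> ennreal (C * r)"
      proof (rule ennreal_leI, rule order_trans[OF lip])
        have "0 \<le> C" using C0[of "axis 1 1"] by (simp add: norm_axis_1)
        then show "C * norm y \<le> C * r" using True by (intro mult_left_mono) auto
      qed
      finally show ?thesis using True by simp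
    qed simp
  qed
  also have "\<dots> = ennreal (C * r) * ennreal V" by (subst nn_integral_cmult) (auto simp: eV)
  finally have main: "(\<integral>\<^sup>+z. ennreal \<bar>V * f z - ball_integral f z r\<bar> \<partial>lborel) \<le> ennreal (C * r) * ennreal V" .
  note [measurable] = ball_integral_measurable
  have "(\<integral>\<^sup>+z. ennreal \<bar>f z - ball_integral f z r / V\<bar> \<partial>lborel) = (\<integral>\<^sup>+z. ennreal (1 / V) * ennreal \<bar>V * f z - ball_integral f z r\<bar> \<partial>lborel)"
  proof (intro nn_integral_cong)
    fix z
    have "f z - ball_integral f z r / V = (1 / V) * (V * f z - ball_integral f z r)"
      using V by (simp add: field_simps)
    then have "\<bar>f z - ball_integral f z r / V\<bar> = (1 / V) * \<bar>V * f z - ball_integral f z r\<bar>"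
      using V by (metis abs_mult abs_of_pos zero_less_divide_1_iff)
    then show "ennreal \<bar>f z - ball_integral f z r / V\<bar> = ennreal (1 / V) * ennreal \<bar>V * f z - ball_integral f z r\<bar>"
      using V by (simp only: ennreal_mult abs_ge_zero zero_le_divide_1_iff less_imp_le)
  qed
  also have "\<dots> = ennreal (1 / V) * (\<integral>\<^sup>+z. ennreal \<bar>V * f z - ball_integral f z r\<bar> \<partial>lborel)"
    by (rule nn_integral_cmult) measurable
  also have "\<dots> \<le> ennreal (1 / V) * (ennreal (C * r) * ennreal V)"
    by (intro mult_left_mono main) auto
  also have "\<dots> = ennreal (C * r)"
  proof -
    have "0 \<le> C" using C0[of "axis 1 1"] by (simp add: norm_axis_1)
    then show ?thesis using V r by (simp add: ennreal_mult[symmetric])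
  qed
  finally show ?thesis unfolding V_def .
qed

lemma zero_if_ball_integrals_zero:
  fixes f :: "real^3 \<Rightarrow> real"
  assumes int: "integrable lborel f"
    and lip: "\<And>h. (LBINT x. \<bar>f (x + h) - f x\<bar>) \<le> C * norm h"
    and zero: "\<And>\<delta>. 0 < \<delta> \<Longrightarrow> \<exists>r. 0 < r \<and> r < \<delta> \<and> (AE z in lborel. ball_integral f z r = 0)"
  shows "AE x in lborel. f x = 0"
proof -
  have [measurable]: "f \<in> borel_measurable borel" using borel_measurable_integrable[OF int] by simp
  have le: "(\<integral>\<^sup>+z. ennreal \<bar>f z\<bar> \<partial>lborel) \<le> ennreal (\<bar>C\<bar> * \<delta>)" if \<delta>: "0 < \<delta>" for \<delta>
  proof -
    obtain r where r: "0 < r" "r < \<delta>" and z: "AE z in lborel. ball_integral f z r = 0" using zero[OF \<delta>] by blast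
    have "(\<integral>\<^sup>+z. ennreal \<bar>f z\<bar> \<partial>lborel) = (\<integral>\<^sup>+z. ennreal \<bar>f z - ball_integral f z r / ball_vol r\<bar> \<partial>lborel)"
      by (rule nn_integral_cong_AE) (use z in eventually_elim, simp)
    also have "\<dots> \<le> ennreal (C * r)" by (rule ball_integral_approximates[OF int r(1) lip])
    also have "\<dots> \<le> ennreal (\<bar>C\<bar> * \<delta>)" using r by (intro ennreal_leI mult_mono) auto
    finally show ?thesis .
  qed
  have "(\<integral>\<^sup>+z. ennreal \<bar>f z\<bar> \<partial>lborel) \<le> 0"
  proof (rule LIMSEQ_le_const)
    have "(\<lambda>n. \<bar>C\<bar> * (1 / real (Suc n))) \<longlonglongrightarrow> \<bar>C\<bar> * 0"
      by (intro tendsto_intros lim_1_over_n[THEN LIMSEQ_Suc])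
    then have "(\<lambda>n. ennreal (\<bar>C\<bar> * (1 / real (Suc n)))) \<longlonglongrightarrow> ennreal (\<bar>C\<bar> * 0)" by (rule tendsto_ennrealI)
    then show "(\<lambda>n. ennreal (\<bar>C\<bar> * (1 / real (Suc n)))) \<longlonglongrightarrow> 0" by simp
    show "\<exists>N. \<forall>n\<ge>N. (\<integral>\<^sup>+z. ennreal \<bar>f z\<bar> \<partial>lborel) \<le> ennreal (\<bar>C\<bar> * (1 / real (Suc n)))"
      by (intro exI allI impI le) simp
  qed
  then have "(\<integral>\<^sup>+z. ennreal \<bar>f z\<bar> \<partial>lborel) = 0" by simp
  then have "AE z in lborel. ennreal \<bar>f z\<bar> = 0" by (subst (asm) nn_integral_0_iff_AE) auto
  then show ?thesis by eventually_elim simp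
qed

text \<open>
  Along radii that shrink geometrically the \<open>L\<^sup>1\<close> errors are summable, so the sum of the pointwise errors is
  finite almost everywhere.
\<close>

lemma ball_averages_converge:
  fixes f :: "real^3 \<Rightarrow> real"
  assumes int: "integrable lborel f"
    and lip: "\<And>h. (LBINT x. \<bar>f (x + h) - f x\<bar>) \<le> C * norm h"
  shows "AE z in lborel. (\<lambda>n. ball_integral f z ((1/2)^n) / ball_vol ((1/2)^n)) \<longlonglongrightarrow> f z"
proof -
  have [measurable]: "f \<in> borel_measurable borel" using borel_measurable_integrable[OF int] by simp
  note [measurable] = ball_integral_measurable
  define d where "d n z = \<bar>f z - ball_integral f z ((1/2)^n) / ball_vol ((1/2)^n)\<bar>" for n z
  have [measurable]: "d n \<in> borel_measurable borel" for n unfolding d_def by measurable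
  have "(\<integral>\<^sup>+z. (\<Sum>n. ennreal (d n z)) \<partial>lborel) = (\<Sum>n. \<integral>\<^sup>+z. ennreal (d n z) \<partial>lborel)"
    by (rule nn_integral_suminf) measurable
  also have "\<dots> \<le> (\<Sum>n. ennreal (\<bar>C\<bar> * (1/2)^n))"
  proof (intro suminf_le summableI)
    fix n
    have "(\<integral>\<^sup>+z. ennreal (d n z) \<partial>lborel) \<le> ennreal (C * (1/2)^n)"
      unfolding d_def by (intro ball_integral_approximates int lip) simp
    also have "\<dots> \<le> ennreal (\<bar>C\<bar> * (1/2)^n)" by (intro ennreal_leI mult_right_mono) auto
    finally show "(\<integral>\<^sup>+z. ennreal (d n z) \<partial>lborel) \<le> ennreal (\<bar>C\<bar> * (1/2)^n)" .
  qed
  also have "\<dots> < \<infinity>" by (subst suminf_ennreal2) (auto intro!: summable_mult summable_geometric)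
  finally have "AE z in lborel. (\<Sum>n. ennreal (d n z)) \<noteq> \<infinity>"
    by (intro nn_integral_noteq_infinite) auto
  then show ?thesis
  proof eventually_elim
    case (elim z)
    have "summable (\<lambda>n. d n z)"
      by (rule summable_suminf_not_top) (use elim in \<open>auto simp: d_def\<close>)
    then have "(\<lambda>n. d n z) \<longlonglongrightarrow> 0" by (rule summable_LIMSEQ_zero)
    then have "(\<lambda>n. f z - ball_integral f z ((1/2)^n) / ball_vol ((1/2)^n)) \<longlonglongrightarrow> 0"
      unfolding d_def by (rule tendsto_rabs_zero_cancel)
    then have "(\<lambda>n. f z - (f z - ball_integral f z ((1/2)^n) / ball_vol ((1/2)^n))) \<longlonglongrightarrow> f z - 0"
      by (intro tendsto_diff tendsto_const)
    then show ?case by simp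
  qed
qed

section \<open>Strict convexity of the Coulomb energy\<close>

lemma orthogonal_measurable:
  fixes R :: "real^('n::{finite,wellorder}) \<Rightarrow> real^('n::{finite,wellorder})"
  assumes "orthogonal_transformation R"
  shows "R \<in> borel_measurable borel"
  by (intro borel_measurable_continuous_onI linear_continuous_on)
     (use assms orthogonal_transformation_linear linear_conv_bounded_linear in blast)

lemma lborel_distr_orthogonal:
  fixes R :: "real^('n::{finite,wellorder}) \<Rightarrow> real^('n::{finite,wellorder})"
  assumes R: "orthogonal_transformation R"
  shows "distr lborel borel R = lborel"
proof (rule lborel_eqI[symmetric])
  note [measurable] = orthogonal_measurable[OF R]
  fix l u :: "real^('n::{finite,wellorder})" assume lu: "\<And>b. b \<in> Basis \<Longrightarrow> l \<bullet> b \<le> u \<bullet> b"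
  have bij: "bij R" using R by (rule orthogonal_transformation_bij)
  have inv: "orthogonal_transformation (inv R)" using R by (rule orthogonal_transformation_inv)
  have pre: "R -` box l u = inv R ` box l u" using bij by (rule bij_vimage_eq_inv_image)
  have m: "R -` box l u \<in> sets borel"
    using measurable_sets[OF orthogonal_measurable[OF R], of "box l u"] by simp
  have "emeasure (distr lborel borel R) (box l u) = emeasure lborel (R -` box l u)"
    by (subst emeasure_distr) auto
  also have "\<dots> = emeasure lebesgue (R -` box l u)" using m by simp
  also have "\<dots> = ennreal (measure lebesgue (R -` box l u))"
    unfolding pre by (intro emeasure_eq_measure2 measurable_orthogonal_image[OF inv]) simp
  also have "measure lebesgue (R -` box l u) = measure lebesgue (box l u)"
    unfolding pre by (rule measure_orthogonal_image[OF inv]) simp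
  also have "ennreal (measure lebesgue (box l u)) = emeasure lebesgue (box l u)"
    by (rule emeasure_eq_measure2[symmetric]) simp
  also have "\<dots> = emeasure lborel (box l u)" by simp
  also have "\<dots> = (\<Prod>b\<in>Basis. (u - l) \<bullet> b)" using lu by (rule emeasure_lborel_box)
  finally show "emeasure (distr lborel borel R) (box l u) = (\<Prod>b\<in>Basis. (u - l) \<bullet> b)" .
qed simp

lemma nn_integral_orthogonal:
  fixes R :: "real^('n::{finite,wellorder}) \<Rightarrow> real^('n::{finite,wellorder})" and f :: "real^('n::{finite,wellorder}) \<Rightarrow> ennreal"
  assumes R: "orthogonal_transformation R" and [measurable]: "f \<in> borel_measurable borel"
  shows "(\<integral>\<^sup>+x. f (R x) \<partial>lborel) = (\<integral>\<^sup>+x. f x \<partial>lborel)"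
  by (subst (2) lborel_distr_orthogonal[OF R, symmetric])
     (simp add: nn_integral_distr orthogonal_measurable[OF R])

lemma integral_orthogonal:
  fixes R :: "real^('n::{finite,wellorder}) \<Rightarrow> real^('n::{finite,wellorder})" and f :: "real^('n::{finite,wellorder}) \<Rightarrow> real"
  assumes R: "orthogonal_transformation R" and [measurable]: "f \<in> borel_measurable borel"
  shows "(LBINT x. f (R x)) = (LBINT x. f x)"
  by (subst (2) lborel_distr_orthogonal[OF R, symmetric])
     (simp add: integral_distr orthogonal_measurable[OF R])

lemma integrable_orthogonal:
  fixes R :: "real^('n::{finite,wellorder}) \<Rightarrow> real^('n::{finite,wellorder})" and f :: "real^('n::{finite,wellorder}) \<Rightarrow> real"
  assumes R: "orthogonal_transformation R" and f: "f \<in> borel_measurable borel" and i: "integrable lborel f"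
  shows "integrable lborel (\<lambda>x. f (R x))"
  using i f orthogonal_measurable[OF R]
  by (subst (asm) lborel_distr_orthogonal[OF R, symmetric]) (simp add: integrable_distr_eq)

lemma nn_integral_similarity:
  fixes R :: "real^3 \<Rightarrow> real^3" and f :: "real^3 \<Rightarrow> ennreal"
  assumes R: "orthogonal_transformation R" and [measurable]: "f \<in> borel_measurable borel" and d: "0 < d"
  shows "(\<integral>\<^sup>+w. f w \<partial>lborel) = ennreal (d ^ 3) * (\<integral>\<^sup>+z. f (x + d *\<^sub>R R z) \<partial>lborel)"
proof -
  have "(\<integral>\<^sup>+w. f w \<partial>lborel) = ennreal (d ^ 3) * (\<integral>\<^sup>+z. f (x + d *\<^sub>R z) \<partial>lborel)"
    using d by (subst lborel_affine[of d x]) (simp_all add: nn_integral_density nn_integral_distr nn_integral_cmult)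
  also have "(\<integral>\<^sup>+z. f (x + d *\<^sub>R z) \<partial>lborel) = (\<integral>\<^sup>+z. f (x + d *\<^sub>R R z) \<partial>lborel)"
    by (rule nn_integral_orthogonal[OF R, symmetric]) measurable
  finally show ?thesis .
qed

text \<open>
  The exponent is forced by scaling: the volume of the intersection of two balls of radius \<open>r\<close> has dimension
  \<open>length\<^sup>3\<close>, and \<open>\<integral> length\<^sup>3 r\<^bsup>-5\<^esup> dr\<close> has the dimension of \<open>1 / length\<close>.
\<close>

definition scale_weight :: "real \<Rightarrow> ennreal" where
  "scale_weight r = ennreal (if 0 < r then 1 / r ^ 5 else 0)"

definition ball_overlap :: "real^3 \<Rightarrow> real^3 \<Rightarrow> ennreal" where
  "ball_overlap x y = (\<integral>\<^sup>+r. scale_weight r * emeasure lborel (ball x r \<inter> ball y r) \<partial>lborel)"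

lemma scale_weight_measurable [measurable]: "scale_weight \<in> borel_measurable borel"
  unfolding scale_weight_def[abs_def] by measurable

lemma pred_in_ball_measurable [measurable (raw)]:
  fixes f g :: "'a \<Rightarrow> real^3"
  assumes [measurable]: "f \<in> borel_measurable M" "g \<in> borel_measurable M" "h \<in> borel_measurable M"
  shows "Measurable.pred M (\<lambda>p. g p \<in> ball (f p) (h p))"
  unfolding mem_ball by measurable

lemma fst_borel_measurable [measurable]: "fst \<in> borel_measurable (borel :: (real \<times> (real^3)) measure)"
  and snd_borel_measurable [measurable]: "snd \<in> borel_measurable (borel :: (real \<times> (real^3)) measure)"
  by (intro borel_measurable_continuous_onI continuous_intros)+

lemma emeasure_ball_Int:
  "emeasure lborel (ball x r \<inter> ball y r) = (\<integral>\<^sup>+z. indicator (ball z r) x * indicator (ball z r) (y::real^3) \<partial>lborel)"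
proof -
  have "emeasure lborel (ball x r \<inter> ball y r) = (\<integral>\<^sup>+z. indicator (ball x r \<inter> ball y r) z \<partial>lborel)"
    by simp
  also have "\<dots> = (\<integral>\<^sup>+z. indicator (ball z r) x * indicator (ball z r) y \<partial>lborel)"
    by (intro nn_integral_cong) (auto simp: indicator_def dist_commute)
  finally show ?thesis .
qed

lemma emeasure_ball_Int_measurable [measurable]:
  "(\<lambda>r. emeasure lborel (ball x r \<inter> ball (y::real^3) r)) \<in> borel_measurable borel"
proof -
  have "(\<lambda>r. \<integral>\<^sup>+z. indicator (ball z r) x * indicator (ball z r) y \<partial>(lborel::(real^3) measure)) \<in> borel_measurable borel"
    by measurable
  then show ?thesis unfolding emeasure_ball_Int .
qed

text \<open>
  A similarity that maps \<open>0\<close> and a unit vector to \<open>x\<close> and \<open>y\<close> has ratio \<open>d = \<bar>x - y\<bar>\<close>. It scales the volumes by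
  \<open>d\<^sup>3\<close>, and substituting \<open>r = d s\<close> contributes \<open>d\<^bsup>-5\<^esup> d\<close>.
\<close>

lemma ball_overlap_scaling:
  assumes "x \<noteq> y"
  shows "ball_overlap x y = ennreal (1 / norm (x - y)) * ball_overlap 0 (axis 1 1)"
proof -
  define d where "d = norm (y - x)"
  have d: "0 < d" using assms by (simp add: d_def)
  let ?e = "axis 1 1 :: real^3"
  obtain R where R: "orthogonal_transformation R" and Re: "R ?e = (y - x) /\<^sub>R d"
    using orthogonal_transformation_exists[of ?e "(y - x) /\<^sub>R d"] d by (auto simp: d_def norm_axis_1)
  have lin: "linear R" using R by (rule orthogonal_transformation_linear)
  have dist_R: "dist (R a) (R b) = dist a b" for a b
    using R by (simp add: dist_norm orthogonal_transformation_norm linear_diff[OF lin, symmetric])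
  have y: "y = x + d *\<^sub>R R ?e" using d by (simp add: Re)
  have x: "x = x + d *\<^sub>R R 0" by (simp add: linear_0[OF lin])
  have meas: "emeasure lborel (ball x r \<inter> ball y r) = ennreal (d ^ 3) * emeasure lborel (ball 0 (r / d) \<inter> ball ?e (r / d))" for r
  proof -
    have D: "dist (x + d *\<^sub>R R a) (x + d *\<^sub>R R b) < r \<longleftrightarrow> dist a b < r / d" for a b
    proof -
      have "dist (x + d *\<^sub>R R a) (x + d *\<^sub>R R b) = d * dist (R a) (R b)"
        using d by (simp add: dist_norm scaleR_diff_right[symmetric])
      then show ?thesis using d by (simp add: dist_R field_simps)
    qed
    have "emeasure lborel (ball x r \<inter> ball y r) = (\<integral>\<^sup>+z. indicator (ball x r \<inter> ball y r) z \<partial>lborel)"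
      by simp
    also have "\<dots> = ennreal (d ^ 3) * (\<integral>\<^sup>+z. indicator (ball x r \<inter> ball y r) (x + d *\<^sub>R R z) \<partial>lborel)"
      by (rule nn_integral_similarity[OF R _ d]) (intro borel_measurable_indicator, simp)
    also have "(\<integral>\<^sup>+z. indicator (ball x r \<inter> ball y r) (x + d *\<^sub>R R z) \<partial>lborel)
        = (\<integral>\<^sup>+z. indicator (ball 0 (r / d) \<inter> ball ?e (r / d)) z \<partial>lborel)"
    proof (intro nn_integral_cong)
      fix z
      have "x + d *\<^sub>R R z \<in> ball x r \<longleftrightarrow> z \<in> ball 0 (r / d)" using D[of 0 z] x by simp
      moreover have "x + d *\<^sub>R R z \<in> ball y r \<longleftrightarrow> z \<in> ball ?e (r / d)" using D[of ?e z] y by simp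
      ultimately show "indicator (ball x r \<inter> ball y r) (x + d *\<^sub>R R z)
        = (indicator (ball 0 (r / d) \<inter> ball ?e (r / d)) z :: ennreal)"
        by (simp add: indicator_def)
    qed
    finally show ?thesis by simp
  qed
  have w: "scale_weight (d * s) = ennreal (1 / d ^ 5) * scale_weight s" for s
    unfolding scale_weight_def using d
    by (auto simp: ennreal_mult[symmetric] zero_less_mult_iff power_mult_distrib)
  have "ball_overlap x y = (\<integral>\<^sup>+r. scale_weight r * (ennreal (d ^ 3) * emeasure lborel (ball 0 (r / d) \<inter> ball ?e (r / d))) \<partial>lborel)"
    unfolding ball_overlap_def meas ..
  also have "\<dots> = ennreal \<bar>d\<bar> * (\<integral>\<^sup>+s. scale_weight (0 + d * s) * (ennreal (d ^ 3) * emeasure lborel (ball 0 ((0 + d * s) / d) \<inter> ball ?e ((0 + d * s) / d))) \<partial>lborel)"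
    by (rule nn_integral_real_affine) (measurable, use d in simp)
  also have "\<dots> = ennreal d * (\<integral>\<^sup>+s. ennreal (d ^ 3 / d ^ 5) * (scale_weight s * emeasure lborel (ball 0 s \<inter> ball ?e s)) \<partial>lborel)"
  proof -
    have "ennreal (1 / d ^ 5) * ennreal (d ^ 3) = ennreal (d ^ 3 / d ^ 5)"
      using d by (simp add: ennreal_mult[symmetric])
    then have "scale_weight (d * s) * (ennreal (d ^ 3) * X) = ennreal (d ^ 3 / d ^ 5) * (scale_weight s * X)" for s X
      unfolding w by (metis mult.assoc mult.commute)
    then show ?thesis using d by simp
  qed
  also have "\<dots> = ennreal d * (ennreal (d ^ 3 / d ^ 5) * ball_overlap 0 ?e)"
    unfolding ball_overlap_def by (subst nn_integral_cmult) auto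
  also have "\<dots> = ennreal (1 / norm (x - y)) * ball_overlap 0 ?e"
  proof -
    have "d * (d ^ 3 / d ^ 5) = 1 / d" using d by (simp add: field_simps eval_nat_numeral)
    then show ?thesis using d
      by (simp add: mult.assoc[symmetric] ennreal_mult[symmetric] d_def norm_minus_commute)
  qed
  finally show ?thesis .
qed

text \<open>
  Balls of radius less than \<open>1/2\<close> around points at distance \<open>1\<close> do not meet, which removes the singularity of
  the weight at \<open>0\<close>; at infinity the integrand is of order \<open>r\<^bsup>-2\<^esup>\<close>.
\<close>

lemma ball_overlap_unit_finite: "ball_overlap 0 (axis 1 1) < \<infinity>"
proof -
  let ?e = "axis 1 1 :: real^3"
  let ?v = "unit_ball_vol 3"
  have "ball_overlap 0 ?e \<le> (\<integral>\<^sup>+r. ennreal (?v * (1 / r\<^sup>2)) * indicator {1/2..} r \<partial>lborel)"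
    unfolding ball_overlap_def
  proof (intro nn_integral_mono)
    fix r :: real
    show "scale_weight r * emeasure lborel (ball 0 r \<inter> ball ?e r) \<le> ennreal (?v * (1 / r\<^sup>2)) * indicator {1/2..} r"
    proof (cases "r < 1/2")
      case True
      have "ball 0 r \<inter> ball ?e r = {}"
      proof -
        have False if "dist 0 z < r" "dist ?e z < r" for z
          using that True dist_triangle2[of 0 ?e z] by (simp add: dist_norm norm_axis_1)
        then show ?thesis by auto
      qed
      then show ?thesis by simp
    next
      case False
      have "emeasure lborel (ball 0 r \<inter> ball ?e r) \<le> emeasure lborel (ball (0::real^3) r)"
        by (intro emeasure_mono) auto
      also have "\<dots> = ennreal (?v * r ^ 3)" using False by (subst emeasure_ball) auto
      finally have "scale_weight r * emeasure lborel (ball 0 r \<inter> ball ?e r) \<le> ennreal (1 / r ^ 5) * ennreal (?v * r ^ 3)"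
        using False unfolding scale_weight_def by (intro mult_mono) auto
      also have "\<dots> = ennreal (?v * (1 / r\<^sup>2))"
        using False by (simp add: ennreal_mult[symmetric] field_simps eval_nat_numeral)
      finally show ?thesis using False by simp
    qed
  qed
  also have "\<dots> = ennreal (0 - (- ?v * (1 / (1/2))))"
  proof (rule nn_integral_FTC_atLeast)
    fix r :: real assume r: "1/2 \<le> r"
    show "((\<lambda>r. - ?v * (1 / r)) has_real_derivative ?v * (1 / r\<^sup>2)) (at r)"
      using r by (auto intro!: derivative_eq_intros simp: power2_eq_square)
    show "0 \<le> ?v * (1 / r\<^sup>2)" by simp
  next
    have "((\<lambda>r. - ?v * (1 / r)) \<longlongrightarrow> - ?v * 0) at_top"
      by (intro tendsto_intros tendsto_divide_0[OF tendsto_const] filterlim_at_top_imp_at_infinity filterlim_ident)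
    then show "((\<lambda>r. - ?v * (1 / r)) \<longlongrightarrow> 0) at_top" by simp
  qed measurable
  finally show ?thesis by (rule le_less_trans) simp
qed

text \<open>
  The Coulomb energy of a nonnegative density with values in \<open>[0, \<infinity>]\<close>, where integrals may be interchanged
  without integrability conditions.
\<close>

definition coulomb_nn :: "(real^3 \<Rightarrow> real) \<Rightarrow> ennreal" where
  "coulomb_nn \<rho> = (\<integral>\<^sup>+x. \<integral>\<^sup>+y. ennreal (\<rho> x * \<rho> y / norm (x - y)) \<partial>lborel \<partial>lborel)"

text \<open>
  The pair consists of the radius and the centre, in this order, so that the almost everywhere statements
  obtained below split into "for almost every radius, for almost every centre".
\<close>

definition ball_mass :: "(real^3 \<Rightarrow> real) \<Rightarrow> real \<times> (real^3) \<Rightarrow> ennreal" where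
  "ball_mass \<rho> p = (\<integral>\<^sup>+x. ennreal (\<rho> x) * indicator (ball (snd p) (fst p)) x \<partial>lborel)"

lemma ball_mass_measurable [measurable]:
  assumes [measurable]: "\<rho> \<in> borel_measurable borel"
  shows "ball_mass \<rho> \<in> borel_measurable borel"
  unfolding ball_mass_def[abs_def] by measurable

text \<open>
  The formula of Fefferman and de la Llave. The overlap of two balls around \<open>x\<close> and \<open>y\<close> counts the balls that
  contain both points, so \<open>1 / \<bar>x - y\<bar>\<close> is, up to a constant, an integral over all balls of
  \<open>1\<^sub>B(x) 1\<^sub>B(y)\<close>. Inserting this makes the Coulomb energy an integral of squares.
\<close>

lemma fefferman_de_la_llave:
  fixes \<rho> :: "real^3 \<Rightarrow> real"
  assumes [measurable]: "\<rho> \<in> borel_measurable borel" and nonneg: "\<And>x. 0 \<le> \<rho> x"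
  shows "ball_overlap 0 (axis 1 1) * coulomb_nn \<rho> = (\<integral>\<^sup>+p. scale_weight (fst p) * (ball_mass \<rho> p)\<^sup>2 \<partial>lborel)"
proof -
  define c where "c = ball_overlap 0 (axis 1 1)"
  let ?k = "\<lambda>x p. indicator (ball (snd p) (fst p :: real)) (x :: real^3) :: ennreal"
  have overlap: "ball_overlap x y = (\<integral>\<^sup>+p. scale_weight (fst p) * (?k x p * ?k y p) \<partial>lborel)" for x y
  proof -
    have "(\<integral>\<^sup>+p. scale_weight (fst p) * (?k x p * ?k y p) \<partial>lborel)
        = (\<integral>\<^sup>+p. scale_weight (fst p) * (?k x p * ?k y p) \<partial>(lborel \<Otimes>\<^sub>M lborel))"
      by (simp add: lborel_prod)
    also have "\<dots> = (\<integral>\<^sup>+r. \<integral>\<^sup>+z. scale_weight r * (?k x (r, z) * ?k y (r, z)) \<partial>lborel \<partial>lborel)"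
      by (subst lborel.nn_integral_fst[symmetric]) (auto simp: borel_prod)
    also have "\<dots> = (\<integral>\<^sup>+r. scale_weight r * emeasure lborel (ball x r \<inter> ball y r) \<partial>lborel)"
      by (intro nn_integral_cong) (simp add: emeasure_ball_Int nn_integral_cmult)
    finally show ?thesis unfolding ball_overlap_def by simp
  qed
  have "c * coulomb_nn \<rho> = (\<integral>\<^sup>+x. \<integral>\<^sup>+y. c * ennreal (\<rho> x * \<rho> y / norm (x - y)) \<partial>lborel \<partial>lborel)"
    unfolding coulomb_nn_def by (simp add: nn_integral_cmult)
  also have "\<dots> = (\<integral>\<^sup>+x. \<integral>\<^sup>+y. ennreal (\<rho> x) * ennreal (\<rho> y) * ball_overlap x y \<partial>lborel \<partial>lborel)"
  proof (rule nn_integral_cong, rule nn_integral_cong_AE)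
    fix x :: "real^3"
    have "AE y in lborel. y \<noteq> x" by (rule AE_lborel_singleton)
    then show "AE y in lborel. c * ennreal (\<rho> x * \<rho> y / norm (x - y)) = ennreal (\<rho> x) * ennreal (\<rho> y) * ball_overlap x y"
    proof eventually_elim
      case (elim y)
      have "ennreal (\<rho> x * \<rho> y / norm (x - y)) = ennreal (\<rho> x) * ennreal (\<rho> y) * ennreal (1 / norm (x - y))"
        using nonneg by (simp add: ennreal_mult[symmetric])
      then show ?case using elim ball_overlap_scaling[of x y] by (simp add: c_def mult_ac)
    qed
  qed
  also have "\<dots> = (\<integral>\<^sup>+x. \<integral>\<^sup>+y. \<integral>\<^sup>+p. scale_weight (fst p) * (ennreal (\<rho> x) * ?k x p) * (ennreal (\<rho> y) * ?k y p) \<partial>lborel \<partial>lborel \<partial>lborel)"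
    unfolding overlap by (subst nn_integral_cmult[symmetric]) (auto simp: mult_ac)
  also have "\<dots> = (\<integral>\<^sup>+x. \<integral>\<^sup>+p. \<integral>\<^sup>+y. scale_weight (fst p) * (ennreal (\<rho> x) * ?k x p) * (ennreal (\<rho> y) * ?k y p) \<partial>lborel \<partial>lborel \<partial>lborel)"
    by (intro nn_integral_cong lborel_pair.Fubini') measurable
  also have "\<dots> = (\<integral>\<^sup>+x. \<integral>\<^sup>+p. scale_weight (fst p) * (ennreal (\<rho> x) * ?k x p) * ball_mass \<rho> p \<partial>lborel \<partial>lborel)"
    unfolding ball_mass_def by (intro nn_integral_cong nn_integral_cmult) measurable
  also have "\<dots> = (\<integral>\<^sup>+p. \<integral>\<^sup>+x. scale_weight (fst p) * (ennreal (\<rho> x) * ?k x p) * ball_mass \<rho> p \<partial>lborel \<partial>lborel)"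
    by (rule lborel_pair.Fubini') measurable
  also have "\<dots> = (\<integral>\<^sup>+p. scale_weight (fst p) * (ball_mass \<rho> p)\<^sup>2 \<partial>lborel)"
  proof (intro nn_integral_cong)
    fix p
    have "(\<integral>\<^sup>+x. scale_weight (fst p) * (ennreal (\<rho> x) * ?k x p) * ball_mass \<rho> p \<partial>lborel)
        = (\<integral>\<^sup>+x. (scale_weight (fst p) * ball_mass \<rho> p) * (ennreal (\<rho> x) * ?k x p) \<partial>lborel)"
      by (simp add: mult_ac)
    also have "\<dots> = (scale_weight (fst p) * ball_mass \<rho> p) * ball_mass \<rho> p"
      unfolding ball_mass_def by (rule nn_integral_cmult) measurable
    finally show "(\<integral>\<^sup>+x. scale_weight (fst p) * (ennreal (\<rho> x) * ?k x p) * ball_mass \<rho> p \<partial>lborel)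
        = scale_weight (fst p) * (ball_mass \<rho> p)\<^sup>2" by (simp add: power2_eq_square mult_ac)
  qed
  finally show ?thesis unfolding c_def .
qed

lemma ball_mass_eq_ball_integral:
  fixes \<rho> :: "real^3 \<Rightarrow> real"
  assumes int: "integrable lborel \<rho>" and nonneg: "\<And>x. 0 \<le> \<rho> x"
  shows "ball_mass \<rho> p = ennreal (ball_integral \<rho> (snd p) (fst p))"
proof -
  have i: "integrable lborel (\<lambda>x. indicator (ball (snd p) (fst p)) x * \<rho> x)"
    using integrable_mult_indicator[OF _ int, of "ball (snd p) (fst p)"] by simp
  have "ball_mass \<rho> p = (\<integral>\<^sup>+x. ennreal (indicator (ball (snd p) (fst p)) x * \<rho> x) \<partial>lborel)"
    unfolding ball_mass_def by (intro nn_integral_cong) (auto simp: indicator_def)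
  also have "\<dots> = ennreal (ball_integral \<rho> (snd p) (fst p))"
    unfolding ball_integral_def using i nonneg by (intro nn_integral_eq_integral) auto
  finally show ?thesis .
qed

lemma ball_integral_lin:
  assumes "integrable lborel f" "integrable lborel g"
  shows "ball_integral (\<lambda>x. a * f x + b * g x) z r = a * ball_integral f z r + b * ball_integral g z r"
proof -
  have i: "integrable lborel (\<lambda>x. indicator (ball z r) x * h x)" if "integrable lborel h" for h :: "real^3 \<Rightarrow> real"
    using integrable_mult_indicator[OF _ that, of "ball z r"] by simp
  have "ball_integral (\<lambda>x. a * f x + b * g x) z r
      = (LBINT x. a * (indicator (ball z r) x * f x) + b * (indicator (ball z r) x * g x))"
    unfolding ball_integral_def by (simp add: algebra_simps)
  also have "\<dots> = a * ball_integral f z r + b * ball_integral g z r"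
    unfolding ball_integral_def using i[OF assms(1)] i[OF assms(2)] by simp
  finally show ?thesis .
qed

text \<open>
  By the previous formula the energy is a weighted \<open>L\<^sup>2\<close> norm of the ball masses \<open>a\<close> and \<open>b\<close>, and
  \<open>((a + b)/2)\<^sup>2 + ((a - b)/2)\<^sup>2 = a\<^sup>2/2 + b\<^sup>2/2\<close>. If the midpoint has no less energy than the endpoints, the
  integral of the squared differences vanishes.
\<close>

lemma coulomb_strict_convexity:
  fixes f g :: "real^3 \<Rightarrow> real"
  assumes f: "integrable lborel f" "\<And>x. 0 \<le> f x" and g: "integrable lborel g" "\<And>x. 0 \<le> g x"
    and eq: "coulomb_nn f = coulomb_nn g" and fin: "coulomb_nn f < \<infinity>"
    and ge: "coulomb_nn f \<le> coulomb_nn (\<lambda>x. (f x + g x) / 2)"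
  shows "AE p in lborel. 0 < fst p \<longrightarrow> ball_integral f (snd p) (fst p) = ball_integral g (snd p) (fst p)"
proof -
  have [measurable]: "f \<in> borel_measurable borel" "g \<in> borel_measurable borel"
    using borel_measurable_integrable[OF f(1)] borel_measurable_integrable[OF g(1)] by auto
  define c where "c = ball_overlap 0 (axis 1 1)"
  define a where "a p = ball_integral f (snd p) (fst p)" for p
  define b where "b p = ball_integral g (snd p) (fst p)" for p
  have ab0: "0 \<le> a p" "0 \<le> b p" for p
    unfolding a_def b_def ball_integral_def using f(2) g(2) by (auto intro!: Bochner_Integration.integral_nonneg)
  have mf: "ball_mass f p = ennreal (a p)" and mg: "ball_mass g p = ennreal (b p)" for p
    unfolding a_def b_def by (rule ball_mass_eq_ball_integral; fact)+
  have mh: "ball_mass (\<lambda>x. (f x + g x) / 2) p = ennreal ((a p + b p) / 2)" for p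
  proof -
    have h: "integrable lborel (\<lambda>x. (f x + g x) / 2)" "0 \<le> (f x + g x) / 2" for x
      using f g by auto
    have "(\<lambda>x. (f x + g x) / 2) = (\<lambda>x. (1/2) * f x + (1/2) * g x)" by (auto simp: field_simps)
    then show ?thesis using ball_mass_eq_ball_integral[OF h, of p] ball_integral_lin[OF f(1) g(1), of "1/2" "1/2"]
      by (simp add: a_def b_def add_divide_distrib)
  qed
  have "(\<lambda>p. enn2real (ball_mass f p)) \<in> borel_measurable borel" "(\<lambda>p. enn2real (ball_mass g p)) \<in> borel_measurable borel"
    by measurable
  then have [measurable]: "a \<in> borel_measurable borel" "b \<in> borel_measurable borel"
    using ab0 by (auto simp: mf mg)
  define w where "w p = scale_weight (fst p :: real)" for p :: "real \<times> (real^3)"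
  have [measurable]: "w \<in> borel_measurable borel" unfolding w_def[abs_def] by measurable
  have cf: "c * coulomb_nn f = (\<integral>\<^sup>+p. w p * ennreal ((a p)\<^sup>2) \<partial>lborel)"
    unfolding c_def w_def fefferman_de_la_llave[OF \<open>f \<in> borel_measurable borel\<close> f(2)] mf using ab0 by (simp add: ennreal_power)
  have cg: "c * coulomb_nn g = (\<integral>\<^sup>+p. w p * ennreal ((b p)\<^sup>2) \<partial>lborel)"
    unfolding c_def w_def fefferman_de_la_llave[OF \<open>g \<in> borel_measurable borel\<close> g(2)] mg using ab0 by (simp add: ennreal_power)
  have ch: "c * coulomb_nn (\<lambda>x. (f x + g x) / 2) = (\<integral>\<^sup>+p. w p * ennreal (((a p + b p) / 2)\<^sup>2) \<partial>lborel)"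
  proof -
    have "c * coulomb_nn (\<lambda>x. (f x + g x) / 2) = (\<integral>\<^sup>+p. w p * (ball_mass (\<lambda>x. (f x + g x) / 2) p)\<^sup>2 \<partial>lborel)"
      unfolding c_def w_def by (rule fefferman_de_la_llave) (use f(2) g(2) in auto)
    then show ?thesis unfolding mh using ab0 by (simp add: ennreal_power)
  qed
  \<comment> \<open>the deficit in the midpoint convexity of the energy\<close>
  define Df where "Df = (\<integral>\<^sup>+p. w p * ennreal (((a p - b p) / 2)\<^sup>2) \<partial>lborel)"
  have "c * coulomb_nn (\<lambda>x. (f x + g x) / 2) + Df
      = (\<integral>\<^sup>+p. w p * ennreal (((a p + b p) / 2)\<^sup>2) + w p * ennreal (((a p - b p) / 2)\<^sup>2) \<partial>lborel)"
    unfolding ch Df_def by (rule nn_integral_add[symmetric]) measurable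
  also have "\<dots> = (\<integral>\<^sup>+p. ennreal (1/2) * (w p * ennreal ((a p)\<^sup>2)) + ennreal (1/2) * (w p * ennreal ((b p)\<^sup>2)) \<partial>lborel)"
  proof (intro nn_integral_cong)
    fix p
    have "((a p + b p) / 2)\<^sup>2 + ((a p - b p) / 2)\<^sup>2 = (1/2) * (a p)\<^sup>2 + (1/2) * (b p)\<^sup>2"
      by (simp add: power2_eq_square field_simps)
    then have "ennreal (((a p + b p) / 2)\<^sup>2) + ennreal (((a p - b p) / 2)\<^sup>2)
        = ennreal (1/2) * ennreal ((a p)\<^sup>2) + ennreal (1/2) * ennreal ((b p)\<^sup>2)"
      by (simp only: ennreal_plus[symmetric] ennreal_mult[symmetric] zero_le_power2 mult_nonneg_nonneg
          zero_le_divide_1_iff zero_le_numeral)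
    then have "w p * (ennreal (((a p + b p) / 2)\<^sup>2) + ennreal (((a p - b p) / 2)\<^sup>2))
        = w p * (ennreal (1/2) * ennreal ((a p)\<^sup>2) + ennreal (1/2) * ennreal ((b p)\<^sup>2))" by (simp only:)
    then show "w p * ennreal (((a p + b p) / 2)\<^sup>2) + w p * ennreal (((a p - b p) / 2)\<^sup>2)
        = ennreal (1/2) * (w p * ennreal ((a p)\<^sup>2)) + ennreal (1/2) * (w p * ennreal ((b p)\<^sup>2))"
      by (simp only: distrib_left mult.left_commute)
  qed
  also have "\<dots> = ennreal (1/2) * (c * coulomb_nn f) + ennreal (1/2) * (c * coulomb_nn g)"
    unfolding cf cg by (simp add: nn_integral_add nn_integral_cmult)
  also have "\<dots> = c * coulomb_nn f"
  proof -
    have "ennreal (1/2) + ennreal (1/2) = 1" by (subst ennreal_plus[symmetric]) auto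
    then have "ennreal (1/2) * x + ennreal (1/2) * x = x" for x :: ennreal
      by (simp only: distrib_right[symmetric] mult_1)
    then show ?thesis using eq by simp
  qed
  finally have sum: "c * coulomb_nn (\<lambda>x. (f x + g x) / 2) + Df = c * coulomb_nn f" .
  have cfin: "c * coulomb_nn f < \<infinity>"
    using fin ball_overlap_unit_finite unfolding c_def by (simp add: ennreal_mult_less_top)
  have "c * coulomb_nn f + Df \<le> c * coulomb_nn f + 0"
    using add_right_mono[OF mult_left_mono[OF ge, of c], of Df] sum by simp
  then have "Df \<le> 0" using cfin by (subst (asm) ennreal_add_left_cancel_le) auto
  then have "Df = 0" by simp
  then have "AE p in lborel. w p * ennreal (((a p - b p) / 2)\<^sup>2) = 0"
    unfolding Df_def by (subst (asm) nn_integral_0_iff_AE) auto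
  then show ?thesis
  proof eventually_elim
    case (elim p)
    show ?case
    proof
      assume "0 < fst p"
      then have "w p \<noteq> 0" by (simp add: w_def scale_weight_def ennreal_eq_0_iff not_le)
      then have "ennreal (((a p - b p) / 2)\<^sup>2) = 0" using elim by simp
      then have "a p = b p" by (simp add: ennreal_eq_0_iff)
      then show "ball_integral f (snd p) (fst p) = ball_integral g (snd p) (fst p)" by (simp add: a_def b_def)
    qed
  qed
qed

section \<open>Radial symmetry of minimizers\<close>

lemma coulomb_energy_eq:
  fixes F \<rho> :: "real^3 \<Rightarrow> real"
  assumes F: "F \<in> borel_measurable lebesgue" and [measurable]: "\<rho> \<in> borel_measurable borel"
    and ae: "AE x in lebesgue. F x = \<rho> x" and nonneg: "\<And>x. 0 \<le> \<rho> x"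
    and fin: "\<And>x. (\<integral>\<^sup>+y. ennreal (\<rho> y / norm (x - y)) \<partial>lborel) < \<infinity>"
  shows "coulomb_energy F = enn2real (coulomb_nn \<rho>)"
proof -
  define p where "p x = (\<integral>y. \<rho> y / norm (x - y) \<partial>lborel)" for x
  have int: "integrable lborel (\<lambda>y. \<rho> y / norm (x - y))" for x
    using fin[of x] nonneg by (intro integrableI_nonneg) auto
  have p: "ennreal (p x) = (\<integral>\<^sup>+y. ennreal (\<rho> y / norm (x - y)) \<partial>lborel)" for x
    unfolding p_def using int[of x] nonneg by (intro nn_integral_eq_integral[symmetric]) auto
  have p0: "0 \<le> p x" for x unfolding p_def using nonneg by (intro Bochner_Integration.integral_nonneg) auto
  have "(\<lambda>x. \<integral>y. \<rho> y / norm (x - y) \<partial>lborel) \<in> borel_measurable lborel"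
    by (rule lborel.borel_measurable_lebesgue_integral) measurable
  then have pm [measurable]: "p \<in> borel_measurable borel" unfolding p_def[abs_def] by simp
  have pl: "p \<in> borel_measurable lebesgue" by (rule measurable_completion) simp
  have inner: "(LINT y|lebesgue. F x * F y / norm (x - y)) = F x * p x" for x
  proof -
    have nm: "(\<lambda>y. norm (x - y)) \<in> borel_measurable lebesgue" by (rule measurable_completion) simp
    have "(LINT y|lebesgue. F x * F y / norm (x - y)) = (\<integral>y. F x * \<rho> y / norm (x - y) \<partial>lborel)"
    proof (rule integral_lebesgue_representative)
      show "(\<lambda>y. F x * F y / norm (x - y)) \<in> borel_measurable lebesgue" using F nm by simp
      show "AE y in lebesgue. F x * F y / norm (x - y) = F x * \<rho> y / norm (x - y)"
        using ae by eventually_elim simp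
    qed measurable
    also have "\<dots> = F x * p x" unfolding p_def by (simp flip: times_divide_eq_right)
    finally show ?thesis .
  qed
  have "coulomb_energy F = (LINT x|lebesgue. F x * p x)" unfolding coulomb_energy_def inner ..
  also have "\<dots> = (LBINT x. \<rho> x * p x)"
  proof (rule integral_lebesgue_representative)
    show "(\<lambda>x. F x * p x) \<in> borel_measurable lebesgue" using F pl by simp
    show "AE x in lebesgue. F x * p x = \<rho> x * p x" using ae by eventually_elim simp
  qed measurable
  also have "\<dots> = enn2real (\<integral>\<^sup>+x. ennreal (\<rho> x * p x) \<partial>lborel)"
    using nonneg p0 by (intro integral_eq_nn_integral) auto
  also have "(\<integral>\<^sup>+x. ennreal (\<rho> x * p x) \<partial>lborel) = coulomb_nn \<rho>"
    unfolding coulomb_nn_def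
  proof (rule nn_integral_cong)
    fix x
    have "ennreal (\<rho> x * p x) = ennreal (\<rho> x) * (\<integral>\<^sup>+y. ennreal (\<rho> y / norm (x - y)) \<partial>lborel)"
      using nonneg p0 by (simp add: ennreal_mult p)
    also have "\<dots> = (\<integral>\<^sup>+y. ennreal (\<rho> x * \<rho> y / norm (x - y)) \<partial>lborel)"
      using nonneg by (subst nn_integral_cmult[symmetric]) (auto simp: ennreal_mult[symmetric])
    finally show "ennreal (\<rho> x * p x) = (\<integral>\<^sup>+y. ennreal (\<rho> x * \<rho> y / norm (x - y)) \<partial>lborel)" .
  qed
  finally show ?thesis .
qed

text \<open>
  Finiteness of the potentials is what excludes the default value of a divergent integral in
  \<open>coulomb_energy\<close>.
\<close>

lemma action_eq:
  fixes w :: "real^3 \<Rightarrow> real"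
  assumes w: "w \<in> sq_integrable lborel"
    and U: "U \<in> borel_measurable lebesgue" "AE x in lebesgue. U x = complex_of_real (w x)"
    and fin: "\<And>x. (\<integral>\<^sup>+y. ennreal ((w y)\<^sup>2 / norm (x - y)) \<partial>lborel) < \<infinity>"
  shows "action \<omega> U = 1/2 * (L2_norm (weak_gradient U))\<^sup>2 + 1/4 * enn2real (coulomb_nn (\<lambda>x. (w x)\<^sup>2))
     - 1/2 * (LBINT x. (w x)\<^sup>2 / norm x) + \<omega>/2 * (LBINT x. (w x)\<^sup>2)"
proof -
  have wm [measurable]: "w \<in> borel_measurable borel" using sq_integrableD(1)[OF w] by simp
  have ae: "AE x in lebesgue. (cmod (U x))\<^sup>2 = (w x)\<^sup>2" using U(2) by eventually_elim simp
  have Um: "(\<lambda>x. (cmod (U x))\<^sup>2) \<in> borel_measurable lebesgue" using U(1) by measurable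
  have nm: "(\<lambda>x::real^3. norm x) \<in> borel_measurable lebesgue" by (rule measurable_completion) simp
  have "coulomb_energy (\<lambda>x. (cmod (U x))\<^sup>2) = enn2real (coulomb_nn (\<lambda>x. (w x)\<^sup>2))"
    by (rule coulomb_energy_eq[OF Um _ ae _ fin]) auto
  moreover have "(LINT x|lebesgue. (cmod (U x))\<^sup>2 / norm x) = (LBINT x. (w x)\<^sup>2 / norm x)"
  proof (rule integral_lebesgue_representative)
    show "(\<lambda>x. (cmod (U x))\<^sup>2 / norm x) \<in> borel_measurable lebesgue" using Um nm by (rule borel_measurable_divide)
    show "AE x in lebesgue. (cmod (U x))\<^sup>2 / norm x = (w x)\<^sup>2 / norm x" using ae by eventually_elim simp
  qed measurable
  moreover have "(L2_norm U)\<^sup>2 = (LBINT x. (w x)\<^sup>2)"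
    unfolding L2_norm_def using integral_lebesgue_representative[OF Um _ ae] by simp
  ultimately show ?thesis unfolding action_def by simp
qed

text \<open>
  The reverse triangle inequality in the plane for the vectors \<open>(a, b)\<close> and \<open>(c, d)\<close>, divided by \<open>sqrt 2\<close>.
\<close>

lemma rms_diff_le:
  fixes a b c d :: real
  shows "(sqrt ((a\<^sup>2 + b\<^sup>2) / 2) - sqrt ((c\<^sup>2 + d\<^sup>2) / 2))\<^sup>2 \<le> (1/2) * (a - c)\<^sup>2 + (1/2) * (b - d)\<^sup>2"
proof -
  define p q where "p = sqrt ((a\<^sup>2 + b\<^sup>2) / 2)" and "q = sqrt ((c\<^sup>2 + d\<^sup>2) / 2)"
  have p: "0 \<le> p" "p\<^sup>2 = (a\<^sup>2 + b\<^sup>2) / 2" and q: "0 \<le> q" "q\<^sup>2 = (c\<^sup>2 + d\<^sup>2) / 2" unfolding p_def q_def by simp_all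
  have "((a * c + b * d) / 2)\<^sup>2 \<le> (p * q)\<^sup>2"
  proof -
    have "(p * q)\<^sup>2 - ((a * c + b * d) / 2)\<^sup>2 = ((a * d - b * c) / 2)\<^sup>2"
    proof -
      have "(p * q)\<^sup>2 = ((a\<^sup>2 + b\<^sup>2) / 2) * ((c\<^sup>2 + d\<^sup>2) / 2)" by (simp only: power_mult_distrib p q)
      then show ?thesis by (simp add: power2_eq_square algebra_simps)
    qed
    then show ?thesis by (metis diff_ge_0_iff_ge zero_le_power2)
  qed
  then have "(a * c + b * d) / 2 \<le> p * q" by (rule power2_le_imp_le[OF _ mult_nonneg_nonneg[OF p(1) q(1)]])
  moreover have "(p - q)\<^sup>2 = (a\<^sup>2 + b\<^sup>2) / 2 + (c\<^sup>2 + d\<^sup>2) / 2 - 2 * (p * q)"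
    by (simp add: power2_diff p q)
  moreover have "(1/2) * (a - c)\<^sup>2 + (1/2) * (b - d)\<^sup>2 = (a\<^sup>2 + b\<^sup>2) / 2 + (c\<^sup>2 + d\<^sup>2) / 2 - 2 * ((a * c + b * d) / 2)"
    by (simp add: power2_eq_square field_simps)
  ultimately show ?thesis unfolding p_def q_def by argo
qed

lemma sum_sq_orthogonal_frame:
  fixes R :: "real^3 \<Rightarrow> real^3"
  assumes R: "orthogonal_transformation R"
  shows "(\<Sum>i\<in>UNIV. (R (axis i 1) \<bullet> G)\<^sup>2) = (norm G)\<^sup>2"
proof -
  obtain y where y: "G = R y" using orthogonal_transformation_surj[OF R] by (meson surjE)
  have "R (axis i 1) \<bullet> G = y $ i" for i
    using R unfolding y orthogonal_transformation_def by (simp add: inner_axis' )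
  moreover have "norm G = norm y" using R unfolding y by (rule orthogonal_transformation_norm)
  ultimately show ?thesis by (simp add: power2_norm_vec)
qed

lemma sq_integrable_orthogonal:
  fixes R :: "real^3 \<Rightarrow> real^3"
  assumes R: "orthogonal_transformation R" and f: "f \<in> sq_integrable lborel"
  shows "(\<lambda>x. f (R x)) \<in> sq_integrable lborel"
proof (rule sq_integrableI)
  have [measurable]: "f \<in> borel_measurable borel" using sq_integrableD(1)[OF f] by simp
  note [measurable] = orthogonal_measurable[OF R]
  show "(\<lambda>x. f (R x)) \<in> borel_measurable lborel" by measurable
  show "integrable lborel (\<lambda>x. (f (R x))\<^sup>2)"
    by (rule integrable_orthogonal[OF R, of "\<lambda>x. (f x)\<^sup>2"]) (use sq_integrableD[OF f] in auto)
qed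

text \<open>
  Convexity of the kinetic energy as a function of the density. By \<open>rms_diff_le\<close> each difference of \<open>v\<close> is
  dominated by the root mean square of those of \<open>w\<close> and \<open>w \<circ> R\<close>, and in the direction of the
  \<open>i\<close>-th axis the differences of \<open>w \<circ> R\<close> are those of \<open>w\<close> in the direction of the \<open>i\<close>-th vector of a rotated
  frame. Translation bounds determine weak derivatives and their norms, which replaces a chain rule for \<open>v\<close>;
  summing over the frame gives back the full gradient.
\<close>

lemma rms_H1:
  fixes w :: "real^3 \<Rightarrow> real" and R :: "real^3 \<Rightarrow> real^3"
  assumes R: "orthogonal_transformation R" and w: "w \<in> sq_integrable lborel"
    and g: "\<And>i. g i \<in> sq_integrable lborel" "\<And>i. weak_dir_deriv (axis i 1) w (g i)"
  defines "v \<equiv> \<lambda>x. sqrt (((w x)\<^sup>2 + (w (R x))\<^sup>2) / 2)"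
  shows "v \<in> sq_integrable lborel" and "(\<lambda>x. complex_of_real (v x)) \<in> H1"
    and "(L2_norm (weak_gradient (\<lambda>x. complex_of_real (v x))))\<^sup>2 \<le> (\<Sum>i\<in>UNIV. LBINT x. (g i x)\<^sup>2)"
proof -
  have lin: "linear R" using R by (rule orthogonal_transformation_linear)
  note wR = sq_integrable_orthogonal[OF R w]
  have [measurable]: "w \<in> borel_measurable borel" "R \<in> borel_measurable borel" "g i \<in> borel_measurable borel" for i
    using sq_integrableD(1)[OF w] orthogonal_measurable[OF R] sq_integrableD(1)[OF g(1)] by auto
  have v2: "(v x)\<^sup>2 = (1/2) * (w x)\<^sup>2 + (1/2) * (w (R x))\<^sup>2" for x
    unfolding v_def by (simp add: field_simps)
  have vm [measurable]: "v \<in> borel_measurable borel" unfolding v_def by measurable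
  show v: "v \<in> sq_integrable lborel"
    using sq_integrableD(2)[OF w] sq_integrableD(2)[OF wR] by (intro sq_integrableI) (auto simp: v2)
  define G where "G e x = (\<Sum>j\<in>UNIV. e $ j * g j x)" for e :: "real^3" and x
  have GL: "G e \<in> sq_integrable lborel" for e
    unfolding G_def[abs_def] by (intro sq_integrable_sum sq_integrable_cmult g) auto
  have Gt: "G (t *\<^sub>R e) x = t * G e x" for t e x
    by (simp add: G_def sum_distrib_left mult.assoc)
  have wt: "(LBINT x. (w (x + t *\<^sub>R e) - w x)\<^sup>2) \<le> t\<^sup>2 * (LBINT x. (G e x)\<^sup>2)" for t e
  proof -
    have "weak_dir_deriv (t *\<^sub>R e) w (G (t *\<^sub>R e))"
      unfolding G_def[abs_def] by (rule weak_dir_deriv_sum[OF w g])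
    from translation_bound_of_weak_deriv[OF w GL this] show ?thesis
      by (simp add: Gt power_mult_distrib)
  qed
  define B where "B i = sqrt ((1/2) * (LBINT x. (G (axis i 1) x)\<^sup>2) + (1/2) * (LBINT x. (G (R (axis i 1)) x)\<^sup>2))" for i
  have B: "0 \<le> B i" "(B i)\<^sup>2 = (1/2) * (LBINT x. (G (axis i 1) x)\<^sup>2) + (1/2) * (LBINT x. (G (R (axis i 1)) x)\<^sup>2)" for i
    unfolding B_def by (simp_all add: add_nonneg_nonneg)
  have vt: "(LBINT x. (v (x + t *\<^sub>R axis i 1) - v x)\<^sup>2) \<le> t\<^sup>2 * (B i)\<^sup>2" for t i
  proof -
    let ?h = "t *\<^sub>R axis i 1 :: real^3"
    have Rh: "R (x + ?h) = R x + t *\<^sub>R R (axis i 1)" for x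
      by (simp add: linear_add[OF lin] linear_scale[OF lin])
    have d1: "(\<lambda>x. w (x + ?h) - w x) \<in> sq_integrable lborel"
      by (intro sq_integrable_diff sq_integrable_shift w)
    have d2': "(\<lambda>x. w (x + t *\<^sub>R R (axis i 1)) - w x) \<in> sq_integrable lborel"
      by (intro sq_integrable_diff sq_integrable_shift w)
    note d2 = sq_integrable_orthogonal[OF R d2']
    have "(LBINT x. (v (x + ?h) - v x)\<^sup>2)
      \<le> (LBINT x. (1/2) * (w (x + ?h) - w x)\<^sup>2 + (1/2) * (w (R x + t *\<^sub>R R (axis i 1)) - w (R x))\<^sup>2)"
    proof (rule integral_mono)
      show "integrable lborel (\<lambda>x. (v (x + ?h) - v x)\<^sup>2)"
        by (intro sq_integrableD(2) sq_integrable_diff sq_integrable_shift v)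
      show "(v (x + ?h) - v x)\<^sup>2 \<le> (1/2) * (w (x + ?h) - w x)\<^sup>2 + (1/2) * (w (R x + t *\<^sub>R R (axis i 1)) - w (R x))\<^sup>2" for x
        unfolding v_def Rh by (rule rms_diff_le)
    qed (use sq_integrableD(2)[OF d1] sq_integrableD(2)[OF d2] in auto)
    also have "\<dots> = (1/2) * (LBINT x. (w (x + ?h) - w x)\<^sup>2)
        + (1/2) * (LBINT x. (w (R x + t *\<^sub>R R (axis i 1)) - w (R x))\<^sup>2)"
      using sq_integrableD(2)[OF d1] sq_integrableD(2)[OF d2] by simp
    also have "(LBINT x. (w (R x + t *\<^sub>R R (axis i 1)) - w (R x))\<^sup>2) = (LBINT x. (w (x + t *\<^sub>R R (axis i 1)) - w x)\<^sup>2)"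
      by (rule integral_orthogonal[OF R, of "\<lambda>x. (w (x + t *\<^sub>R R (axis i 1)) - w x)\<^sup>2"]) measurable
    also have "(1/2) * (LBINT x. (w (x + ?h) - w x)\<^sup>2) + (1/2) * (LBINT x. (w (x + t *\<^sub>R R (axis i 1)) - w x)\<^sup>2)
      \<le> (1/2) * (t\<^sup>2 * (LBINT x. (G (axis i 1) x)\<^sup>2)) + (1/2) * (t\<^sup>2 * (LBINT x. (G (R (axis i 1)) x)\<^sup>2))"
      by (intro add_mono mult_left_mono wt) auto
    also have "\<dots> = t\<^sup>2 * (B i)\<^sup>2" unfolding B by (simp add: algebra_simps)
    finally show ?thesis .
  qed
  have "\<exists>h. h \<in> sq_integrable lborel \<and> (LBINT x. (h x)\<^sup>2) \<le> (B i)\<^sup>2 \<and> weak_dir_deriv (axis i 1) v h" for i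
    using weak_deriv_of_translation_bound[OF v B(1) vt] by blast
  then have "\<forall>i. \<exists>h. h \<in> sq_integrable lborel \<and> (LBINT x. (h x)\<^sup>2) \<le> (B i)\<^sup>2 \<and> weak_dir_deriv (axis i 1) v h"
    by blast
  from choice[OF this] obtain h where h: "\<And>i. h i \<in> sq_integrable lborel"
    "\<And>i. (LBINT x. (h i x)\<^sup>2) \<le> (B i)\<^sup>2" "\<And>i. weak_dir_deriv (axis i 1) v (h i)" by blast
  show "(\<lambda>x. complex_of_real (v x)) \<in> H1" by (rule of_real_H1(1)[OF v h(1,3)])
  have gi: "integrable lborel (\<lambda>x. (g i x)\<^sup>2)" for i by (rule sq_integrableD(2)[OF g(1)])
  have frame: "(\<Sum>i\<in>UNIV. LBINT x. (G (Q (axis i 1)) x)\<^sup>2) = (\<Sum>i\<in>UNIV. LBINT x. (g i x)\<^sup>2)"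
    if Q: "orthogonal_transformation Q" for Q :: "real^3 \<Rightarrow> real^3"
  proof -
    have "(\<Sum>i\<in>UNIV. LBINT x. (G (Q (axis i 1)) x)\<^sup>2) = (LBINT x. (\<Sum>i\<in>UNIV. (G (Q (axis i 1)) x)\<^sup>2))"
      using sq_integrableD(2)[OF GL] by (intro Bochner_Integration.integral_sum[symmetric]) auto
    also have "\<dots> = (LBINT x. (\<Sum>i\<in>UNIV. (g i x)\<^sup>2))"
    proof (rule Bochner_Integration.integral_cong[OF refl])
      fix x
      have "G e x = e \<bullet> (\<chi> j. g j x)" for e by (simp add: G_def inner_vec_def)
      then show "(\<Sum>i\<in>UNIV. (G (Q (axis i 1)) x)\<^sup>2) = (\<Sum>i\<in>UNIV. (g i x)\<^sup>2)"
        using sum_sq_orthogonal_frame[OF Q, of "\<chi> j. g j x"] by (simp add: power2_norm_vec)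
    qed
    also have "\<dots> = (\<Sum>i\<in>UNIV. LBINT x. (g i x)\<^sup>2)"
      using gi by (intro Bochner_Integration.integral_sum) auto
    finally show ?thesis .
  qed
  have "(L2_norm (weak_gradient (\<lambda>x. complex_of_real (v x))))\<^sup>2 = (\<Sum>i\<in>UNIV. LBINT x. (h i x)\<^sup>2)"
    by (rule of_real_H1(2)[OF v h(1,3)])
  also have "\<dots> \<le> (\<Sum>i\<in>UNIV. (B i)\<^sup>2)" by (intro sum_mono h)
  also have "\<dots> = (1/2) * (\<Sum>i\<in>UNIV. LBINT x. (G (axis i 1) x)\<^sup>2) + (1/2) * (\<Sum>i\<in>UNIV. LBINT x. (G (R (axis i 1)) x)\<^sup>2)"
    unfolding B sum.distrib sum_distrib_left ..
  also have "\<dots> = (\<Sum>i\<in>UNIV. LBINT x. (g i x)\<^sup>2)"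
    using frame[OF R] frame[OF orthogonal_transformation_id] by simp
  finally show "(L2_norm (weak_gradient (\<lambda>x. complex_of_real (v x))))\<^sup>2 \<le> (\<Sum>i\<in>UNIV. LBINT x. (g i x)\<^sup>2)" .
qed

lemma coulomb_nn_orthogonal:
  fixes R :: "real^3 \<Rightarrow> real^3"
  assumes R: "orthogonal_transformation R" and [measurable]: "\<rho> \<in> borel_measurable borel"
  shows "coulomb_nn (\<lambda>x. \<rho> (R x)) = coulomb_nn \<rho>"
proof -
  have lin: "linear R" using R by (rule orthogonal_transformation_linear)
  have n: "norm (x - y) = norm (R x - R y)" for x y
    using orthogonal_transformation_norm[OF R, of "x - y"] by (simp add: linear_diff[OF lin])
  have "coulomb_nn (\<lambda>x. \<rho> (R x)) = (\<integral>\<^sup>+x. \<integral>\<^sup>+y. ennreal (\<rho> (R x) * \<rho> (R y) / norm (R x - R y)) \<partial>lborel \<partial>lborel)"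
    unfolding coulomb_nn_def by (subst n) (rule refl)
  also have "\<dots> = (\<integral>\<^sup>+x. \<integral>\<^sup>+y. ennreal (\<rho> (R x) * \<rho> y / norm (R x - y)) \<partial>lborel \<partial>lborel)"
    by (intro nn_integral_cong nn_integral_orthogonal[OF R]) measurable
  also have "\<dots> = coulomb_nn \<rho>"
    unfolding coulomb_nn_def
    by (rule nn_integral_orthogonal[OF R, of "\<lambda>x. \<integral>\<^sup>+y. ennreal (\<rho> x * \<rho> y / norm (x - y)) \<partial>lborel"]) measurable
  finally show ?thesis .
qed

lemma coulomb_nn_finite:
  fixes \<rho> :: "real^3 \<Rightarrow> real"
  assumes int: "integrable lborel \<rho>" and nonneg: "\<And>x. 0 \<le> \<rho> x"
    and lip: "\<And>h. (LBINT x. \<bar>\<rho> (x + h) - \<rho> x\<bar>) \<le> C * norm h"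
  shows "coulomb_nn \<rho> < \<infinity>"
proof -
  have [measurable]: "\<rho> \<in> borel_measurable borel" using borel_measurable_integrable[OF int] by simp
  have "coulomb_nn \<rho> = (\<integral>\<^sup>+x. ennreal (\<rho> x) * (\<integral>\<^sup>+y. ennreal (\<rho> y / norm (x - y)) \<partial>lborel) \<partial>lborel)"
    unfolding coulomb_nn_def using nonneg
    by (subst nn_integral_cmult[symmetric]) (auto simp: ennreal_mult[symmetric])
  also have "\<dots> \<le> (\<integral>\<^sup>+x. ennreal (\<rho> x) * ennreal (3 * C / 2) \<partial>lborel)"
    by (intro nn_integral_mono mult_left_mono coulomb_potential_bound int nonneg lip) simp
  also have "\<dots> = (\<integral>\<^sup>+x. ennreal (\<rho> x) \<partial>lborel) * ennreal (3 * C / 2)"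
    by (rule nn_integral_multc) measurable
  also have "\<dots> < \<infinity>"
    using int nonneg by (simp add: nn_integral_eq_integral ennreal_mult_less_top)
  finally show ?thesis .
qed

lemma lipschitz_orthogonal:
  fixes R :: "real^3 \<Rightarrow> real^3"
  assumes R: "orthogonal_transformation R" and [measurable]: "\<rho> \<in> borel_measurable borel"
    and lip: "\<And>h. (LBINT x. \<bar>\<rho> (x + h) - \<rho> x\<bar>) \<le> C * norm h"
  shows "(LBINT x. \<bar>\<rho> (R (x + h)) - \<rho> (R x)\<bar>) \<le> C * norm h"
proof -
  have "(LBINT x. \<bar>\<rho> (R (x + h)) - \<rho> (R x)\<bar>) = (LBINT x. \<bar>\<rho> (R x + R h) - \<rho> (R x)\<bar>)"
    by (simp add: linear_add[OF orthogonal_transformation_linear[OF R]])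
  also have "\<dots> = (LBINT x. \<bar>\<rho> (x + R h) - \<rho> x\<bar>)"
    by (rule integral_orthogonal[OF R, of "\<lambda>x. \<bar>\<rho> (x + R h) - \<rho> x\<bar>"]) measurable
  also have "\<dots> \<le> C * norm h" using lip[of "R h"] by (simp add: orthogonal_transformation_norm[OF R])
  finally show ?thesis .
qed

text \<open>
  The function \<open>v\<close> competes with \<open>w\<close>. It has the same mass and the same attraction to the nucleus, since these
  are linear in the density and invariant under \<open>R\<close>, and no more kinetic energy. So minimality forces its
  Coulomb energy to be at least that of \<open>w\<close>, and strict convexity makes the two densities agree on almost
  every ball; small balls then identify them pointwise.
\<close>

lemma minimizer_density_invariant:
  fixes w :: "real^3 \<Rightarrow> real" and R :: "real^3 \<Rightarrow> real^3"
  assumes R: "orthogonal_transformation R"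
    and min: "\<And>U. U \<in> H1 \<Longrightarrow> action \<omega> u \<le> action \<omega> U"
    and u: "u \<in> L2" "AE x in lebesgue. u x = complex_of_real (w x)"
    and w: "w \<in> sq_integrable lborel"
    and g: "\<And>i. g i \<in> sq_integrable lborel" "\<And>i. weak_dir_deriv (axis i 1) w (g i)"
    and K: "(L2_norm (weak_gradient u))\<^sup>2 = (\<Sum>i\<in>UNIV. LBINT x. (g i x)\<^sup>2)"
    and lip: "\<And>h. (LBINT x. \<bar>(w (x + h))\<^sup>2 - (w x)\<^sup>2\<bar>) \<le> C * norm h"
  shows "AE x in lborel. (w x)\<^sup>2 = (w (R x))\<^sup>2"
proof -
  define \<rho> where "\<rho> x = (w x)\<^sup>2" for x
  define \<sigma> where "\<sigma> x = \<rho> (R x)" for x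
  define v where "v = (\<lambda>x. sqrt (((w x)\<^sup>2 + (w (R x))\<^sup>2) / 2))"
  have lin: "linear R" using R by (rule orthogonal_transformation_linear)
  note [measurable] = orthogonal_measurable[OF R]
  have [measurable]: "\<rho> \<in> borel_measurable borel" "\<sigma> \<in> borel_measurable borel"
    using sq_integrableD(1)[OF w] unfolding \<rho>_def[abs_def] \<sigma>_def[abs_def] by auto
  have \<rho>: "integrable lborel \<rho>" "\<And>x. 0 \<le> \<rho> x"
    and lip\<rho>: "\<And>h. (LBINT x. \<bar>\<rho> (x + h) - \<rho> x\<bar>) \<le> C * norm h"
    using sq_integrableD(2)[OF w] lip by (auto simp: \<rho>_def[abs_def])
  have \<sigma>: "integrable lborel \<sigma>" "\<And>x. 0 \<le> \<sigma> x"
    using integrable_orthogonal[OF R _ \<rho>(1)] \<rho>(2) unfolding \<sigma>_def[abs_def] by auto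
  have lip\<sigma>: "\<And>h. (LBINT x. \<bar>\<sigma> (x + h) - \<sigma> x\<bar>) \<le> C * norm h"
    unfolding \<sigma>_def by (rule lipschitz_orthogonal[OF R _ lip\<rho>]) measurable
  have v: "v \<in> sq_integrable lborel" "(\<lambda>x. complex_of_real (v x)) \<in> H1"
    and Kv: "(L2_norm (weak_gradient (\<lambda>x. complex_of_real (v x))))\<^sup>2 \<le> (L2_norm (weak_gradient u))\<^sup>2"
    using rms_H1[OF R w g] unfolding v_def K by auto
  have v2: "(v x)\<^sup>2 = (\<rho> x + \<sigma> x) / 2" for x unfolding v_def \<rho>_def \<sigma>_def by simp
  have fin\<rho>: "(\<integral>\<^sup>+y. ennreal (\<rho> y / norm (x - y)) \<partial>lborel) < \<infinity>" for x
    using coulomb_potential_bound[OF \<rho> lip\<rho>, of x] by (rule le_less_trans) simp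
  have fin\<sigma>: "(\<integral>\<^sup>+y. ennreal (\<sigma> y / norm (x - y)) \<partial>lborel) < \<infinity>" for x
    using coulomb_potential_bound[OF \<sigma> lip\<sigma>, of x] by (rule le_less_trans) simp
  have finv: "(\<integral>\<^sup>+y. ennreal ((v y)\<^sup>2 / norm (x - y)) \<partial>lborel) < \<infinity>" for x
  proof -
    have "(\<integral>\<^sup>+y. ennreal ((v y)\<^sup>2 / norm (x - y)) \<partial>lborel)
        \<le> (\<integral>\<^sup>+y. ennreal (\<rho> y / norm (x - y)) + ennreal (\<sigma> y / norm (x - y)) \<partial>lborel)"
    proof (intro nn_integral_mono)
      fix y
      have "(\<rho> y + \<sigma> y) / 2 / norm (x - y) \<le> (\<rho> y + \<sigma> y) / norm (x - y)"
        using \<rho>(2)[of y] \<sigma>(2)[of y] by (intro divide_right_mono) auto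
      then have "(v y)\<^sup>2 / norm (x - y) \<le> \<rho> y / norm (x - y) + \<sigma> y / norm (x - y)"
        unfolding v2 add_divide_distrib[of "\<rho> y" "\<sigma> y" "norm (x - y)", symmetric] .
      then have "ennreal ((v y)\<^sup>2 / norm (x - y)) \<le> ennreal (\<rho> y / norm (x - y) + \<sigma> y / norm (x - y))"
        by (rule ennreal_leI)
      then show "ennreal ((v y)\<^sup>2 / norm (x - y)) \<le> ennreal (\<rho> y / norm (x - y)) + ennreal (\<sigma> y / norm (x - y))"
        using \<rho>(2)[of y] \<sigma>(2)[of y] by (simp add: ennreal_plus)
    qed
    also have "\<dots> = (\<integral>\<^sup>+y. ennreal (\<rho> y / norm (x - y)) \<partial>lborel) + (\<integral>\<^sup>+y. ennreal (\<sigma> y / norm (x - y)) \<partial>lborel)"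
      by (rule nn_integral_add) measurable
    also have "\<dots> < \<infinity>" using fin\<rho>[of x] fin\<sigma>[of x] by simp
    finally show ?thesis .
  qed
  have au: "action \<omega> u = 1/2 * (L2_norm (weak_gradient u))\<^sup>2 + 1/4 * enn2real (coulomb_nn \<rho>)
     - 1/2 * (LBINT x. \<rho> x / norm x) + \<omega>/2 * (LBINT x. \<rho> x)"
    unfolding \<rho>_def by (rule action_eq[OF w L2D(1)[OF u(1)] u(2)]) (use fin\<rho> in \<open>simp add: \<rho>_def\<close>)
  have vl: "(\<lambda>x. complex_of_real (v x)) \<in> borel_measurable lebesgue"
    using L2D(1)[OF of_real_L2[OF v(1)]] .
  have av: "action \<omega> (\<lambda>x. complex_of_real (v x)) = 1/2 * (L2_norm (weak_gradient (\<lambda>x. complex_of_real (v x))))\<^sup>2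
     + 1/4 * enn2real (coulomb_nn (\<lambda>x. (v x)\<^sup>2)) - 1/2 * (LBINT x. (v x)\<^sup>2 / norm x) + \<omega>/2 * (LBINT x. (v x)\<^sup>2)"
    by (rule action_eq[OF v(1) vl _ finv]) simp
  have mass: "(LBINT x. (v x)\<^sup>2) = (LBINT x. \<rho> x)"
  proof -
    have "(LBINT x. \<sigma> x) = (LBINT x. \<rho> x)"
      unfolding \<sigma>_def by (rule integral_orthogonal[OF R]) measurable
    then show ?thesis unfolding v2 using \<rho>(1) \<sigma>(1) by simp
  qed
  have pot: "(LBINT x. (v x)\<^sup>2 / norm x) = (LBINT x. \<rho> x / norm x)"
  proof -
    have i: "integrable lborel (\<lambda>x. \<rho> x / norm x)" "integrable lborel (\<lambda>x. \<sigma> x / norm x)"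
      using fin\<rho>[of 0] fin\<sigma>[of 0] \<rho>(2) \<sigma>(2) by (auto intro!: integrableI_nonneg)
    have "(LBINT x. \<sigma> x / norm x) = (LBINT x. \<rho> (R x) / norm (R x))"
      by (simp add: \<sigma>_def orthogonal_transformation_norm[OF R])
    also have "\<dots> = (LBINT x. \<rho> x / norm x)"
      by (rule integral_orthogonal[OF R, of "\<lambda>x. \<rho> x / norm x"]) measurable
    finally have e: "(LBINT x. \<sigma> x / norm x) = (LBINT x. \<rho> x / norm x)" .
    have "(LBINT x. (v x)\<^sup>2 / norm x) = (LBINT x. (1/2) * (\<rho> x / norm x) + (1/2) * (\<sigma> x / norm x))"
      unfolding v2 by (intro Bochner_Integration.integral_cong) (auto simp: add_divide_distrib)
    also have "\<dots> = (1/2) * (LBINT x. \<rho> x / norm x) + (1/2) * (LBINT x. \<sigma> x / norm x)"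
      by (simp only: Bochner_Integration.integral_add[OF integrable_mult_right[OF i(1)] integrable_mult_right[OF i(2)]]
          integral_mult_right_zero)
    finally show ?thesis using e by simp
  qed
  have Q: "coulomb_nn \<rho> < \<infinity>" by (rule coulomb_nn_finite[OF \<rho> lip\<rho>])
  have "enn2real (coulomb_nn \<rho>) \<le> enn2real (coulomb_nn (\<lambda>x. (v x)\<^sup>2))"
    using min[OF v(2)] Kv unfolding au av mass pot by argo
  then have "coulomb_nn \<rho> \<le> coulomb_nn (\<lambda>x. (v x)\<^sup>2)"
    using Q by (metis ennreal_enn2real ennreal_leI enn2real_eq_0_iff infinity_ennreal_def less_top order_refl top_greatest linear)
  then have ge: "coulomb_nn \<rho> \<le> coulomb_nn (\<lambda>x. (\<rho> x + \<sigma> x) / 2)" unfolding v2 .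
  have eq: "coulomb_nn \<rho> = coulomb_nn \<sigma>"
    unfolding \<sigma>_def[abs_def] by (rule coulomb_nn_orthogonal[OF R, symmetric]) measurable
  have "AE p in (lborel :: (real \<times> (real^3)) measure). 0 < fst p \<longrightarrow> ball_integral \<rho> (snd p) (fst p) = ball_integral \<sigma> (snd p) (fst p)"
    by (rule coulomb_strict_convexity[OF \<rho> \<sigma> eq Q ge])
  then have "AE p in (lborel :: real measure) \<Otimes>\<^sub>M (lborel :: (real^3) measure). 0 < fst p \<longrightarrow> ball_integral \<rho> (snd p) (fst p) = ball_integral \<sigma> (snd p) (fst p)"
    unfolding lborel_prod .
  then have rz: "AE r in lborel. AE z in lborel. 0 < r \<longrightarrow> ball_integral \<rho> z r = ball_integral \<sigma> z r"
    using lborel_pair.AE_pair by fastforce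
  have "AE x in lborel. \<rho> x - \<sigma> x = 0"
  proof (rule zero_if_ball_integrals_zero)
    show "integrable lborel (\<lambda>x. \<rho> x - \<sigma> x)" using \<rho>(1) \<sigma>(1) by simp
    show "(LBINT x. \<bar>\<rho> (x + h) - \<sigma> (x + h) - (\<rho> x - \<sigma> x)\<bar>) \<le> (2 * C) * norm h" for h
    proof -
      have i: "integrable lborel (\<lambda>x. \<rho> (x + h) - \<rho> x)" "integrable lborel (\<lambda>x. \<sigma> (x + h) - \<sigma> x)"
        using \<rho>(1) \<sigma>(1) integrable_shift[of \<rho> h] integrable_shift[of \<sigma> h] by auto
      have "(LBINT x. \<bar>\<rho> (x + h) - \<sigma> (x + h) - (\<rho> x - \<sigma> x)\<bar>)
        \<le> (LBINT x. \<bar>\<rho> (x + h) - \<rho> x\<bar> + \<bar>\<sigma> (x + h) - \<sigma> x\<bar>)"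
      proof (rule integral_mono)
        have "(\<lambda>x. \<rho> (x + h) - \<sigma> (x + h) - (\<rho> x - \<sigma> x)) = (\<lambda>x. (\<rho> (x + h) - \<rho> x) - (\<sigma> (x + h) - \<sigma> x))"
          by (auto simp: algebra_simps)
        then show "integrable lborel (\<lambda>x. \<bar>\<rho> (x + h) - \<sigma> (x + h) - (\<rho> x - \<sigma> x)\<bar>)"
          using Bochner_Integration.integrable_diff[OF i] by simp
      qed (use i in auto)
      also have "\<dots> \<le> C * norm h + C * norm h"
        using i lip\<rho>[of h] lip\<sigma>[of h] by (subst Bochner_Integration.integral_add) auto
      finally show ?thesis by simp
    qed
    fix \<delta> :: real assume \<delta>: "0 < \<delta>"
    \<comment> \<open>almost every radius is good, and an interval of radii is not a null set\<close>
    have "\<exists>r. 0 < r \<and> r < \<delta> \<and> (AE z in lborel. 0 < r \<longrightarrow> ball_integral \<rho> z r = ball_integral \<sigma> z r)"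
    proof (rule ccontr)
      assume n: "\<not> ?thesis"
      have "AE r in lborel. r \<notin> {0<..<\<delta>}"
        using rz by eventually_elim (use n in auto)
      then have "{0<..<\<delta>} \<in> null_sets lborel" by (subst AE_iff_null_sets) auto
      then show False using \<delta> by (simp add: null_sets_def)
    qed
    then obtain r where r: "0 < r" "r < \<delta>" "AE z in lborel. ball_integral \<rho> z r = ball_integral \<sigma> z r" by auto
    have "AE z in lborel. ball_integral (\<lambda>x. \<rho> x - \<sigma> x) z r = 0"
      using r(3)
    proof eventually_elim
      case (elim z)
      then show ?case using ball_integral_lin[OF \<rho>(1) \<sigma>(1), of 1 "-1" z r] by simp
    qed
    then show "\<exists>r. 0 < r \<and> r < \<delta> \<and> (AE z in lborel. ball_integral (\<lambda>x. \<rho> x - \<sigma> x) z r = 0)"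
      using r by blast
  qed
  then show ?thesis unfolding \<rho>_def \<sigma>_def by eventually_elim simp
qed

text \<open>
  The density equals its rotated copy only up to a null set that depends on the rotation. Averages over balls
  do not see null sets, so they are radial exactly.
\<close>

lemma ball_integral_radial:
  fixes \<rho> :: "real^3 \<Rightarrow> real"
  assumes [measurable]: "\<rho> \<in> borel_measurable borel"
    and inv: "\<And>R. orthogonal_transformation R \<Longrightarrow> AE x in lborel. \<rho> x = \<rho> (R x)"
    and n: "norm z = norm z'"
  shows "ball_integral \<rho> z r = ball_integral \<rho> z' r"
proof -
  obtain R where R: "orthogonal_transformation R" and z': "R z = z'"
    using orthogonal_transformation_exists[OF n] by blast
  note [measurable] = orthogonal_measurable[OF R]
  have lin: "linear R" using R by (rule orthogonal_transformation_linear)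
  have iff: "R x \<in> ball (R z) r \<longleftrightarrow> x \<in> ball z r" for x
    using orthogonal_transformation_norm[OF R, of "z - x"] by (simp add: dist_norm linear_diff[OF lin])
  have bm [measurable]: "ball c r \<in> sets borel" for c :: "real^3" by simp
  have "ball_integral \<rho> z' r = (LBINT x. indicator (ball z' r) (R x) * \<rho> (R x))"
    unfolding ball_integral_def by (rule integral_orthogonal[OF R, symmetric]) measurable
  also have "\<dots> = (LBINT x. indicator (ball z r) x * \<rho> (R x))"
    using iff by (simp add: z'[symmetric] indicator_def)
  also have "\<dots> = (LBINT x. indicator (ball z r) x * \<rho> x)"
    by (rule integral_cong_AE) (measurable, use inv[OF R] in eventually_elim, simp)
  finally show ?thesis unfolding ball_integral_def by simp
qed

theorem theorem3:
  fixes \<omega> S_min :: real and u :: "real^3 \<Rightarrow> complex"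
  assumes "1/16 < \<omega>" and "\<omega> < 1/4"
    and "is_action_min \<omega> S_min"
    and "u \<in> H1"
    and "positive_fun u"
    and "action \<omega> u = S_min"
  shows "radially_symmetric u"
proof -
  have min: "action \<omega> u \<le> action \<omega> U" if "U \<in> H1" for U
    using assms(3,6) that unfolding is_action_min_def by simp
  have u2: "u \<in> L2" using assms(4) unfolding H1_def by simp
  have "(\<lambda>x. cmod (u x)) \<in> borel_measurable lebesgue" using L2D(1)[OF u2] by measurable
  then obtain f where f: "f \<in> sq_integrable lborel" "AE x in lebesgue. cmod (u x) = f x"
    using lebesgue_sq_integrable_representative[of "\<lambda>x. cmod (u x)"] L2D(2)[OF u2] by blast
  define w where "w x = \<bar>f x\<bar>" for x
  have w: "w \<in> sq_integrable lborel" unfolding w_def[abs_def]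
    by (rule sq_integrable_bound[OF f(1)]) (use sq_integrableD(1)[OF f(1)] in \<open>auto intro: borel_measurable_abs\<close>)
  have uw: "AE x in lebesgue. u x = complex_of_real (w x)"
    using f(2) assms(5)[unfolded positive_fun_def]
  proof eventually_elim
    case (elim x)
    then have "u x = complex_of_real (Re (u x))" "0 < Re (u x)" by (auto simp: complex_is_Real_iff complex_eq_iff)
    then have "cmod (u x) = Re (u x)" by (metis norm_of_real abs_of_pos)
    then show ?case using elim \<open>u x = complex_of_real (Re (u x))\<close> by (simp add: w_def)
  qed
  obtain g where g: "\<And>i. g i \<in> sq_integrable lborel" "\<And>i. weak_dir_deriv (axis i 1) w (g i)"
    and K: "(L2_norm (weak_gradient u))\<^sup>2 = (\<Sum>i\<in>UNIV. LBINT x. (g i x)\<^sup>2)"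
    using weak_gradient_components[OF u2 weak_gradient_exists[OF assms(4)] w uw] by blast
  define B where "B = sqrt (\<Sum>i\<in>UNIV. LBINT x. (g i x)\<^sup>2)"
  have B: "0 \<le> B" "B\<^sup>2 = (\<Sum>i\<in>UNIV. LBINT x. (g i x)\<^sup>2)" unfolding B_def by (auto simp: sum_nonneg)
  have wt: "(LBINT x. (w (x + h) - w x)\<^sup>2) \<le> B\<^sup>2 * (norm h)\<^sup>2" for h
  proof -
    have GL: "(\<lambda>x. \<Sum>i\<in>UNIV. h $ i * g i x) \<in> sq_integrable lborel"
      by (intro sq_integrable_sum sq_integrable_cmult g) auto
    have "(LBINT x. (w (x + h) - w x)\<^sup>2) \<le> (LBINT x. (\<Sum>i\<in>UNIV. h $ i * g i x)\<^sup>2)"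
      by (rule translation_bound_of_weak_deriv[OF w GL weak_dir_deriv_sum[OF w g]])
    also have "\<dots> \<le> (LBINT x. (norm h)\<^sup>2 * (\<Sum>i\<in>UNIV. (g i x)\<^sup>2))"
    proof (rule integral_mono)
      show "(\<Sum>i\<in>UNIV. h $ i * g i x)\<^sup>2 \<le> (norm h)\<^sup>2 * (\<Sum>i\<in>UNIV. (g i x)\<^sup>2)" for x
        using Cauchy_Schwarz_ineq_sum[of "\<lambda>i. h $ i" "\<lambda>i. g i x" UNIV] by (simp add: power2_norm_vec)
    qed (use sq_integrableD(2)[OF GL] sq_integrableD(2)[OF g(1)] in auto)
    also have "\<dots> = B\<^sup>2 * (norm h)\<^sup>2"
      unfolding B using sq_integrableD(2)[OF g(1)] by (simp add: Bochner_Integration.integral_sum)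
    finally show ?thesis .
  qed
  define C where "C = 2 * B * sqrt (LBINT x. (w x)\<^sup>2)"
  have lip: "(LBINT x. \<bar>(w (x + h))\<^sup>2 - (w x)\<^sup>2\<bar>) \<le> C * norm h" for h
    unfolding C_def by (rule square_translation_bound[OF w B(1) wt])
  have inv: "AE x in lborel. (w x)\<^sup>2 = (w (R x))\<^sup>2" if "orthogonal_transformation R" for R
    by (rule minimizer_density_invariant[OF that min u2 uw w g K lip])
  have \<rho>m: "(\<lambda>x. (w x)\<^sup>2) \<in> borel_measurable borel" using sq_integrableD(1)[OF w] by simp
  \<comment> \<open>the averages are radial, so each can be read off on a fixed ray\<close>
  define a where "a n z = ball_integral (\<lambda>x. (w x)\<^sup>2) z ((1/2)^n) / ball_vol ((1/2)^n)" for n z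
  define G where "G t = complex_of_real (sqrt (lim (\<lambda>n. a n (t *\<^sub>R axis 1 1))))" for t
  have a: "a n z = a n (norm z *\<^sub>R axis 1 1)" for n z
    unfolding a_def using ball_integral_radial[OF \<rho>m inv, of z "norm z *\<^sub>R axis 1 1"] by (simp add: norm_axis_1)
  have "AE z in lborel. (\<lambda>n. a n z) \<longlonglongrightarrow> (w z)\<^sup>2"
    unfolding a_def by (rule ball_averages_converge[OF sq_integrableD(2)[OF w] lip])
  then have "AE z in lebesgue. (\<lambda>n. a n z) \<longlonglongrightarrow> (w z)\<^sup>2" by (rule AE_completion)
  then have "AE z in lebesgue. u z = G (norm z)"
    using uw
  proof eventually_elim
    case (elim z)
    have "lim (\<lambda>n. a n (norm z *\<^sub>R axis 1 1)) = (w z)\<^sup>2"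
      using elim(1) a[of _ z] by (simp add: limI)
    then show ?case using elim(2) unfolding G_def by (simp add: w_def)
  qed
  then show ?thesis unfolding radially_symmetric_def by blast
qed

end
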